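(* For all integers $r\ge 3$, $k\ge 1$ and $1\le s\le r$, one has $$\delta_{\mathrm{hom}}(T_{r,k}^{s})=\frac{2r-5}{2r-3}.$$
   Context: All graphs are finite and simple. A graph is $H$-free if it contains no (not necessarily induced) subgraph isomorphic to $H$. $\delta(G)$ denotes the minimum degree of $G$. A homomorphism $G\to F$ is a map $V(G)\to V(F)$ sending edges to edges; we write $G\xrightarrow{\mathrm{hom}}F$ if one exists. The homomorphism threshold of a graph $H$ is $$\delta_{\mathrm{hom}}(H):=\inf\{\alpha\ge 0:\ \text{there is a (finite) } H\text{-free graph } F=F(H,\alpha)\text{ such that every } H\text{-free graph } G \text{ with } \delta(G)\ge \alpha|V(G)| \text{ satisfies } G\xrightarrow{\mathrm{hom}}F\}.$$ For integers $r\ge 3$, $k\ge 1$, $1\le s\le r$, $T_{r,k}^{s}$ is the graph obtained from $k$ copies of the complete graph $K_r$ by identifying a common clique of order $s$ and keeping all remaining vertices disjoint (so it has $s+k(r-s)$ vertices; if $k=1$ or $s=r$ then $T_{r,k}^s=K_r$). *)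

theory Defs
  imports Complex_Main "Graph_Theory.Graph_Theory"
begin

text \<open>A finite simple graph is a \<^locale>\<open>pair_graph\<close>: a finite, loop-free, symmetric digraph
  whose arcs are pairs of vertices, each edge \<open>uv\<close> being the two arcs \<open>(u, v)\<close> and \<open>(v, u)\<close>.
  Thus the (total) degree of a vertex is its out-degree.\<close>

definition contains_copy :: "'a pair_pre_digraph \<Rightarrow> 'b pair_pre_digraph \<Rightarrow> bool" where
  "contains_copy H G \<longleftrightarrow>
     (\<exists>H' :: 'b pair_pre_digraph. pair_graph H' \<and>
        subgraph (with_proj H') (with_proj G) \<and> digraph_iso (with_proj H) (with_proj H'))"

definition free_of :: "'a pair_pre_digraph \<Rightarrow> 'b pair_pre_digraph \<Rightarrow> bool" where
  "free_of H G \<longleftrightarrow> \<not> contains_copy H G"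

text \<open>Meaningful only for graphs with at least one vertex.\<close>

definition min_degree :: "'a pair_pre_digraph \<Rightarrow> nat" where
  "min_degree G = Min (out_degree (with_proj G) ` pverts G)"

definition graph_hom :: "('a \<Rightarrow> 'b) \<Rightarrow> 'a pair_pre_digraph \<Rightarrow> 'b pair_pre_digraph \<Rightarrow> bool" where
  "graph_hom f G F \<longleftrightarrow>
     (\<forall>v \<in> pverts G. f v \<in> pverts F) \<and> (\<forall>(u, v) \<in> parcs G. (f u, f v) \<in> parcs F)"

definition homomorphic_to :: "'a pair_pre_digraph \<Rightarrow> 'b pair_pre_digraph \<Rightarrow> bool" where
  "homomorphic_to G F \<longleftrightarrow> (\<exists>f. graph_hom f G F)"

text \<open>Every finite graph is isomorphic to one with vertices in \<^typ>\<open>nat\<close>, so letting \<open>F\<close> and \<open>G\<close>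
  range over graphs on \<^typ>\<open>nat\<close> loses nothing. The graph without vertices may be included among
  the \<open>G\<close>, whatever its minimum degree: it is homomorphic to every \<open>F\<close>.\<close>

definition hom_threshold :: "'a pair_pre_digraph \<Rightarrow> real" where
  "hom_threshold H = Inf {\<alpha> :: real. \<alpha> \<ge> 0 \<and>
     (\<exists>F :: nat pair_pre_digraph. pair_graph F \<and> free_of H F \<and>
        (\<forall>G :: nat pair_pre_digraph.
           pair_graph G \<and> free_of H G \<and> real (min_degree G) \<ge> \<alpha> * real (card (pverts G))
             \<longrightarrow> homomorphic_to G F))}"

text \<open>The \<open>j\<close>-th copy of \<open>K\<^sub>r\<close> (\<open>1 \<le> j \<le> k\<close>) has vertices \<open>copy_vertex s j i\<close> for \<open>i < r\<close>. Those with
  \<open>i < s\<close> form the common clique: they get the label \<open>(0, i)\<close>, independent of \<open>j\<close>.\<close>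

definition copy_vertex :: "nat \<Rightarrow> nat \<Rightarrow> nat \<Rightarrow> nat \<times> nat" where
  "copy_vertex s j i = (if i < s then (0, i) else (j, i))"

definition T_graph :: "nat \<Rightarrow> nat \<Rightarrow> nat \<Rightarrow> (nat \<times> nat) pair_pre_digraph" where
  "T_graph r k s =
     \<lparr> pverts = {copy_vertex s j i | j i. j \<in> {1..k} \<and> i < r},
       parcs = {(copy_vertex s j a, copy_vertex s j b) | j a b. j \<in> {1..k} \<and> a < r \<and> b < r \<and> a \<noteq> b} \<rparr>"

lemma pair_graph_T_graph: "pair_graph (T_graph r k s)"
proof -
  let ?V = "pverts (T_graph r k s)" and ?E = "parcs (T_graph r k s)"
  have "?V = (\<lambda>(j, i). copy_vertex s j i) ` ({1..k} \<times> {..<r})"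
    by (force simp: T_graph_def)
  hence V: "finite ?V" by simp
  have sub: "?E \<subseteq> ?V \<times> ?V"
    by (auto simp: T_graph_def)
  hence E: "finite ?E" using V by (meson finite_SigmaI finite_subset)
  have symE: "sym ?E"
    by (fastforce simp: T_graph_def sym_def)
  show ?thesis
    using V E sub symE
    by unfold_locales (auto simp: symmetric_def T_graph_def copy_vertex_def split: if_splits)
qed

lemma card_T_graph:
  assumes "k \<ge> 1" "s \<le> r"
  shows "card (pverts (T_graph r k s)) = s + k * (r - s)"
proof -
  have "pverts (T_graph r k s) = ({0} \<times> {..<s}) \<union> ({1..k} \<times> {s..<r})"
    (is "?L = ?R")
  proof
    show "?L \<subseteq> ?R" by (auto simp: T_graph_def copy_vertex_def)
  next
    have "(0, i) \<in> ?L" if "i < s" for i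
    proof -
      have "(0, i) = copy_vertex s 1 i" "1 \<in> {1..k}" "i < r"
        using assms that by (auto simp: copy_vertex_def)
      thus ?thesis unfolding T_graph_def by auto
    qed
    moreover have "(j, i) \<in> ?L" if "j \<in> {1..k}" "s \<le> i" "i < r" for j i
    proof -
      have "(j, i) = copy_vertex s j i" using that by (simp add: copy_vertex_def)
      thus ?thesis using that unfolding T_graph_def by auto
    qed
    ultimately show "?R \<subseteq> ?L" by auto
  qed
  moreover have "card (({0} \<times> {..<s}) \<union> ({1..k} \<times> {s..<r})) = s + k * (r - s)"
    by (subst card_Un_disjoint) auto
  ultimately show ?thesis by simp
qed

end

theory Submission
  imports Defs "HOL-Library.Ramsey" "HOL-Combinatorics.Permutations"
begin

text \<open>Upper bound. Put \<open>\<theta> = (2r - 5)/(2r - 3)\<close>, so that in the graphs considered every vertex misses at most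
  \<open>m\<close> vertices, where \<open>(2r - 3)m \<le> (2 - \<epsilon>)n\<close>. Let first \<open>G\<close> be \<open>K\<^sub>r\<close>-free, and let \<open>F\<close> be a \<open>K\<^sub>r\<close>-free homomorphic
  image of \<open>G\<close> with as few vertices and then as many edges as possible, weighted by the sizes of the fibres.
  Vertices of \<open>F\<close> whose neighbourhoods differ by little weight could be identified, so the neighbourhoods
  are pairwise far apart. Adding an edge to \<open>F\<close> creates a \<open>K\<^sub>r\<close>, and this bounds the size of a set shattered by
  the neighbourhoods. By the Sauer-Shelah lemma and a sampling argument, \<open>F\<close> has bounded size. Both steps
  count, over all vertices \<open>z\<close>, how many vertices of a small configuration \<open>z\<close> misses.

  Let now \<open>G\<close> be \<open>T\<close>-free and large. Call a clique heavy if it extends to a \<open>K\<^sub>r\<close> even after a bounded number of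
  vertices is forbidden. Every \<open>K\<^sub>r\<close> contains heavy cliques of every size between 2 and \<open>r\<close>. If \<open>s \<ge> 2\<close>, a heavy
  clique of size \<open>s\<close> is the core of a copy of \<open>T\<close>, so \<open>G\<close> is \<open>K\<^sub>r\<close>-free. If \<open>s = 1\<close>, the heavy pairs cover a set \<open>X\<close>
  of bounded size, and every \<open>K\<^sub>r\<close> through \<open>v\<close> contains a heavy pair \<open>e\<close> for which \<open>e \<union> {v}\<close> is heavy. The
  argument for \<open>K\<^sub>r\<close>-free graphs preserves this last property, and it makes the image \<open>T\<close>-free.

  Lower bound. For \<open>r = 3\<close> this is Hajnal's construction, with the Kneser graph replaced by a graph whose
  chromatic number is unbounded by Ramsey's theorem. For larger \<open>r\<close>, independent sets are joined to it.\<close>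

section \<open>Dense weighted graphs\<close>

text \<open>The constant comes from one tight count. Merging two close non-neighbours
  \<open>v\<close> and \<open>v'\<close> can fail because of a clique with \<open>r - 3\<close>
  vertices adjacent to both and two private ones. Common neighbours of those \<open>r - 3\<close>
  vertices miss at least one private vertex, and those adjacent also to \<open>v\<close> and
  \<open>v'\<close> may be assumed to miss both. Up to an error term, twice the total weight is then
  at most \<open>(2 * r - 3) * m\<close>, which is exactly what the degree condition forbids. For
  \<open>s = 1\<close> the obstacle is that merging vertices and adding edges creates new cliques,
  so T-freeness is not visibly preserved. Therefore \<open>E\<close> is computed once in G and then
  frozen: it records pairs that are heavy in G and lie in a small set \<open>X\<close> whose points
  never move. A flower in the image then produces heavy sets of G itself. In the lower bound, the
  chromatic number of Kneser graphs would call for a topological argument. Sets of permutations of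
  density just below one half, whose disjointness follows from an order argument, allow Ramsey's
  theorem instead.\<close>

definition is_clique :: "('a \<times> 'a) set \<Rightarrow> 'a set \<Rightarrow> bool" where
  "is_clique A K \<longleftrightarrow> (\<forall>x\<in>K. \<forall>y\<in>K. x \<noteq> y \<longrightarrow> (x, y) \<in> A)"

text \<open>With \<open>E = (\<lambda>_. {})\<close> this says that there is no \<open>r\<close>-clique at all. In general a member of \<open>E p\<close> is a set
  that an \<open>r\<close>-clique through \<open>p\<close> is allowed to contain.\<close>

definition good :: "nat \<Rightarrow> 'a set \<Rightarrow> ('a \<times> 'a) set \<Rightarrow> ('a \<Rightarrow> 'a set set) \<Rightarrow> bool" where
  "good r V A E \<longleftrightarrow>
     (\<forall>K \<subseteq> V. is_clique A K \<and> card K = r \<longrightarrow> (\<forall>p\<in>K. \<exists>e\<in>E p. e \<subseteq> K))"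

lemma is_clique_subset: "is_clique A K \<Longrightarrow> L \<subseteq> K \<Longrightarrow> is_clique A L"
  by (auto simp: is_clique_def)

lemma is_clique_insert:
  assumes "sym A" "is_clique A K" "K \<subseteq> A `` {v}"
  shows "is_clique A (insert v K)"
  using assms by (fastforce simp: is_clique_def sym_def)

definition common_nbhd :: "'a set \<Rightarrow> ('a \<times> 'a) set \<Rightarrow> 'a set \<Rightarrow> 'a set" where
  "common_nbhd V A Z = {v \<in> V. \<forall>z\<in>Z. (z, v) \<in> A}"

lemma card_lt_2: "finite T \<Longrightarrow> \<not> 2 \<le> card T \<Longrightarrow> T = {} \<or> (\<exists>d. T = {d})"
  by (metis One_nat_def Suc_1 card_1_singletonE card_0_eq le_less_Suc_eq less_one not_le)

text \<open>The weight of a vertex will be the size of its fibre under a homomorphism. The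
  hypothesis bounds the missed weight, not the degree, because this bound passes to homomorphic
  images. A vertex counts among those it misses.\<close>

locale weighted_graph =
  fixes V :: "'a set" and A :: "('a \<times> 'a) set" and w :: "'a \<Rightarrow> real" and m :: real
  assumes finV: "finite V" and symA: "sym A" and irreflA: "irrefl A" and AV: "A \<subseteq> V \<times> V"
    and w_nonneg: "\<And>v. 0 \<le> w v"
    and miss: "\<And>v. v \<in> V \<Longrightarrow> sum w (V - A `` {v}) \<le> m"
begin

lemma nbhd_subset: "A `` {v} \<subseteq> V"
  using AV by auto

lemma adj_sym: "(x, y) \<in> A \<longleftrightarrow> (y, x) \<in> A"
  using symA by (auto dest: symD)

lemma not_adj_self: "(x, x) \<notin> A"
  using irreflA by (auto dest: irreflD)

lemma sum_w_mono: "S \<subseteq> T \<Longrightarrow> T \<subseteq> V \<Longrightarrow> sum w S \<le> sum w T"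
  using finV by (intro sum_mono2) (auto intro: finite_subset w_nonneg)

text \<open>Double counting of the non-adjacent pairs \<open>(z, d)\<close> with weight
  \<open>w z * c d\<close>. Summed over \<open>z\<close> first, each \<open>d\<close> contributes at
  most \<open>c d * m\<close> by symmetry of \<open>A\<close>. The degree condition enters almost
  every later argument in this form: \<open>c\<close> prices the vertices of a small configuration
  \<open>W\<close>, and \<open>g\<close> is the price that \<open>z\<close> must miss.\<close>

lemma miss_count:
  assumes S: "S \<subseteq> V" and W: "W \<subseteq> V" and c: "\<And>d. 0 \<le> c d"
    and g: "\<And>z. z \<in> S \<Longrightarrow> g z \<le> sum c (W - A `` {z})"
  shows "(\<Sum>z\<in>S. w z * g z) \<le> sum c W * m"
proof -
  have fS: "finite S" and fW: "finite W"
    using finV S W by (auto intro: finite_subset)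
  have "(\<Sum>z\<in>S. w z * g z) \<le> (\<Sum>z\<in>S. w z * sum c (W - A `` {z}))"
    by (intro sum_mono mult_left_mono g w_nonneg)
  also have "\<dots> = (\<Sum>z\<in>S. \<Sum>d\<in>W. if (z, d) \<notin> A then w z * c d else 0)"
  proof (rule sum.cong[OF refl])
    fix z
    have "W - A `` {z} = {d \<in> W. (z, d) \<notin> A}"
      by auto
    then show "w z * sum c (W - A `` {z}) = (\<Sum>d\<in>W. if (z, d) \<notin> A then w z * c d else 0)"
      using fW by (simp add: sum_distrib_left sum.inter_filter if_distrib mult_ac cong: if_cong)
  qed
  also have "\<dots> = (\<Sum>d\<in>W. \<Sum>z\<in>S. if (z, d) \<notin> A then w z * c d else 0)"
    by (rule sum.swap)
  also have "\<dots> \<le> (\<Sum>d\<in>W. c d * m)"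
  proof (rule sum_mono)
    fix d
    assume d: "d \<in> W"
    have "(\<Sum>z\<in>S. if (z, d) \<notin> A then w z * c d else 0) = c d * sum w {z \<in> S. (z, d) \<notin> A}"
      using fS by (simp add: sum_distrib_left sum.inter_filter if_distrib mult_ac cong: if_cong)
    also have "\<dots> \<le> c d * sum w (V - A `` {d})"
      using S adj_sym by (intro mult_left_mono sum_w_mono c) auto
    also have "\<dots> \<le> c d * m"
      using W d by (intro mult_left_mono miss c) auto
    finally show "(\<Sum>z\<in>S. if (z, d) \<notin> A then w z * c d else 0) \<le> c d * m" .
  qed
  also have "\<dots> = sum c W * m"
    by (simp add: sum_distrib_right)
  finally show ?thesis .
qed

lemma common_nbhd_weight:
  assumes S: "S \<subseteq> V" and Z: "Z \<subseteq> V"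
  shows "sum w S - real (card Z) * m \<le> sum w (S \<inter> common_nbhd V A Z)"
proof -
  have fS: "finite S" and fZ: "finite Z"
    using finV S Z by (auto intro: finite_subset)
  have "sum w (S - common_nbhd V A Z) = (\<Sum>z\<in>S - common_nbhd V A Z. w z * 1)"
    by simp
  also have "\<dots> \<le> sum (\<lambda>_. 1) Z * m"
  proof (rule miss_count)
    fix z
    assume "z \<in> S - common_nbhd V A Z"
    then have ne: "Z - A `` {z} \<noteq> {}"
      using S adj_sym by (auto simp: common_nbhd_def)
    have "finite (Z - A `` {z})"
      using fZ by simp
    then have "0 < card (Z - A `` {z})"
      using ne by (simp add: card_gt_0_iff)
    then show "1 \<le> (\<Sum>_\<in>Z - A `` {z}. 1::real)"
      by simp
  qed (use S Z in auto)
  finally have "sum w (S - common_nbhd V A Z) \<le> real (card Z) * m"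
    by simp
  moreover have "sum w S = sum w (S \<inter> common_nbhd V A Z) + sum w (S - common_nbhd V A Z)"
    using fS by (metis sum.Int_Diff)
  ultimately show ?thesis by linarith
qed

end

section \<open>Cliques controlled by a light set \<open>X\<close>, and merging of vertices\<close>

locale dense_good = weighted_graph +
  fixes X :: "'a set" and E :: "'a \<Rightarrow> 'a set set" and r :: nat and \<beta> :: real
  assumes XV: "X \<subseteq> V" and E: "\<And>v e. v \<in> V \<Longrightarrow> e \<in> E v \<Longrightarrow> e \<subseteq> X \<and> 2 \<le> card e"
    and good: "good r V A E" and r3: "3 \<le> r"
    and dense: "(2 * real r - 3) * m + \<beta> \<le> 2 * sum w V"
    and light: "4 * sum w X \<le> \<beta>" and \<beta>_pos: "0 < \<beta>"
begin

lemma goodD: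
  assumes "K \<subseteq> V" "is_clique A K" "card K = r" "p \<in> K"
  obtains e where "e \<in> E p" "e \<subseteq> K" "e \<subseteq> X" "2 \<le> card e"
proof -
  obtain e where "e \<in> E p" "e \<subseteq> K"
    using good assms unfolding good_def by blast
  then show ?thesis
    using that E[of p e] assms by blast
qed

lemma weight_diff_light:
  assumes "S \<subseteq> V"
  shows "sum w S - \<beta> / 4 \<le> sum w (S - X)"
proof -
  have fS: "finite S"
    using finV assms by (auto intro: finite_subset)
  have "sum w S = sum w (S \<inter> X) + sum w (S - X)"
    using fS by (metis sum.Int_Diff)
  moreover have "sum w (S \<inter> X) \<le> sum w X"
    using XV by (intro sum_w_mono) auto
  ultimately show ?thesis using light by linarith
qed

text \<open>Replacement vertices are always taken outside \<open>X\<close>: members of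
  \<open>E p\<close> lie inside \<open>X\<close>, so a new vertex can never help a clique to contain
  one. Since \<open>X\<close> is light, this restriction costs only
  \<open>\<beta> / 4\<close>.\<close>

lemma common_nbhd_weight_light:
  assumes "S \<subseteq> V" "Z \<subseteq> V"
  shows "sum w S - real (card Z) * m - \<beta> / 4 \<le> sum w (S \<inter> (common_nbhd V A Z - X))"
proof -
  have "S \<inter> common_nbhd V A Z \<subseteq> V"
    using assms by auto
  then have "sum w (S \<inter> common_nbhd V A Z) - \<beta> / 4 \<le> sum w (S \<inter> common_nbhd V A Z - X)"
    by (rule weight_diff_light)
  moreover have "S \<inter> common_nbhd V A Z - X = S \<inter> (common_nbhd V A Z - X)"
    by auto
  ultimately show ?thesis
    using common_nbhd_weight[OF assms] by simp
qed

lemma m_nonneg: "v \<in> V \<Longrightarrow> 0 \<le> m"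
  using miss[of v] sum_nonneg[of "V - A `` {v}" w] w_nonneg by (auto intro: order_trans)

text \<open>If \<open>D\<close> existed, identifying \<open>v\<close> with \<open>v'\<close> would create a forbidden clique. As long as possible, vertices of
  \<open>D\<close> are replaced by common neighbours of \<open>v\<close> and \<open>v'\<close>. In the end almost every such common neighbour misses
  two of the remaining vertices of \<open>D\<close>, where a vertex \<open>p\<close> witnessing that \<open>D\<close> is forbidden counts twice,
  since \<open>p\<close> itself cannot be replaced.\<close>

lemma close_same_type_no_mixed_clique:
  assumes v: "v \<in> V - X" and v': "v' \<in> V - X" and na: "(v, v') \<notin> A" and Ev: "E v = E v'"
    and NX: "A `` {v} \<inter> X = A `` {v'} \<inter> X"
    and close: "sum w V - m - \<beta> / 8 \<le> sum w (A `` {v} \<inter> A `` {v'})"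
  shows "\<lbrakk>D \<subseteq> V; is_clique A D; card D = r - 1; D \<subseteq> A `` {v} \<union> A `` {v'}; p \<in> insert v D;
          \<forall>e\<in>E p. \<not> e \<subseteq> D\<rbrakk> \<Longrightarrow> False"
proof (induction "card (D - (A `` {v} \<inter> A `` {v'} - X))" arbitrary: D p rule: less_induct)
  case less
  note IH = less.hyps and D = less.prems
  define M where "M = A `` {v} \<inter> A `` {v'}"
  define W where "W = D - (M - X)"
  define Z where "Z = D \<inter> (M - X)"
  define U where "U = common_nbhd V A Z - X"
  have fD: "finite D"
    using D(1) finV by (rule finite_subset)
  have MV: "M \<subseteq> V"
    using nbhd_subset by (auto simp: M_def)
  have m0: "0 \<le> m"
    using v m_nonneg by auto
  \<comment> \<open>Otherwise \<open>insert u D\<close> is an \<open>r\<close>-clique already before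
    merging. Since \<open>u\<close> is outside \<open>X\<close> and \<open>E v = E v'\<close>, the
    set supplied by \<open>good\<close> lies in \<open>D\<close>, against the choice of
    \<open>p\<close>.\<close>
  have not_sub: "\<not> D \<subseteq> A `` {u}" if u: "u \<in> {v, v'}" for u
  proof
    assume sub: "D \<subseteq> A `` {u}"
    have uD: "u \<notin> D"
      using sub not_adj_self by auto
    have K: "is_clique A (insert u D)" "card (insert u D) = r" "insert u D \<subseteq> V"
      using is_clique_insert[OF symA D(2) sub] D(1,3) uD fD u v v' r3 by auto
    define p' where "p' = (if p = v then u else p)"
    have p': "p' \<in> insert u D" "E p' = E p"
      using D(5) u Ev by (auto simp: p'_def)
    obtain e where "e \<in> E p'" "e \<subseteq> insert u D" "e \<subseteq> X"
      by (rule goodD[OF K(3,1,2) p'(1)])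
    then have "e \<in> E p" "e \<subseteq> D"
      using p' u v v' by auto
    then show False
      using D(6) by blast
  qed
  obtain d1 d2 where d1: "d1 \<in> D" "d1 \<notin> A `` {v'}" and d2: "d2 \<in> D" "d2 \<notin> A `` {v}"
    using not_sub[of v] not_sub[of v'] by auto
  \<comment> \<open>They differ because each vertex of \<open>D\<close> is adjacent to
    \<open>v\<close> or \<open>v'\<close>, and they avoid \<open>X\<close> because \<open>v\<close>
    and \<open>v'\<close> have the same neighbours there.\<close>
  have d12: "d1 \<noteq> d2" "d1 \<in> W" "d2 \<in> W" "d1 \<notin> X" "d2 \<notin> X"
    using d1 d2 D(4) NX by (auto simp: W_def M_def)
  have fW: "finite W" and WV: "W \<subseteq> V" and ZV: "Z \<subseteq> V" and ZX: "Z \<inter> X = {}" and WZ: "D = W \<union> Z" "W \<inter> Z = {}"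
    using fD D(1) by (auto simp: W_def Z_def)
  have q2: "2 \<le> card W"
    using card_mono[OF fW, of "{d1, d2}"] d12 by auto
  have cZ: "card W + card Z = r - 1"
    using WZ fD D(3) card_Un_disjoint[of W Z] by (simp add: finite_subset)
  have UV: "U \<subseteq> V"
    by (auto simp: U_def common_nbhd_def)
  have zZ: "Z \<subseteq> A `` {z}" if "z \<in> U" for z
    using that adj_sym by (auto simp: U_def common_nbhd_def)
  have replace: False
    if z: "z \<in> M" "z \<in> U" and d0: "d0 \<in> W" "W - {d0} \<subseteq> A `` {z}"
      and p': "p' \<in> insert v D" "p' \<noteq> d0" "\<forall>e\<in>E p'. \<not> e \<subseteq> D" for z d0 p'
  proof -
    define D' where "D' = insert z (D - {d0})"
    have zX: "z \<notin> X" and zM: "z \<in> M - X"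
      using z by (auto simp: U_def)
    have adj: "D - {d0} \<subseteq> A `` {z}"
      using zZ[OF z(2)] d0 WZ by auto
    have zD: "z \<notin> D - {d0}"
      using adj not_adj_self by auto
    have dD: "d0 \<in> D"
      using d0 WZ by auto
    have "is_clique A D'"
      unfolding D'_def using is_clique_insert[OF symA is_clique_subset[OF D(2)] adj] by auto
    moreover have "card D' = r - 1"
      unfolding D'_def using zD dD fD D(3) by (metis card_Suc_Diff1 card_insert_disjoint finite_Diff)
    moreover have "D' \<subseteq> V" "D' \<subseteq> A `` {v} \<union> A `` {v'}"
      unfolding D'_def using D(1,4) z MV by (auto simp: M_def)
    moreover have "p' \<in> insert v D'"
      using p' by (auto simp: D'_def)
    moreover have "\<forall>e\<in>E p'. \<not> e \<subseteq> D'"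
    proof (intro ballI notI)
      fix e
      assume e: "e \<in> E p'" "e \<subseteq> D'"
      have "p' \<in> V"
        using p' v D(1) by auto
      then have "e \<subseteq> X"
        using E e(1) by simp
      then have "e \<subseteq> D"
        using e(2) zX by (auto simp: D'_def)
      then show False
        using p'(3) e(1) by simp
    qed
    moreover have "card (D' - (A `` {v} \<inter> A `` {v'} - X)) < card (D - (A `` {v} \<inter> A `` {v'} - X))"
    proof -
      have "D' - (M - X) \<subseteq> W - {d0}"
        using zM by (auto simp: D'_def W_def)
      then have "card (D' - (M - X)) \<le> card (W - {d0})"
        using fW by (intro card_mono) auto
      also have "\<dots> < card W"
        using fW d0 by (intro psubset_card_mono) auto
      finally show ?thesis
        by (simp add: W_def M_def)
    qed
    ultimately show False
      using IH[of D' p'] by blast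
  qed
  have wU: "sum w V - real (card Z) * m - \<beta> / 4 \<le> sum w U"
    using common_nbhd_weight_light[of V Z] ZV UV by (simp add: U_def Int_absorb1)
  have "sum w M - real (card Z) * m - \<beta> / 4 \<le> sum w (M \<inter> U)"
    using common_nbhd_weight_light[OF MV ZV] by (simp add: U_def)
  then have wMU: "sum w V - m - real (card Z) * m - 3 * \<beta> / 8 \<le> sum w (M \<inter> U)"
    using close by (simp add: M_def)
  have cZ': "real (card Z) = real r - 1 - real (card W)"
    using cZ r3 by linarith
  have one: "W - A `` {z} \<noteq> {}" if z: "z \<in> U" and p': "p' \<in> V" "p' \<in> insert z D" "\<forall>e\<in>E p'. \<not> e \<subseteq> D" for z p'
  proof
    assume "W - A `` {z} = {}"
    then have adj: "D \<subseteq> A `` {z}"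
      using WZ zZ[OF z] by auto
    have zD: "z \<notin> D"
      using adj not_adj_self by auto
    have K: "insert z D \<subseteq> V" "is_clique A (insert z D)" "card (insert z D) = r"
      using is_clique_insert[OF symA D(2) adj] zD fD D(1,3) r3 z UV by auto
    obtain e where "e \<in> E p'" "e \<subseteq> insert z D" "e \<subseteq> X"
      by (rule goodD[OF K p'(2)])
    then show False
      using p' z by (auto simp: U_def)
  qed
  have wU_split: "(\<Sum>z\<in>U. w z * (if z \<in> M then 2 else 1)) = sum w U + sum w (M \<inter> U)"
  proof -
    have fU: "finite U"
      using UV finV by (rule finite_subset)
    have "(\<Sum>z\<in>U. w z * (if z \<in> M then 2 else 1)) = (\<Sum>z\<in>U. w z + (if z \<in> M then w z else 0))"
      by (intro sum.cong) auto
    also have "\<dots> = sum w U + sum w (U \<inter> M)"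
      using fU by (simp add: sum.distrib sum.inter_restrict)
    finally show ?thesis by (simp add: Int_commute)
  qed
  have mono: "real (card W) \<ge> 3 \<Longrightarrow> (2 * real r - real (card W)) * m \<le> (2 * real r - 3) * m"
    using m0 by (intro mult_right_mono) auto
  show False
  proof (cases "\<forall>e\<in>E v. \<not> e \<subseteq> D")
    case True
    have two: "2 \<le> card (W - A `` {z})" if z: "z \<in> M" "z \<in> U" for z
    proof (rule ccontr)
      assume "\<not> 2 \<le> card (W - A `` {z})"
      then obtain d0 where "d0 \<in> W" "W - A `` {z} \<subseteq> {d0}"
        using fW d12(2) card_lt_2[of "W - A `` {z}"] by blast
      moreover have "v \<noteq> d0"
        using \<open>d0 \<in> W\<close> WZ D(4) na not_adj_self adj_sym by auto
      ultimately show False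
        using replace[OF z, of d0 v] True by blast
    qed
    show False
    proof (cases "card W = 2")
      case c2: True
      \<comment> \<open>The tight case. Here \<open>card Z = r - 3\<close>, so \<open>wU\<close> and
        \<open>wMU\<close> together lose \<open>(2 * r - 5) * m\<close>; with the
        \<open>2 * m\<close> from the count this is exactly the coefficient
        \<open>2 * r - 3\<close>. That a vertex of \<open>U\<close> outside \<open>M\<close> misses
        something needs \<open>D\<close> to be disjoint from \<open>X\<close>, so that no member of
        \<open>E z\<close> fits into \<open>D\<close>.\<close>
      have "W = {d1, d2}"
        using card_subset_eq[of W "{d1, d2}"] c2 d12 fW by auto
      then have DX: "D \<inter> X = {}"
        using WZ ZX d12 by auto
      have "(\<Sum>z\<in>U. w z * (if z \<in> M then 2 else 1)) \<le> sum (\<lambda>_. 1) W * m"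
      proof (rule miss_count)
        fix z
        assume z: "z \<in> U"
        have "\<forall>e\<in>E z. \<not> e \<subseteq> D"
        proof (intro ballI notI)
          fix e
          assume "e \<in> E z" "e \<subseteq> D"
          then have "e \<subseteq> D \<inter> X" "2 \<le> card e"
            using E z UV by blast+
          then show False
            using DX by simp
        qed
        then have "W - A `` {z} \<noteq> {}"
          using one[OF z, of z] z UV by auto
        then have "1 \<le> card (W - A `` {z})"
          using fW by (simp add: Suc_le_eq card_gt_0_iff)
        then show "(if z \<in> M then 2 else 1) \<le> (\<Sum>_\<in>W - A `` {z}. 1::real)"
          using two[OF _ z] by auto
      qed (use UV WV in auto)
      then have "sum w U + sum w (M \<inter> U) \<le> 2 * m"
        by (simp add: wU_split c2)
      then show False
        using wU wMU dense \<beta>_pos cZ' c2 by (simp add: algebra_simps)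
    next
      case False
      then have q3: "3 \<le> real (card W)"
        using q2 by linarith
      \<comment> \<open>Now \<open>M \<inter> U\<close> alone is enough: twice its lower bound
        against \<open>card W * m\<close> gives the coefficient \<open>2 * r - card W\<close>, which
        is at most \<open>2 * r - 3\<close>.\<close>
      have "(\<Sum>z\<in>M \<inter> U. w z * 2) \<le> sum (\<lambda>_. 1) W * m"
        using two by (intro miss_count) (use UV WV in auto)
      then have "2 * sum w (M \<inter> U) \<le> real (card W) * m"
        by (simp add: sum_distrib_left mult.commute)
      then show False
        using wMU dense \<beta>_pos mono[OF q3] by (simp add: cZ' algebra_simps)
    qed
  next
    case nv: False
    have pD: "p \<in> D"
      using D(5,6) nv by auto
    have q3: "3 \<le> real (card W)"
    proof (rule ccontr)
      assume "\<not> ?thesis"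
      then have "card W = 2"
        using q2 by linarith
      then have "W = {d1, d2}"
        using card_subset_eq[of W "{d1, d2}"] d12 fW by auto
      then have "D \<inter> X = {}"
        using WZ ZX d12 by auto
      moreover obtain e where "e \<in> E v" "e \<subseteq> D"
        using nv by blast
      moreover have "e \<subseteq> X" "2 \<le> card e"
        using E[of v e] v \<open>e \<in> E v\<close> by auto
      ultimately have "e \<subseteq> {}"
        by blast
      then show False
        using \<open>2 \<le> card e\<close> by simp
    qed
    \<comment> \<open>The extra unit of price for \<open>p\<close> is paid for by counting over
      \<open>U\<close> and \<open>M \<inter> U\<close> once each instead of
      \<open>M \<inter> U\<close> twice, since the bound for \<open>U\<close> is better by
      \<open>m\<close>. The coefficient is again \<open>2 * r - card W\<close>.\<close>
    define c :: "'a \<Rightarrow> real" where "c = (\<lambda>d. if d = p then 2 else 1)"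
    have "sum c W \<le> real (card W) + 1"
    proof -
      have "sum c W = (\<Sum>d\<in>W. 1 + (if d = p then 1 else 0))"
        by (intro sum.cong) (auto simp: c_def)
      also have "\<dots> = real (card W) + (if p \<in> W then 1 else 0)"
        using fW by (simp add: sum.distrib)
      finally show ?thesis by simp
    qed
    then have cW: "sum c W * m \<le> (real (card W) + 1) * m"
      using m0 by (rule mult_right_mono)
    have "(\<Sum>z\<in>U. w z * (if z \<in> M then 2 else 1)) \<le> sum c W * m"
    proof (rule miss_count)
      fix z
      assume z: "z \<in> U"
      have ne: "W - A `` {z} \<noteq> {}"
        using one[OF z, of p] pD D by auto
      have fin: "finite (W - A `` {z})"
        using fW by simp
      have ge: "real (card (W - A `` {z})) \<le> sum c (W - A `` {z})"
      proof -
        have "(\<Sum>d\<in>W - A `` {z}. 1) \<le> sum c (W - A `` {z})"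
          by (intro sum_mono) (auto simp: c_def)
        then show ?thesis by simp
      qed
      show "(if z \<in> M then 2 else 1) \<le> sum c (W - A `` {z})"
      proof (cases "2 \<le> card (W - A `` {z})")
        case True
        then show ?thesis using ge by auto
      next
        case False
        moreover have "card (W - A `` {z}) > 0"
          using ne fin by (simp add: card_gt_0_iff)
        ultimately have "card (W - A `` {z}) = 1"
          by linarith
        then obtain d0 where d0: "W - A `` {z} = {d0}"
          by (auto simp: card_1_singleton_iff)
        show ?thesis
        proof (cases "z \<in> M \<and> d0 \<noteq> p")
          case True
          then show ?thesis
            using replace[of z d0 p] z d0 D(5,6) by blast
        next
          case False
          then show ?thesis
            by (auto simp: d0 c_def)
        qed
      qed
    qed (use UV WV in \<open>auto simp: c_def\<close>)
    then have "sum w U + sum w (M \<inter> U) \<le> (real (card W) + 1) * m"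
      using cW by (simp add: wU_split)
    then show False
      using wU wMU dense \<beta>_pos mono[OF q3] by (simp add: cZ' algebra_simps)
  qed
qed

end

section \<open>Non-edges forming a co-matching\<close>

context dense_good
begin

lemma weight_nonneg: "0 \<le> sum w V"
  by (intro sum_nonneg w_nonneg)

text \<open>For \<open>q = r - 2\<close> and \<open>Z = {}\<close> the sets \<open>C i\<close> come from the cliques created by adding the edges \<open>s i u i\<close>.
  A vertex \<open>z\<close> that misses less than two of \<open>s i\<close>, \<open>u i\<close> and \<open>C i - Z\<close> for many \<open>i\<close> may replace one vertex of each of
  these \<open>C i\<close>, which leads to the same configuration with \<open>z\<close> added to \<open>Z\<close>.\<close>

lemma co_matching_bound:
  fixes s u :: "'i \<Rightarrow> 'a" and C :: "'i \<Rightarrow> 'a set"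
  assumes "finite I" "Z \<subseteq> V - X"
    and "\<And>i. i \<in> I \<Longrightarrow> s i \<in> V - X \<and> u i \<in> V - X \<and> s i \<noteq> u i \<and> (s i, u i) \<notin> A"
    and "\<And>i. i \<in> I \<Longrightarrow> C i \<subseteq> V \<and> is_clique A (C i) \<and> card (C i) = r - 2 \<and> Z \<subseteq> C i \<and> card (C i - Z) = q"
    and "\<And>i. i \<in> I \<Longrightarrow> C i \<subseteq> A `` {s i} \<inter> A `` {u i}"
    and "\<And>i. i \<in> I \<Longrightarrow> \<exists>p \<in> insert (s i) (insert (u i) (C i)). \<forall>e\<in>E p. \<not> e \<subseteq> C i"
    and "\<And>i j. i \<in> I \<Longrightarrow> j \<in> I \<Longrightarrow> i \<noteq> j \<Longrightarrow> (s i, u j) \<in> A"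
  shows "real (card I) \<le> (4 * sum w V / \<beta>) ^ q"
  using assms
proof (induction q arbitrary: I Z C)
  case 0
  show ?case
  proof (rule ccontr)
    assume "\<not> ?thesis"
    then have "\<not> card I \<le> Suc 0"
      by simp
    then obtain i j where ij: "i \<in> I" "j \<in> I" "i \<noteq> j"
      using card_le_Suc0_iff_eq[OF 0(1)] by auto
    have fC: "finite (C i)" "finite (C j)"
      using 0(4) ij finV by (auto intro: finite_subset)
    \<comment> \<open>With nothing left to replace, all \<open>C i\<close> coincide with
      \<open>Z\<close>. For two different indices, \<open>Z\<close> with \<open>s i\<close> and
      \<open>u j\<close> is then an \<open>r\<close>-clique that avoids \<open>X\<close>.\<close>
    have CZ: "C i = Z" "C j = Z"
      using 0(4)[OF ij(1)] 0(4)[OF ij(2)] fC by auto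
    have sZ: "Z \<subseteq> A `` {s i}" and uZ: "Z \<subseteq> A `` {u j}"
      using 0(5)[OF ij(1)] 0(5)[OF ij(2)] CZ by auto
    have adj: "(s i, u j) \<in> A"
      using 0(7) ij by blast
    have c1: "is_clique A (insert (u j) Z)"
      using is_clique_insert[OF symA _ uZ] 0(4)[OF ij(1)] CZ by auto
    have c2: "is_clique A (insert (s i) (insert (u j) Z))"
      using is_clique_insert[OF symA c1, of "s i"] sZ adj by auto
    have nin: "u j \<notin> Z" "s i \<notin> insert (u j) Z"
      using sZ uZ adj not_adj_self by auto
    have cr: "card (insert (s i) (insert (u j) Z)) = r"
      using nin fC CZ 0(4)[OF ij(1)] r3 by simp
    have sub: "insert (s i) (insert (u j) Z) \<subseteq> V"
      using 0(2,3) ij by auto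
    obtain e where e: "e \<subseteq> insert (s i) (insert (u j) Z)" "e \<subseteq> X" "2 \<le> card e"
      by (rule goodD[OF sub c2 cr insertI1])
    have "e \<subseteq> {}"
      using e(1,2) 0(2) 0(3)[OF ij(1)] 0(3)[OF ij(2)] by auto
    then show False
      using e(3) by simp
  qed
next
  case (Suc q)
  define k where "k = Suc q"
  define B where "B = (4 * sum w V / \<beta>) ^ q"
  define U where "U = common_nbhd V A Z - X"
  define W where "W i = insert (s i) (insert (u i) (C i - Z))" for i
  define P where "P i = {p \<in> insert (s i) (insert (u i) (C i)). \<forall>e\<in>E p. \<not> e \<subseteq> C i}" for i
  define a where "a i = (SOME p. p \<in> P i)" for i
  define T where "T z = {i \<in> I. \<exists>c\<in>C i - Z. \<exists>p\<in>P i - {c}. W i - {c} \<subseteq> A `` {z}}" for z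
  \<comment> \<open>The price of \<open>W i\<close>: its \<open>k + 2\<close> vertices, and one more
    for the doubled witness \<open>a i\<close>. The degree condition can afford
    \<open>2 * k + 1\<close>, so nothing may be doubled when \<open>k = 1\<close>; in that case
    every vertex is a witness, which replaces the doubling.\<close>
  define \<kappa> where "\<kappa> = (if k = 1 then 3 else real k + 3)"
  define c :: "'i \<Rightarrow> 'a \<Rightarrow> real" where "c i d = (if d = a i \<and> 2 \<le> k then 2 else 1)" for i d
  note su = Suc.prems(3) and C = Suc.prems(4) and CN = Suc.prems(5) and adj = Suc.prems(7)
  have kC: "card (C i - Z) = k" if "i \<in> I" for i
    using C[OF that] by (simp add: k_def)
  have k1: "1 \<le> k"
    by (simp add: k_def)
  have fC: "finite (C i)" if "i \<in> I" for i
    using C[OF that] finV by (auto intro: finite_subset)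
  have UV: "U \<subseteq> V"
    by (auto simp: U_def common_nbhd_def)
  have ZV: "Z \<subseteq> V"
    using Suc.prems(2) by auto
  have zZ: "Z \<subseteq> A `` {z}" if "z \<in> U" for z
    using that adj_sym by (auto simp: U_def common_nbhd_def)
  have PV: "p \<in> V" if "i \<in> I" "p \<in> P i" for i p
    using that su[OF that(1)] C[OF that(1)] by (auto simp: P_def)
  have Pne: "a i \<in> P i" if "i \<in> I" for i
  proof -
    have "\<exists>p. p \<in> P i"
      using Suc.prems(6)[OF that] unfolding P_def by blast
    then show ?thesis
      unfolding a_def by (rule someI_ex)
  qed
  have sunC: "s i \<notin> C i" "u i \<notin> C i" if "i \<in> I" for i
    using CN[OF that] not_adj_self by auto
  \<comment> \<open>A member of \<open>E p\<close> has at least two vertices, all in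
    \<open>X\<close>, while \<open>C i\<close> has only one vertex outside \<open>Z\<close>, and
    \<open>Z\<close> avoids \<open>X\<close>.\<close>
  have Pall: "P i = insert (s i) (insert (u i) (C i))" if i: "i \<in> I" and k: "k = 1" for i
  proof -
    have "\<forall>e\<in>E p. \<not> e \<subseteq> C i" if p: "p \<in> insert (s i) (insert (u i) (C i))" for p
    proof (intro ballI notI)
      fix e
      assume e: "e \<in> E p" "e \<subseteq> C i"
      have "p \<in> V"
        using p su[OF i] C[OF i] by auto
      then have "e \<subseteq> X" "2 \<le> card e"
        using E e by auto
      then have "e \<subseteq> C i - Z"
        using e(2) Suc.prems(2) by auto
      then have "card e \<le> card (C i - Z)"
        using fC[OF i] by (intro card_mono) auto
      then show False
        using kC[OF i] k \<open>2 \<le> card e\<close> by simp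
    qed
    then show ?thesis
      by (auto simp: P_def)
  qed
  have T_bound: "real (card (T z)) \<le> B" if z: "z \<in> U" for z
  proof -
    have "\<forall>i\<in>T z. \<exists>x. x \<in> C i - Z \<and> (\<exists>p\<in>P i - {x}. W i - {x} \<subseteq> A `` {z})"
      by (auto simp: T_def)
    then obtain f where f: "\<And>i. i \<in> T z \<Longrightarrow> f i \<in> C i - Z"
        "\<And>i. i \<in> T z \<Longrightarrow> \<exists>p\<in>P i - {f i}. W i - {f i} \<subseteq> A `` {z}"
      by metis
    have TI: "T z \<subseteq> I"
      by (auto simp: T_def)
    define C' where "C' i = insert z (C i - {f i})" for i
    have zadj: "C i - {f i} \<subseteq> A `` {z}" "(z, s i) \<in> A" "(z, u i) \<in> A" if i: "i \<in> T z" for i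
    proof -
      have "W i - {f i} \<subseteq> A `` {z}"
        using f(2)[OF i] by blast
      moreover have "s i \<noteq> f i" "u i \<noteq> f i"
        using sunC[of i] f(1)[OF i] TI i by auto
      ultimately show "C i - {f i} \<subseteq> A `` {z}" "(z, s i) \<in> A" "(z, u i) \<in> A"
        using zZ[OF z] by (auto simp: W_def)
    qed
    have znot: "z \<notin> C i - {f i}" if i: "i \<in> T z" for i
      using zadj(1)[OF i] not_adj_self by auto
    have zX: "z \<notin> X"
      using z by (auto simp: U_def)
    have zV: "z \<in> V"
      using z UV by auto
    show ?thesis
      unfolding B_def
    proof (rule Suc.IH)
      show "finite (T z)"
        using TI Suc.prems(1) by (rule finite_subset)
      show "insert z Z \<subseteq> V - X"
        using Suc.prems(2) zX zV by auto
    next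
      fix i
      assume "i \<in> T z"
      then show "s i \<in> V - X \<and> u i \<in> V - X \<and> s i \<noteq> u i \<and> (s i, u i) \<notin> A"
        using su TI by blast
    next
      fix i
      assume i: "i \<in> T z"
      then have iI: "i \<in> I"
        using TI by auto
      have fi: "f i \<in> C i" "f i \<notin> Z"
        using f(1)[OF i] by auto
      have "C' i \<subseteq> V"
        using C[OF iI] zV by (auto simp: C'_def)
      moreover have "is_clique A (C' i)"
        unfolding C'_def using is_clique_insert[OF symA is_clique_subset zadj(1)[OF i]] C[OF iI] by blast
      moreover have "card (C' i) = r - 2"
      proof -
        have "card (C' i) = Suc (card (C i - {f i}))"
          unfolding C'_def using znot[OF i] fC[OF iI] by (subst card_insert_disjoint) auto
        also have "\<dots> = card (C i)"
          using fC[OF iI] fi(1) by (rule card_Suc_Diff1)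
        finally show ?thesis
          using C[OF iI] by simp
      qed
      moreover have "insert z Z \<subseteq> C' i"
        using C[OF iI] fi by (auto simp: C'_def)
      moreover have "card (C' i - insert z Z) = q"
      proof -
        have "C' i - insert z Z = (C i - Z) - {f i}"
          using znot[OF i] by (auto simp: C'_def)
        then show ?thesis
          using f(1)[OF i] fC[OF iI] kC[OF iI] by (simp add: k_def)
      qed
      ultimately show "C' i \<subseteq> V \<and> is_clique A (C' i) \<and> card (C' i) = r - 2 \<and> insert z Z \<subseteq> C' i
          \<and> card (C' i - insert z Z) = q"
        by blast
      show "C' i \<subseteq> A `` {s i} \<inter> A `` {u i}"
        using CN[OF iI] zadj(2,3)[OF i] adj_sym by (auto simp: C'_def)
      obtain p where p: "p \<in> P i" "p \<noteq> f i"
        using f(2)[OF i] by blast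
      have "\<forall>e\<in>E p. \<not> e \<subseteq> C' i"
      proof (intro ballI notI)
        fix e
        assume e: "e \<in> E p" "e \<subseteq> C' i"
        have "e \<subseteq> X"
          using E[OF PV[OF iI p(1)] e(1)] by simp
        then have "e \<subseteq> C i"
          using e(2) zX by (auto simp: C'_def)
        then show False
          using e(1) p(1) by (simp add: P_def)
      qed
      moreover have "p \<in> insert (s i) (insert (u i) (C' i))"
        using p by (auto simp: P_def C'_def)
      ultimately show "\<exists>p\<in>insert (s i) (insert (u i) (C' i)). \<forall>e\<in>E p. \<not> e \<subseteq> C' i"
        by blast
    next
      fix i j
      assume "i \<in> T z" "j \<in> T z" "i \<noteq> j"
      then show "(s i, u j) \<in> A"
        using adj TI by blast
    qed
  qed
  have two: "2 \<le> sum (c i) (W i - A `` {z})" if z: "z \<in> U" and i: "i \<in> I" "i \<notin> T z" for z i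
  proof -
    have fW: "finite (W i - A `` {z})"
      using fC[OF i(1)] by (simp add: W_def)
    have notT: "\<not> W i - {x} \<subseteq> A `` {z}" if "x \<in> C i - Z" "p \<in> P i" "p \<noteq> x" for x p
      using i that unfolding T_def by blast
    \<comment> \<open>A vertex adjacent to \<open>C i\<close> and to one end \<open>x\<close> of the
      non-edge gives an \<open>r\<close>-clique that really exists in the graph. By
      \<open>good\<close>, the only possible witness left is the other end.\<close>
    have no_ext: False if x: "x \<in> {s i, u i}" and sub: "insert x (C i) \<subseteq> A `` {z}"
        and p: "p \<in> P i" "p \<in> insert x (C i)" for x p
    proof -
      have cl: "is_clique A (insert x (C i))"
        using is_clique_insert[OF symA, of "C i" x] C[OF i(1)] CN[OF i(1)] x by auto
      have cl2: "is_clique A (insert z (insert x (C i)))"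
        using is_clique_insert[OF symA cl sub] .
      have "x \<notin> C i" "z \<notin> insert x (C i)"
        using sunC[OF i(1)] x sub not_adj_self by auto
      then have cr: "card (insert z (insert x (C i))) = r"
        using C[OF i(1)] fC[OF i(1)] r3 by simp
      have sV: "insert z (insert x (C i)) \<subseteq> V"
        using C[OF i(1)] su[OF i(1)] x z UV by auto
      have pin: "p \<in> insert z (insert x (C i))"
        using p by auto
      obtain e where e: "e \<in> E p" "e \<subseteq> insert z (insert x (C i))" "e \<subseteq> X"
        by (rule goodD[OF sV cl2 cr pin])
      have "e \<subseteq> C i"
        using e(2,3) z su[OF i(1)] x by (auto simp: U_def)
      then show False
        using e(1) p(1) by (simp add: P_def)
    qed
    have CZ: "C i - Z \<subseteq> A `` {z} \<Longrightarrow> C i \<subseteq> A `` {z}"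
      using zZ[OF z] by auto
    consider (two) "2 \<le> card (W i - A `` {z})" | (none) "W i - A `` {z} = {}"
      | (one) d where "W i - A `` {z} = {d}"
      using card_lt_2[OF fW] by blast
    then show ?thesis
    proof cases
      case two
      have "(\<Sum>d\<in>W i - A `` {z}. 1) \<le> sum (c i) (W i - A `` {z})"
        by (intro sum_mono) (auto simp: c_def)
      then show ?thesis using two by simp
    next
      case none
      have "\<exists>x\<in>C i - Z. \<exists>p\<in>P i. p \<noteq> x"
      proof (cases "k = 1")
        case True
        have "C i - Z \<noteq> {}"
          using kC[OF i(1)] k1 by (metis card.empty not_one_le_zero)
        then obtain x where x: "x \<in> C i - Z"
          by blast
        then have "s i \<in> P i" "s i \<noteq> x"
          using Pall[OF i(1) True] sunC[OF i(1)] by auto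
        then show ?thesis
          using x by blast
      next
        case False
        then have "\<not> C i - Z \<subseteq> {a i}"
          using kC[OF i(1)] k1 card_mono[of "{a i}" "C i - Z"] by auto
        then obtain x where "x \<in> C i - Z" "a i \<noteq> x"
          by auto
        then show ?thesis
          using Pne[OF i(1)] by (intro bexI[of _ x] bexI[of _ "a i"])
      qed
      then obtain x p where xp: "x \<in> C i - Z" "p \<in> P i" "p \<noteq> x"
        by (elim bexE)
      have "W i - {x} \<subseteq> A `` {z}"
        using none by auto
      then show ?thesis
        using notT[OF xp] by simp
    next
      case (one d)
      have "a i = d \<and> 2 \<le> k"
      proof -
        have adj_z: "y \<in> A `` {z}" if "y \<in> W i" "y \<noteq> d" for y
          using one that by blast
        have "d \<in> W i"
          using one by auto
        then consider (C) "d \<in> C i - Z" | (s) "d = s i" | (u) "d = u i"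
          by (auto simp: W_def)
        then have *: "P i \<subseteq> {d}"
        proof cases
          case C
          then show ?thesis
            using notT[OF C] one by blast
        next
          case s
          have "y \<in> A `` {z}" if "y \<in> C i - Z" for y
            using that sunC[OF i(1)] s by (intro adj_z) (auto simp: W_def)
          moreover have "u i \<in> A `` {z}"
            using su[OF i(1)] s by (intro adj_z) (auto simp: W_def)
          ultimately have sub: "insert (u i) (C i) \<subseteq> A `` {z}"
            using CZ by blast
          show ?thesis
            using no_ext[OF _ sub] s by (auto simp: P_def)
        next
          case u
          have "y \<in> A `` {z}" if "y \<in> C i - Z" for y
            using that sunC[OF i(1)] u by (intro adj_z) (auto simp: W_def)
          moreover have "s i \<in> A `` {z}"
            using su[OF i(1)] u by (intro adj_z) (auto simp: W_def)
          ultimately have sub: "insert (s i) (C i) \<subseteq> A `` {z}"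
            using CZ by blast
          show ?thesis
            using no_ext[OF _ sub] u by (auto simp: P_def)
        qed
        have "k \<noteq> 1"
          using * Pall[OF i(1)] su[OF i(1)] by auto
        then show ?thesis
          using * Pne[OF i(1)] k1 by auto
      qed
      then show ?thesis
        using one by (simp add: c_def)
    qed
  qed
  have wU: "sum w V - real (card Z) * m - \<beta> / 4 \<le> sum w U"
    using common_nbhd_weight_light[of V Z] ZV UV by (simp add: U_def Int_absorb1)
  show ?case
  proof (cases "I = {}")
    case True
    then show ?thesis
      using weight_nonneg \<beta>_pos by simp
  next
    case False
    then obtain i0 where i0: "i0 \<in> I"
      by blast
    have m0: "0 \<le> m"
      using m_nonneg su[OF i0] by blast
    have cZ: "real (card Z) = real r - 2 - real k"
    proof -
      have "card (C i0 - Z) = card (C i0) - card Z"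
        using C[OF i0] fC[OF i0] by (intro card_Diff_subset) (auto intro: finite_subset)
      moreover have "card Z \<le> card (C i0)"
        using C[OF i0] fC[OF i0] by (intro card_mono) auto
      ultimately show ?thesis
        using C[OF i0] kC[OF i0] r3 by linarith
    qed
    \<comment> \<open>Since \<open>card Z = r - 2 - k\<close>, passing to \<open>U\<close> uses up
      \<open>2 * (r - 2 - k)\<close> of the coefficient \<open>2 * r - 3\<close> and leaves
      \<open>2 * k + 1\<close>.\<close>
    have \<kappa>: "\<kappa> * m + \<beta> / 2 \<le> 2 * sum w U"
    proof -
      have "\<kappa> \<le> 2 * real k + 1"
        using k1 by (auto simp: \<kappa>_def)
      then have "\<kappa> * m \<le> (2 * real k + 1) * m"
        using m0 by (rule mult_right_mono)
      then show ?thesis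
        using wU dense by (simp add: cZ algebra_simps)
    qed
    have sc: "sum (c i) (W i) \<le> \<kappa>" if i: "i \<in> I" for i
    proof -
      have fW: "finite (W i)"
        using fC[OF i] by (simp add: W_def)
      have cW: "card (W i) = k + 2"
        using kC[OF i] fC[OF i] su[OF i] sunC[OF i] by (simp add: W_def)
      have "sum (c i) (W i) = (\<Sum>d\<in>W i. 1 + (if d = a i then (if 2 \<le> k then 1 else 0) else 0))"
        by (intro sum.cong) (auto simp: c_def)
      also have "\<dots> = real (k + 2) + (if a i \<in> W i then (if 2 \<le> k then 1 else 0) else 0)"
        using fW by (simp add: sum.distrib cW)
      also have "\<dots> \<le> \<kappa>"
        using k1 by (auto simp: \<kappa>_def)
      finally show ?thesis .
    qed
    have row: "(\<Sum>z\<in>U. w z * (if i \<in> T z then 0 else 2)) \<le> \<kappa> * m" if i: "i \<in> I" for i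
    proof -
      have "(\<Sum>z\<in>U. w z * (if i \<in> T z then 0 else 2)) \<le> sum (c i) (W i) * m"
      proof (rule miss_count[OF UV])
        show "W i \<subseteq> V"
          using C[OF i] su[OF i] by (auto simp: W_def)
        show "0 \<le> c i d" for d
          by (simp add: c_def)
        fix z
        assume "z \<in> U"
        moreover have "0 \<le> sum (c i) (W i - A `` {z})"
          by (intro sum_nonneg) (simp add: c_def)
        ultimately show "(if i \<in> T z then 0 else 2) \<le> sum (c i) (W i - A `` {z})"
          using two i by auto
      qed
      also have "\<dots> \<le> \<kappa> * m"
        using sc[OF i] m0 by (rule mult_right_mono)
      finally show ?thesis .
    qed
    \<comment> \<open>The pairs \<open>(z, i)\<close> with \<open>i\<close> outside
      \<open>T z\<close> are counted both ways: every \<open>z\<close> has at least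
      \<open>card I - B\<close> such indices, while \<open>row\<close> limits their weight for each
      \<open>i\<close>. The slack \<open>\<beta> / 2\<close> in \<open>\<kappa>\<close> turns this
      into a factor \<open>4 * sum w V / \<beta>\<close> over \<open>B\<close>.\<close>
    have "sum w U * (2 * (real (card I) - B)) = (\<Sum>z\<in>U. w z * (2 * (real (card I) - B)))"
      by (rule sum_distrib_right)
    also have "\<dots> \<le> (\<Sum>z\<in>U. \<Sum>i\<in>I. w z * (if i \<in> T z then 0 else 2))"
    proof (rule sum_mono)
      fix z
      assume z: "z \<in> U"
      have TI: "T z \<subseteq> I"
        by (auto simp: T_def)
      have "(\<Sum>i\<in>I. (if i \<in> T z then 0 else 2::real)) = (\<Sum>i\<in>I - T z. 2)"
        using Suc.prems(1) by (intro sum.mono_neutral_cong_right) auto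
      also have "\<dots> = 2 * (real (card I) - real (card (T z)))"
        using Suc.prems(1) TI card_mono[of I "T z"]
        by (simp add: card_Diff_subset finite_subset of_nat_diff)
      also have "\<dots> \<ge> 2 * (real (card I) - B)"
        using T_bound[OF z] by simp
      finally show "w z * (2 * (real (card I) - B)) \<le> (\<Sum>i\<in>I. w z * (if i \<in> T z then 0 else 2))"
        unfolding sum_distrib_left[symmetric] by (intro mult_left_mono w_nonneg)
    qed
    also have "\<dots> = (\<Sum>i\<in>I. \<Sum>z\<in>U. w z * (if i \<in> T z then 0 else 2))"
      by (rule sum.swap)
    also have "\<dots> \<le> (\<Sum>i\<in>I. \<kappa> * m)"
      by (intro sum_mono row)
    also have "\<dots> = real (card I) * (\<kappa> * m)"
      by simp
    finally have "real (card I) * (2 * sum w U - \<kappa> * m) \<le> 2 * sum w U * B"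
      by (simp add: algebra_simps)
    moreover have "real (card I) * (\<beta> / 2) \<le> real (card I) * (2 * sum w U - \<kappa> * m)"
      using \<kappa> by (intro mult_left_mono) auto
    moreover have "2 * sum w U * B \<le> 2 * sum w V * B"
      using sum_w_mono[OF UV order_refl] weight_nonneg \<beta>_pos
      by (intro mult_right_mono) (auto simp: B_def)
    ultimately have "real (card I) * \<beta> \<le> 4 * sum w V * B"
      by linarith
    then show ?thesis
      using \<beta>_pos by (simp add: B_def field_simps)
  qed
qed

end

section \<open>Set systems without large shattered sets\<close>

definition shatters :: "'a set set \<Rightarrow> 'a set \<Rightarrow> bool" where
  "shatters F S \<longleftrightarrow> (\<forall>R\<subseteq>S. \<exists>B\<in>F. B \<inter> S = R)"

text \<open>Pajor's form of the Sauer-Shelah lemma.\<close>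

lemma card_le_shattered:
  assumes "finite T" "F \<subseteq> Pow T"
  shows "card F \<le> card {S. S \<subseteq> T \<and> shatters F S}"
  using assms
proof (induction T arbitrary: F rule: finite_induct)
  case empty
  show ?case
  proof (cases "F = {}")
    case False
    then have F: "F = {{}}"
      using empty by auto
    then have "{S. S \<subseteq> {} \<and> shatters F S} = {{}}"
      by (auto simp: shatters_def)
    then show ?thesis
      by (simp only: F)
  qed simp
next
  case (insert x T)
  define Fa where "Fa = {B \<in> F. x \<notin> B}"
  define Fb where "Fb = (\<lambda>B. B - {x}) ` {B \<in> F. x \<in> B}"
  have finF: "finite F"
    using insert.prems insert.hyps(1) by (meson finite_Pow_iff finite_insert finite_subset)
  have sub: "Fa \<subseteq> Pow T" "Fb \<subseteq> Pow T"
    using insert.prems by (auto simp: Fa_def Fb_def)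
  have fin: "finite Fa" "finite Fb"
    using finF by (auto simp: Fa_def Fb_def)
  have "card Fb = card {B \<in> F. x \<in> B}"
    unfolding Fb_def by (intro card_image inj_onI) blast
  moreover have "card F = card Fa + card {B \<in> F. x \<in> B}"
    unfolding Fa_def using finF
    by (subst card_Un_disjoint[symmetric]) (auto intro: arg_cong[where f = card])
  ultimately have "card F = card (Fa \<union> Fb) + card (Fa \<inter> Fb)"
    using card_Un_Int[OF fin] by simp
  also have "\<dots> \<le> card {S. S \<subseteq> T \<and> shatters (Fa \<union> Fb) S} + card {S. S \<subseteq> T \<and> shatters (Fa \<inter> Fb) S}"
    using sub by (intro add_mono insert.IH) auto
  also have "card {S. S \<subseteq> T \<and> shatters (Fa \<inter> Fb) S}
      = card (insert x ` {S. S \<subseteq> T \<and> shatters (Fa \<inter> Fb) S})"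
  proof (intro card_image[symmetric] inj_onI)
    fix R S
    assume "R \<in> {S. S \<subseteq> T \<and> shatters (Fa \<inter> Fb) S}" "S \<in> {S. S \<subseteq> T \<and> shatters (Fa \<inter> Fb) S}"
      and eq: "insert x R = insert x S"
    then have "x \<notin> R" "x \<notin> S"
      using insert.hyps(2) by auto
    then show "R = S"
      using eq by (simp add: insert_ident)
  qed
  also have "card {S. S \<subseteq> T \<and> shatters (Fa \<union> Fb) S} + \<dots>
      = card ({S. S \<subseteq> T \<and> shatters (Fa \<union> Fb) S} \<union> insert x ` {S. S \<subseteq> T \<and> shatters (Fa \<inter> Fb) S})"
    using insert.hyps by (subst card_Un_disjoint) auto
  also have "\<dots> \<le> card {S. S \<subseteq> insert x T \<and> shatters F S}"
  proof (rule card_mono)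
    show "finite {S. S \<subseteq> insert x T \<and> shatters F S}"
      using insert.hyps(1) by simp
    have 1: "shatters F S" if S: "S \<subseteq> T" and sh: "shatters (Fa \<union> Fb) S" for S
      unfolding shatters_def
    proof (intro allI impI)
      fix R
      assume "R \<subseteq> S"
      then obtain B where B: "B \<in> Fa \<union> Fb" "B \<inter> S = R"
        using sh unfolding shatters_def by blast
      then obtain B' where "B' \<in> F" "B = B' - {x}"
        by (auto simp: Fa_def Fb_def)
      moreover have "x \<notin> S"
        using S insert.hyps(2) by auto
      ultimately show "\<exists>B\<in>F. B \<inter> S = R"
        using B(2) by auto
    qed
    have 2: "shatters F (insert x S)" if S: "S \<subseteq> T" and sh: "shatters (Fa \<inter> Fb) S" for S
      unfolding shatters_def
    proof (intro allI impI)
      fix R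
      assume R: "R \<subseteq> insert x S"
      then have "R - {x} \<subseteq> S"
        by auto
      then obtain B where B: "B \<in> Fa \<inter> Fb" "B \<inter> S = R - {x}"
        using sh unfolding shatters_def by blast
      then obtain B' where B': "B' \<in> F" "x \<in> B'" "B = B' - {x}"
        by (auto simp: Fb_def)
      have xS: "x \<notin> S"
        using S insert.hyps(2) by auto
      have "B \<in> F" "x \<notin> B"
        using B by (auto simp: Fa_def)
      show "\<exists>B\<in>F. B \<inter> insert x S = R"
      proof (cases "x \<in> R")
        case True
        then have "B' \<inter> insert x S = R"
          using B(2) B' xS by auto
        then show ?thesis
          using B'(1) by blast
      next
        case False
        then have "B \<inter> insert x S = R"
          using B(2) \<open>x \<notin> B\<close> by auto
        then show ?thesis
          using \<open>B \<in> F\<close> by blast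
      qed
    qed
    show "{S. S \<subseteq> T \<and> shatters (Fa \<union> Fb) S} \<union> insert x ` {S. S \<subseteq> T \<and> shatters (Fa \<inter> Fb) S}
        \<subseteq> {S. S \<subseteq> insert x T \<and> shatters F S}"
      using 1 2 by auto
  qed
  finally show ?case .
qed

lemma card_small_subsets:
  assumes "finite T"
  shows "card {S. S \<subseteq> T \<and> card S < d} \<le> d * (card T + 1) ^ d"
proof -
  have "{S. S \<subseteq> T \<and> card S < d} = (\<Union>i<d. {S. S \<subseteq> T \<and> card S = i})"
    by auto
  then have "card {S. S \<subseteq> T \<and> card S < d} \<le> (\<Sum>i<d. card {S. S \<subseteq> T \<and> card S = i})"
    by (simp add: card_UN_le)
  also have "\<dots> \<le> (\<Sum>i<d. (card T + 1) ^ d)"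
  proof (rule sum_mono)
    fix i
    assume i: "i \<in> {..<d}"
    have "card {S. S \<subseteq> T \<and> card S = i} = card T choose i"
      using assms by (rule n_subsets)
    also have "\<dots> \<le> card T ^ i"
      by (cases "i \<le> card T") (auto intro: binomial_le_pow simp: binomial_eq_0)
    also have "\<dots> \<le> (card T + 1) ^ i"
      by (intro power_mono) auto
    also have "\<dots> \<le> (card T + 1) ^ d"
      using i by (intro power_increasing) auto
    finally show "card {S. S \<subseteq> T \<and> card S = i} \<le> (card T + 1) ^ d" .
  qed
  finally show ?thesis by simp
qed

text \<open>Shattering passes to subsets, so all shattered sets have fewer than \<open>d\<close>
  elements. What matters is only that the bound is polynomial in \<open>card T\<close> for fixed
  \<open>d\<close>.\<close>

lemma card_no_shattered:
  assumes "finite T" "F \<subseteq> Pow T" and no: "\<And>S. S \<subseteq> T \<Longrightarrow> card S = d \<Longrightarrow> \<not> shatters F S"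
  shows "card F \<le> d * (card T + 1) ^ d"
proof -
  have "card S < d" if S: "S \<subseteq> T" "shatters F S" for S
  proof (rule ccontr)
    assume "\<not> card S < d"
    then obtain S' where S': "S' \<subseteq> S" "card S' = d"
      by (meson not_le obtain_subset_with_card_n)
    have "shatters F S'"
      unfolding shatters_def
    proof (intro allI impI)
      fix R
      assume R: "R \<subseteq> S'"
      then obtain B where B: "B \<in> F" "B \<inter> S = R"
        using S(2) S'(1) unfolding shatters_def by (meson order_trans)
      then have "B \<inter> S' = R"
        using R S'(1) by auto
      then show "\<exists>B\<in>F. B \<inter> S' = R"
        using B(1) by blast
    qed
    then show False
      using no S' S(1) by blast
  qed
  then have "card {S. S \<subseteq> T \<and> shatters F S} \<le> card {S. S \<subseteq> T \<and> card S < d}"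
    using assms(1) by (intro card_mono) auto
  then show ?thesis
    using card_le_shattered[OF assms(1,2)] card_small_subsets[OF assms(1), of d] by linarith
qed

text \<open>Sampling without probability. Each pair is separated by a \<open>\<rho>\<close>-fraction
  of the weight, so by averaging some point separates a \<open>\<rho>\<close>-fraction of the pairs
  not separated so far; \<open>T\<close> collects such points greedily. The pairs are ordered,
  whence the square.\<close>

lemma distinguishing_points:
  fixes w :: "'a \<Rightarrow> real" and N :: "'b \<Rightarrow> 'a set"
  assumes V: "finite V" "\<And>z. 0 \<le> w z" and L: "finite L" and \<rho>: "0 < \<rho>" "\<rho> \<le> 1" and pos: "0 < sum w V"
    and far: "\<And>a b. a \<in> L \<Longrightarrow> b \<in> L \<Longrightarrow> a \<noteq> b \<Longrightarrow> \<rho> * sum w V \<le> sum w {z \<in> V. (z \<in> N a) \<noteq> (z \<in> N b)}"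
  shows "\<exists>T\<subseteq>V. card T \<le> t \<and>
    real (card {(a, b). a \<in> L \<and> b \<in> L \<and> a \<noteq> b \<and> N a \<inter> T = N b \<inter> T}) \<le> real (card L) ^ 2 * (1 - \<rho>) ^ t"
proof (induction t)
  case 0
  have "card {(a, b). a \<in> L \<and> b \<in> L \<and> a \<noteq> b} \<le> card (L \<times> L)"
    using L by (intro card_mono) auto
  then show ?case
    by (intro exI[of _ "{}"]) (simp add: card_cartesian_product power2_eq_square flip: of_nat_mult)
next
  case (Suc t)
  then obtain T where T: "T \<subseteq> V" "card T \<le> t"
    "real (card {(a, b). a \<in> L \<and> b \<in> L \<and> a \<noteq> b \<and> N a \<inter> T = N b \<inter> T}) \<le> real (card L) ^ 2 * (1 - \<rho>) ^ t"
    by blast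
  define Q where "Q = {(a, b). a \<in> L \<and> b \<in> L \<and> a \<noteq> b \<and> N a \<inter> T = N b \<inter> T}"
  define sep where "sep z = {(a, b) \<in> Q. (z \<in> N a) \<noteq> (z \<in> N b)}" for z
  have QL: "Q \<subseteq> L \<times> L"
    by (auto simp: Q_def)
  have fQ: "finite Q"
    using QL L by (meson finite_SigmaI finite_subset)
  have "\<exists>z\<in>V. \<rho> * real (card Q) \<le> real (card (sep z))"
  proof (rule ccontr)
    assume no: "\<not> ?thesis"
    have "\<exists>z\<in>V. 0 < w z"
    proof (rule ccontr)
      assume "\<not> ?thesis"
      then have "sum w V \<le> 0"
        by (intro sum_nonpos) (auto simp: not_less)
      then show False
        using pos by simp
    qed
    then have "(\<Sum>z\<in>V. w z * real (card (sep z))) < (\<Sum>z\<in>V. w z * (\<rho> * real (card Q)))"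
      using no V by (intro sum_strict_mono_ex1) (auto intro!: mult_left_mono mult_strict_left_mono simp: not_le less_imp_le)
    also have "\<dots> = (\<Sum>q\<in>Q. \<rho> * sum w V)"
      by (simp add: sum_distrib_right[symmetric])
    also have "\<dots> \<le> (\<Sum>q\<in>Q. \<Sum>z\<in>V. if q \<in> sep z then w z else 0)"
    proof (rule sum_mono)
      fix q
      assume q: "q \<in> Q"
      obtain a b where ab: "q = (a, b)"
        by fastforce
      have "\<rho> * sum w V \<le> sum w {z \<in> V. (z \<in> N a) \<noteq> (z \<in> N b)}"
        using q ab by (intro far) (auto simp: Q_def)
      also have "\<dots> = (\<Sum>z\<in>V. if q \<in> sep z then w z else 0)"
        using V(1) q by (simp add: sum.inter_filter sep_def ab)
      finally show "\<rho> * sum w V \<le> (\<Sum>z\<in>V. if q \<in> sep z then w z else 0)" .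
    qed
    also have "\<dots> = (\<Sum>z\<in>V. \<Sum>q\<in>Q. if q \<in> sep z then w z else 0)"
      by (rule sum.swap)
    also have "\<dots> = (\<Sum>z\<in>V. w z * real (card (sep z)))"
    proof (rule sum.cong[OF refl])
      fix z
      have "(\<Sum>q\<in>Q. if q \<in> sep z then w z else 0) = (\<Sum>q\<in>Q \<inter> sep z. w z)"
        by (rule sum.inter_restrict[OF fQ, symmetric])
      also have "Q \<inter> sep z = sep z"
        by (auto simp: sep_def)
      finally show "(\<Sum>q\<in>Q. if q \<in> sep z then w z else 0) = w z * real (card (sep z))"
        by simp
    qed
    finally show False by simp
  qed
  then obtain z where z: "z \<in> V" "\<rho> * real (card Q) \<le> real (card (sep z))"
    by blast
  define Q' where "Q' = {(a, b). a \<in> L \<and> b \<in> L \<and> a \<noteq> b \<and> N a \<inter> insert z T = N b \<inter> insert z T}"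
  have "Q' \<subseteq> Q - sep z"
  proof
    fix q
    assume "q \<in> Q'"
    then obtain a b where "q = (a, b)" "a \<in> L" "b \<in> L" "a \<noteq> b" "N a \<inter> insert z T = N b \<inter> insert z T"
      by (auto simp: Q'_def)
    moreover from this have "N a \<inter> T = N b \<inter> T" "z \<in> N a \<longleftrightarrow> z \<in> N b"
      by blast+
    ultimately show "q \<in> Q - sep z"
      by (simp add: Q_def sep_def)
  qed
  then have "card Q' \<le> card (Q - sep z)"
    using fQ by (intro card_mono) auto
  moreover have "sep z \<subseteq> Q"
    by (auto simp: sep_def)
  ultimately have "real (card Q') \<le> real (card Q) - real (card (sep z))"
    using fQ card_mono[OF fQ \<open>sep z \<subseteq> Q\<close>] by (simp add: card_Diff_subset finite_subset)
  also have "\<dots> \<le> (1 - \<rho>) * real (card Q)"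
    using z(2) by (simp add: algebra_simps)
  also have "\<dots> \<le> (1 - \<rho>) * (real (card L) ^ 2 * (1 - \<rho>) ^ t)"
    using T(3) \<rho> by (intro mult_left_mono) (auto simp: Q_def)
  finally have "real (card Q') \<le> real (card L) ^ 2 * (1 - \<rho>) ^ Suc t"
    by (simp add: mult_ac)
  moreover have "insert z T \<subseteq> V" "card (insert z T) \<le> Suc t"
    using z T(1,2) V(1) card_insert_le_m1[of "Suc t" T z] by auto
  ultimately show ?case
    unfolding Q'_def by blast
qed

lemma poly_times_geometric_small:
  fixes \<rho> :: real
  assumes \<rho>: "0 < \<rho>" "\<rho> \<le> 1"
  shows "\<exists>t. real (d * (t + 1) ^ d + 1) ^ 2 * (1 - \<rho>) ^ t < 1"
proof -
  define k where "k = 2 * d"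
  define x :: "nat \<Rightarrow> real" where "x t = \<rho> * (real t + 1)" for t
  define \<delta> where "\<delta> = \<rho> ^ k / (exp \<rho> * (real d + 1) ^ 2)"
  have \<delta>: "\<delta> > 0"
    using \<rho> by (simp add: \<delta>_def)
  have "filterlim (\<lambda>t. real t + 1) at_top sequentially"
    by (rule filterlim_at_top_mono[OF filterlim_real_sequentially]) simp
  then have "filterlim x at_top sequentially"
    unfolding x_def by (rule filterlim_tendsto_pos_mult_at_top[OF tendsto_const \<rho>(1)])
  then have "((\<lambda>t. x t ^ k / exp (x t)) \<longlongrightarrow> 0) sequentially"
    by (rule filterlim_compose[OF tendsto_power_div_exp_0])
  then have "\<forall>\<^sub>F t in sequentially. x t ^ k / exp (x t) < \<delta>"
    using \<delta> by (rule order_tendstoD)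
  then obtain t where t: "x t ^ k / exp (x t) < \<delta>"
    by (auto simp: eventually_sequentially)
  have "real (d * (t + 1) ^ d + 1) \<le> (real d + 1) * (real t + 1) ^ d"
  proof -
    have "1 \<le> (real t + 1) ^ d"
      by simp
    then show ?thesis
      by (simp add: algebra_simps)
  qed
  then have "real (d * (t + 1) ^ d + 1) ^ 2 \<le> ((real d + 1) * (real t + 1) ^ d) ^ 2"
    by (intro power_mono) auto
  also have "\<dots> = (real d + 1) ^ 2 * (real t + 1) ^ k"
    by (simp add: k_def power_mult_distrib power_mult[symmetric] mult.commute)
  finally have 1: "real (d * (t + 1) ^ d + 1) ^ 2 \<le> (real d + 1) ^ 2 * (real t + 1) ^ k" .
  have "(1 - \<rho>) ^ t \<le> exp (- \<rho>) ^ t"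
    using \<rho> exp_ge_add_one_self[of "- \<rho>"] by (intro power_mono) auto
  also have "\<dots> = exp \<rho> / exp (x t)"
    by (simp add: x_def exp_of_nat_mult[symmetric] exp_diff[symmetric] algebra_simps)
  finally have 2: "(1 - \<rho>) ^ t \<le> exp \<rho> / exp (x t)" .
  have "real (d * (t + 1) ^ d + 1) ^ 2 * (1 - \<rho>) ^ t
      \<le> ((real d + 1) ^ 2 * (real t + 1) ^ k) * (exp \<rho> / exp (x t))"
    using 1 2 \<rho> by (intro mult_mono) auto
  also have "\<dots> = (x t ^ k / exp (x t)) / \<delta>"
  proof -
    have "x t ^ k = \<rho> ^ k * (real t + 1) ^ k"
      by (simp only: x_def power_mult_distrib)
    then show ?thesis
      using \<rho> by (simp add: \<delta>_def)
  qed
  also have "\<dots> < 1"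
    using t \<delta> by (subst divide_less_eq_1_pos) auto
  finally show ?thesis by blast
qed

text \<open>A packing bound in the style of Haussler. With \<open>B = d * (t + 1) ^ d\<close>, the
  number \<open>t\<close> is chosen so large that \<open>t\<close> points separate any
  \<open>B + 1\<close> members completely. Their \<open>B + 1\<close> distinct traces on at most
  \<open>t\<close> points would then exceed the Sauer-Shelah bound. Exactly \<open>B + 1\<close>
  members are kept because the sampling bound worsens with their number.\<close>

lemma far_sets_bounded:
  assumes \<rho>: "0 < \<rho>" "\<rho> \<le> (1::real)"
  shows "\<exists>B::nat. \<forall>(V :: 'a set) (w :: 'a \<Rightarrow> real) (L :: 'b set) N.
    finite V \<and> (\<forall>z. 0 \<le> w z) \<and> finite L \<and> 0 < sum w V \<and>
    (\<forall>a\<in>L. \<forall>b\<in>L. a \<noteq> b \<longrightarrow> \<rho> * sum w V \<le> sum w {z \<in> V. (z \<in> N a) \<noteq> (z \<in> N b)}) \<and>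
    (\<forall>S\<subseteq>V. card S = d \<longrightarrow> \<not> (\<forall>R\<subseteq>S. \<exists>a\<in>L. N a \<inter> S = R))
    \<longrightarrow> card L \<le> B"
proof -
  obtain t where t: "real (d * (t + 1) ^ d + 1) ^ 2 * (1 - \<rho>) ^ t < 1"
    using poly_times_geometric_small[OF \<rho>] by blast
  define B where "B = d * (t + 1) ^ d"
  show ?thesis
  proof (intro exI[of _ B] allI impI)
    fix V :: "'a set" and w :: "'a \<Rightarrow> real" and L :: "'b set" and N
    assume asm: "finite V \<and> (\<forall>z. 0 \<le> w z) \<and> finite L \<and> 0 < sum w V \<and>
      (\<forall>a\<in>L. \<forall>b\<in>L. a \<noteq> b \<longrightarrow> \<rho> * sum w V \<le> sum w {z \<in> V. (z \<in> N a) \<noteq> (z \<in> N b)}) \<and>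
      (\<forall>S\<subseteq>V. card S = d \<longrightarrow> \<not> (\<forall>R\<subseteq>S. \<exists>a\<in>L. N a \<inter> S = R))"
    then have V: "finite V" "\<And>z. 0 \<le> w z" and L: "finite L" and pos: "0 < sum w V"
      and far: "\<And>a b. a \<in> L \<Longrightarrow> b \<in> L \<Longrightarrow> a \<noteq> b \<Longrightarrow> \<rho> * sum w V \<le> sum w {z \<in> V. (z \<in> N a) \<noteq> (z \<in> N b)}"
      and no: "\<And>S. S \<subseteq> V \<Longrightarrow> card S = d \<Longrightarrow> \<not> (\<forall>R\<subseteq>S. \<exists>a\<in>L. N a \<inter> S = R)"
      by simp_all
    show "card L \<le> B"
    proof (rule ccontr)
      assume "\<not> card L \<le> B"
      then obtain L' where L': "L' \<subseteq> L" "card L' = B + 1"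
        by (metis Suc_eq_plus1 not_less_eq_eq obtain_subset_with_card_n)
      have fL': "finite L'"
        using L'(1) L by (rule finite_subset)
      have "\<exists>T\<subseteq>V. card T \<le> t \<and>
          real (card {(a, b). a \<in> L' \<and> b \<in> L' \<and> a \<noteq> b \<and> N a \<inter> T = N b \<inter> T}) \<le> real (card L') ^ 2 * (1 - \<rho>) ^ t"
      proof (rule distinguishing_points[OF V fL' \<rho> pos])
        fix a b
        assume "a \<in> L'" "b \<in> L'" "a \<noteq> b"
        then show "\<rho> * sum w V \<le> sum w {z \<in> V. (z \<in> N a) \<noteq> (z \<in> N b)}"
          using L'(1) by (intro far) auto
      qed
      then obtain T where T: "T \<subseteq> V" "card T \<le> t"
        "real (card {(a, b). a \<in> L' \<and> b \<in> L' \<and> a \<noteq> b \<and> N a \<inter> T = N b \<inter> T}) \<le> real (card L') ^ 2 * (1 - \<rho>) ^ t"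
        by blast
      define Q where "Q = {(a, b). a \<in> L' \<and> b \<in> L' \<and> a \<noteq> b \<and> N a \<inter> T = N b \<inter> T}"
      have "real (card Q) < 1"
        using T(3) t by (simp add: Q_def L'(2) B_def)
      moreover have "finite Q"
        using fL' by (intro finite_subset[of Q "L' \<times> L'"]) (auto simp: Q_def)
      ultimately have Q: "Q = {}"
        by simp
      have inj: "inj_on (\<lambda>a. N a \<inter> T) L'"
        using Q by (auto simp: Q_def inj_on_def)
      define F where "F = (\<lambda>a. N a \<inter> T) ` L'"
      have "card F = B + 1"
        using inj L'(2) by (simp add: F_def card_image)
      moreover have "card F \<le> d * (card T + 1) ^ d"
      proof (rule card_no_shattered)
        show "finite T"
          using T(1) V(1) by (rule finite_subset)
        show "F \<subseteq> Pow T"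
          by (auto simp: F_def)
        fix S
        assume S: "S \<subseteq> T" "card S = d"
        show "\<not> shatters F S"
        proof
          assume sh: "shatters F S"
          have "\<exists>a\<in>L. N a \<inter> S = R" if "R \<subseteq> S" for R
          proof -
            have "\<exists>D\<in>F. D \<inter> S = R"
              using sh that by (simp add: shatters_def)
            then obtain a where "a \<in> L'" "N a \<inter> T \<inter> S = R"
              unfolding F_def by (elim bexE imageE) simp
            moreover have "N a \<inter> T \<inter> S = N a \<inter> S"
              using S(1) by auto
            ultimately show ?thesis
              using L'(1) by auto
          qed
          moreover have "S \<subseteq> V"
            using S(1) T(1) by (rule order_trans)
          ultimately show False
            using no[of S] S(2) by simp
        qed
      qed
      moreover have "d * (card T + 1) ^ d \<le> B"
        unfolding B_def using T(2) by (intro mult_left_mono power_mono) auto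
      ultimately show False
        by simp
    qed
  qed
qed

section \<open>Bounded images of dense graphs\<close>

context dense_good
begin

lemma no_clique_outside_X:
  assumes "K \<subseteq> V - X" "is_clique A K" "card K = r"
  shows False
proof -
  have "K \<noteq> {}"
    using assms(3) r3 by auto
  then obtain p where p: "p \<in> K"
    by blast
  have "K \<subseteq> V"
    using assms(1) by auto
  then obtain e where e: "e \<subseteq> K" "e \<subseteq> X" "2 \<le> card e"
    using goodD[OF _ assms(2,3) p] by metis
  then have "e \<subseteq> {}"
    using assms(1) by auto
  then show False
    using e(3) by simp
qed

text \<open>Adjacent vertices cannot be merged without creating a loop. They are never close anyway:
  the common neighbourhood would be heavy enough to pick an \<open>(r - 2)\<close>-clique in it
  greedily, outside \<open>X\<close>, and this clique with \<open>v\<close> and \<open>v'\<close>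
  contradicts \<open>good\<close>.\<close>

lemma adjacent_not_close:
  assumes v: "v \<in> V - X" "v' \<in> V - X" and adj: "(v, v') \<in> A"
  shows "sum w (A `` {v} \<inter> A `` {v'}) < sum w V - m - \<beta> / 8"
proof (rule ccontr)
  assume "\<not> ?thesis"
  then have close: "sum w V - m - \<beta> / 8 \<le> sum w (A `` {v} \<inter> A `` {v'})"
    by simp
  define M where "M = A `` {v} \<inter> A `` {v'}"
  have MV: "M \<subseteq> V"
    using nbhd_subset by (auto simp: M_def)
  have m0: "0 \<le> m"
    using v m_nonneg by auto
  have "j \<le> r - 2 \<Longrightarrow> \<exists>Q\<subseteq>M - X. is_clique A Q \<and> card Q = j" for j
  proof (induction j)
    case 0
    show ?case
      by (intro exI[of _ "{}"]) (auto simp: is_clique_def)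
  next
    case (Suc j)
    then obtain Q where Q: "Q \<subseteq> M - X" "is_clique A Q" "card Q = j"
      by auto
    have QV: "Q \<subseteq> V"
      using Q(1) MV by auto
    have "sum w M - real (card Q) * m - \<beta> / 4 \<le> sum w (M \<inter> (common_nbhd V A Q - X))"
      by (rule common_nbhd_weight_light[OF MV QV])
    moreover have "real j * m \<le> (real r - 3) * m"
      using Suc.prems m0 r3 by (intro mult_right_mono) auto
    ultimately have "0 < sum w (M \<inter> (common_nbhd V A Q - X))"
      using close dense \<beta>_pos m0 by (simp add: M_def Q(3) algebra_simps)
    then have "M \<inter> (common_nbhd V A Q - X) \<noteq> {}"
      by (intro notI) simp
    then obtain z where z: "z \<in> M" "z \<in> common_nbhd V A Q" "z \<notin> X"
      by blast
    have zQ: "Q \<subseteq> A `` {z}"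
      using z(2) adj_sym by (auto simp: common_nbhd_def)
    then have "z \<notin> Q"
      using not_adj_self by auto
    moreover have "finite Q"
      using QV finV by (rule finite_subset)
    ultimately have "card (insert z Q) = Suc j"
      using Q(3) by simp
    then show ?case
      using is_clique_insert[OF symA Q(2) zQ] Q(1) z by (intro exI[of _ "insert z Q"]) auto
  qed
  then obtain Q where Q: "Q \<subseteq> M - X" "is_clique A Q" "card Q = r - 2"
    by blast
  have c1: "is_clique A (insert v Q)"
    using Q by (intro is_clique_insert[OF symA]) (auto simp: M_def)
  have c2: "is_clique A (insert v' (insert v Q))"
    using Q adj adj_sym by (intro is_clique_insert[OF symA c1]) (auto simp: M_def)
  have "v \<notin> Q" "v' \<notin> insert v Q"
    using Q(1) adj not_adj_self by (auto simp: M_def)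
  moreover have "finite Q"
    using Q(1) MV finV by (meson Diff_subset finite_subset order_trans)
  ultimately have "card (insert v' (insert v Q)) = r"
    using Q(3) r3 by simp
  moreover have "insert v' (insert v Q) \<subseteq> V - X"
    using Q(1) MV v by auto
  ultimately show False
    using no_clique_outside_X[OF _ c2] by simp
qed

text \<open>An \<open>r\<close>-clique that is new after merging contains \<open>v\<close>. Each of
  its other vertices was adjacent to \<open>v\<close> or to \<open>v'\<close>, so together they form
  a mixed clique \<open>D\<close> of the kind excluded before.\<close>

lemma merge_good:
  assumes v: "v \<in> V - X" and v': "v' \<in> V - X" and vv: "v \<noteq> v'" and na: "(v, v') \<notin> A" and Ev: "E v = E v'"
    and NX: "A `` {v} \<inter> X = A `` {v'} \<inter> X"
    and close: "sum w V - m - \<beta> / 8 \<le> sum w (A `` {v} \<inter> A `` {v'})"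
  defines "f \<equiv> \<lambda>x. if x = v' then v else x"
  shows "good r (V - {v'}) (map_prod f f ` A) E" "irrefl (map_prod f f ` A)"
proof -
  show "irrefl (map_prod f f ` A)"
    using na adj_sym not_adj_self by (auto simp: irrefl_def f_def split: if_splits)
  have old: "(x, y) \<in> A" if "(x, y) \<in> map_prod f f ` A" "x \<noteq> v" "y \<noteq> v" for x y
    using that by (auto simp: f_def split: if_splits)
  have new: "x \<in> A `` {v} \<union> A `` {v'}" if "(v, x) \<in> map_prod f f ` A" "x \<noteq> v" for x
    using that by (auto simp: f_def split: if_splits)
  show "good r (V - {v'}) (map_prod f f ` A) E"
    unfolding good_def
  proof (intro allI impI ballI)
    fix K p
    assume KV: "K \<subseteq> V - {v'}" and K: "is_clique (map_prod f f ` A) K \<and> card K = r" and p: "p \<in> K"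
    show "\<exists>e\<in>E p. e \<subseteq> K"
    proof (cases "v \<in> K")
      case False
      have "is_clique A K"
        unfolding is_clique_def
      proof (intro ballI impI)
        fix x y
        assume "x \<in> K" "y \<in> K" "x \<noteq> y"
        then show "(x, y) \<in> A"
          using K False by (intro old) (auto simp: is_clique_def)
      qed
      then show ?thesis
        using good KV K p unfolding good_def by blast
    next
      case True
      define D where "D = K - {v}"
      have fK: "finite K"
        using KV finV by (auto intro: finite_subset)
      have D: "D \<subseteq> V" "card D = r - 1" "p \<in> insert v D"
        using KV K True p fK by (auto simp: D_def)
      have "is_clique A D"
        unfolding is_clique_def
      proof (intro ballI impI)
        fix x y
        assume "x \<in> D" "y \<in> D" "x \<noteq> y"
        then show "(x, y) \<in> A"
          using K by (intro old) (auto simp: is_clique_def D_def)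
      qed
      moreover have "D \<subseteq> A `` {v} \<union> A `` {v'}"
      proof
        fix x
        assume "x \<in> D"
        then show "x \<in> A `` {v} \<union> A `` {v'}"
          using K True by (intro new) (auto simp: is_clique_def D_def)
      qed
      ultimately have "\<not> (\<forall>e\<in>E p. \<not> e \<subseteq> D)"
        using close_same_type_no_mixed_clique[OF v v' na Ev NX close D(1) _ D(2) _ D(3)] by blast
      then show ?thesis
        by (auto simp: D_def)
    qed
  qed
qed

text \<open>Of all traces only the sets \<open>S - {s}\<close> matter: they provide a
  \<open>u s\<close> adjacent to all of \<open>S\<close> except \<open>s\<close>. By maximality,
  adding the edge between \<open>s\<close> and \<open>u s\<close> creates a bad clique, and the rest
  of that clique is the set \<open>C s\<close> wanted by the co-matching bound.\<close>

lemma shattered_bound: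
  assumes max: "\<And>s u. s \<in> V - X \<Longrightarrow> u \<in> V - X \<Longrightarrow> s \<noteq> u \<Longrightarrow> (s, u) \<notin> A \<Longrightarrow>
      \<not> good r V (insert (s, u) (insert (u, s) A)) E"
    and S: "S \<subseteq> V - X" and L: "L \<subseteq> V - X" and sh: "\<And>R. R \<subseteq> S \<Longrightarrow> \<exists>a\<in>L. A `` {a} \<inter> S = R"
  shows "real (card S) \<le> real r + (4 * sum w V / \<beta>) ^ (r - 2)"
proof -
  have "\<forall>s\<in>S. \<exists>a. a \<in> L \<and> A `` {a} \<inter> S = S - {s}"
    using sh by blast
  then obtain u where u: "\<And>s. s \<in> S \<Longrightarrow> u s \<in> L" "\<And>s. s \<in> S \<Longrightarrow> A `` {u s} \<inter> S = S - {s}"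
    by metis
  define I where "I = {s \<in> S. u s \<noteq> s}"
  have fS: "finite S"
    using S finV by (auto intro: finite_subset)
  have IS: "I \<subseteq> S"
    by (auto simp: I_def)
  have adj: "(s, u t) \<in> A" if "s \<in> S" "t \<in> S" "s \<noteq> t" for s t
    using u(2)[OF that(2)] that adj_sym by blast
  \<comment> \<open>If \<open>u s = s\<close>, then \<open>s\<close> itself is adjacent to the rest
    of \<open>S\<close>. Such vertices form a clique outside \<open>X\<close>.\<close>
  have "card (S - I) < r"
  proof (rule ccontr)
    assume "\<not> card (S - I) < r"
    then obtain K where K: "K \<subseteq> S - I" "card K = r"
      by (meson not_le obtain_subset_with_card_n)
    have "is_clique A K"
      unfolding is_clique_def
    proof (intro ballI impI)
      fix x y
      assume "x \<in> K" "y \<in> K" "x \<noteq> y"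
      then have "x \<in> S" "y \<in> S" "u y = y"
        using K(1) by (auto simp: I_def)
      then show "(x, y) \<in> A"
        using adj[of x y] \<open>x \<noteq> y\<close> by simp
    qed
    then show False
      using no_clique_outside_X[of K] K S by blast
  qed
  moreover have "real (card I) \<le> (4 * sum w V / \<beta>) ^ (r - 2)"
  proof -
    have "\<exists>C. C \<subseteq> V \<and> is_clique A C \<and> card C = r - 2 \<and> C \<subseteq> A `` {s} \<inter> A `` {u s} \<and>
        (\<exists>p \<in> insert s (insert (u s) C). \<forall>e\<in>E p. \<not> e \<subseteq> C)" if s: "s \<in> I" for s
    proof -
      have su: "s \<in> V - X" "u s \<in> V - X" "s \<noteq> u s" "(s, u s) \<notin> A"
        using s S L u[of s] adj_sym by (auto simp: I_def)
      define A' where "A' = insert (s, u s) (insert (u s, s) A)"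
      obtain K p where K: "K \<subseteq> V" "is_clique A' K" "card K = r" and p: "p \<in> K" "\<forall>e\<in>E p. \<not> e \<subseteq> K"
        using max[OF su] unfolding good_def A'_def by blast
      have fK: "finite K"
        using K(1) finV by (rule finite_subset)
      have sin: "s \<in> K \<and> u s \<in> K"
      proof (rule ccontr)
        assume no: "\<not> ?thesis"
        have "is_clique A K"
          unfolding is_clique_def
        proof (intro ballI impI)
          fix x y
          assume "x \<in> K" "y \<in> K" "x \<noteq> y"
          then show "(x, y) \<in> A"
            using K(2) no by (auto simp: is_clique_def A'_def)
        qed
        obtain e where "e \<in> E p" "e \<subseteq> K"
          by (rule goodD[OF K(1) \<open>is_clique A K\<close> K(3) p(1)])
        then show False
          using p(2) by simp
      qed
      define C where "C = K - {s, u s}"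
      have cl: "(x, y) \<in> A" if "x \<in> K" "y \<in> K" "x \<noteq> y" "{x, y} \<noteq> {s, u s}" for x y
        using K(2) that unfolding is_clique_def A'_def by blast
      have "C \<subseteq> V" "is_clique A C"
        using K(1) cl by (auto simp: C_def is_clique_def)
      moreover have "card C = r - 2"
        using sin su(3) fK K(3) by (simp add: C_def card_Diff_subset)
      moreover have "C \<subseteq> A `` {s} \<inter> A `` {u s}"
      proof
        fix x
        assume "x \<in> C"
        then have "(s, x) \<in> A" "(u s, x) \<in> A"
          using sin by (auto simp: C_def intro!: cl)
        then show "x \<in> A `` {s} \<inter> A `` {u s}"
          by simp
      qed
      moreover have "p \<in> insert s (insert (u s) C)" "\<forall>e\<in>E p. \<not> e \<subseteq> C"
        using p by (auto simp: C_def)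
      ultimately show ?thesis
        by blast
    qed
    then obtain C where C: "\<And>s. s \<in> I \<Longrightarrow> C s \<subseteq> V \<and> is_clique A (C s) \<and> card (C s) = r - 2 \<and>
        C s \<subseteq> A `` {s} \<inter> A `` {u s} \<and> (\<exists>p \<in> insert s (insert (u s) (C s)). \<forall>e\<in>E p. \<not> e \<subseteq> C s)"
      by metis
    show ?thesis
    proof (rule co_matching_bound[where Z = "{}" and s = "\<lambda>s. s" and u = u and C = C])
      show "finite I"
        using IS fS by (rule finite_subset)
      fix s
      assume s: "s \<in> I"
      show "s \<in> V - X \<and> u s \<in> V - X \<and> s \<noteq> u s \<and> (s, u s) \<notin> A"
        using s S L u[of s] adj_sym by (auto simp: I_def)
      show "C s \<subseteq> V \<and> is_clique A (C s) \<and> card (C s) = r - 2 \<and> {} \<subseteq> C s \<and> card (C s - {}) = r - 2"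
        using C[OF s] by simp
      show "C s \<subseteq> A `` {s} \<inter> A `` {u s}" "\<exists>p\<in>insert s (insert (u s) (C s)). \<forall>e\<in>E p. \<not> e \<subseteq> C s"
        using C[OF s] by simp_all
      fix t
      assume "t \<in> I" "s \<noteq> t"
      then show "(s, u t) \<in> A"
        using s IS by (intro adj) auto
    qed simp
  qed
  moreover have "card S = card I + card (S - I)"
    using card_Diff_subset[of I S] card_mono[OF fS IS] IS fS by (simp add: finite_subset)
  ultimately show ?thesis
    by simp
qed

text \<open>The neighbourhood of \<open>v\<close> weighs at least \<open>sum w V - m\<close>, so a
  lighter common part leaves a difference of at least \<open>\<beta> / 8\<close>. Equal traces on
  \<open>X\<close> push this difference outside \<open>X\<close>, which is where shattered sets are
  controlled.\<close>

lemma far_in_class: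
  assumes v: "v \<in> V" and NX: "A `` {v} \<inter> X = A `` {v'} \<inter> X"
    and far: "sum w (A `` {v} \<inter> A `` {v'}) < sum w V - m - \<beta> / 8"
  shows "\<beta> / 8 \<le> sum w {z \<in> V - X. (z \<in> A `` {v}) \<noteq> (z \<in> A `` {v'})}"
proof -
  have fin: "finite (A `` {v})"
    using nbhd_subset finV by (rule finite_subset)
  have "sum w V = sum w (V \<inter> A `` {v}) + sum w (V - A `` {v})"
    using finV by (metis sum.Int_Diff)
  moreover have "V \<inter> A `` {v} = A `` {v}"
    using nbhd_subset by blast
  ultimately have "sum w V - m \<le> sum w (A `` {v})"
    using miss[OF v] by simp
  moreover have "sum w (A `` {v}) = sum w (A `` {v} \<inter> A `` {v'}) + sum w (A `` {v} - A `` {v'})"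
    using fin by (metis sum.Int_Diff)
  moreover have "sum w (A `` {v} - A `` {v'}) \<le> sum w {z \<in> V - X. (z \<in> A `` {v}) \<noteq> (z \<in> A `` {v'})}"
    using nbhd_subset[of v] NX by (intro sum_w_mono) auto
  ultimately show ?thesis
    using far by linarith
qed

end

text \<open>The vertices of the image are representatives inside \<open>V\<close>, so that
  \<open>X\<close> and \<open>E\<close> keep their meaning throughout. The fibres over
  \<open>X\<close> are single points, which keeps \<open>X\<close> light. \<open>A'\<close> may
  exceed the image of \<open>A\<close>, which leaves room for an edge-maximal choice.\<close>

definition good_image ::
  "nat \<Rightarrow> 'a set \<Rightarrow> ('a \<times> 'a) set \<Rightarrow> 'a set \<Rightarrow> ('a \<Rightarrow> 'a set set) \<Rightarrow> 'a set \<Rightarrow> ('a \<times> 'a) set \<Rightarrow> ('a \<Rightarrow> 'a) \<Rightarrow> bool"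
  where "good_image r V A X E V' A' \<phi> \<longleftrightarrow>
    V' \<subseteq> V \<and> \<phi> ` V = V' \<and> (\<forall>x\<in>X. \<phi> x = x) \<and> (\<forall>v\<in>V - X. \<phi> v \<notin> X) \<and>
    (\<forall>(x, y)\<in>A. (\<phi> x, \<phi> y) \<in> A') \<and> sym A' \<and> irrefl A' \<and> A' \<subseteq> V' \<times> V' \<and> good r V' A' E"

text \<open>If \<open>\<phi> y\<close> is not adjacent to \<open>\<phi> x\<close>, then
  \<open>y\<close> is not adjacent to \<open>x\<close>. Measured by fibre sizes, the missed weight
  therefore never grows under a homomorphism.\<close>

lemma dense_good_image:
  assumes img: "good_image r V A X E V' A' \<phi>"
    and V: "finite V" "A \<subseteq> V \<times> V" and X: "X \<subseteq> V" and E: "\<And>v e. v \<in> V \<Longrightarrow> e \<in> E v \<Longrightarrow> e \<subseteq> X \<and> 2 \<le> card e"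
    and miss: "\<And>v. v \<in> V \<Longrightarrow> real (card (V - A `` {v})) \<le> m"
    and r: "3 \<le> r" and dense: "(2 * real r - 3) * m + \<beta> \<le> 2 * real (card V)"
    and light: "4 * real (card X) \<le> \<beta>" and \<beta>: "0 < \<beta>"
  defines "w \<equiv> \<lambda>f. real (card {x \<in> V. \<phi> x = f})"
  shows "sum w V' = real (card V)" "dense_good V' A' w m X E r \<beta>"
proof -
  have im: "V' \<subseteq> V" "\<phi> ` V = V'" "\<And>x. x \<in> X \<Longrightarrow> \<phi> x = x" "\<And>v. v \<in> V - X \<Longrightarrow> \<phi> v \<notin> X"
    "\<And>x y. (x, y) \<in> A \<Longrightarrow> (\<phi> x, \<phi> y) \<in> A'" "sym A'" "irrefl A'" "A' \<subseteq> V' \<times> V'" "good r V' A' E"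
    using img by (auto simp: good_image_def)
  have wS: "sum w S = real (card {x \<in> V. \<phi> x \<in> S})" if S: "S \<subseteq> V'" for S
  proof -
    have fS: "finite S"
      using S im(1) V(1) by (meson finite_subset)
    have "card (\<Union>f\<in>S. {x \<in> V. \<phi> x = f}) = (\<Sum>f\<in>S. card {x \<in> V. \<phi> x = f})"
      using fS V(1) by (intro card_UN_disjoint) auto
    moreover have "(\<Union>f\<in>S. {x \<in> V. \<phi> x = f}) = {x \<in> V. \<phi> x \<in> S}"
      by auto
    ultimately show ?thesis
      by (simp add: w_def)
  qed
  have "{x \<in> V. \<phi> x \<in> V'} = V"
    using im(2) by auto
  then show total: "sum w V' = real (card V)"
    using wS[OF order_refl] by simp
  have XV': "X \<subseteq> V'"
    using im(2,3) X by force
  have "{x \<in> V. \<phi> x \<in> X} = X"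
    using im(3,4) X by auto
  then have wX: "sum w X = real (card X)"
    using wS[OF XV'] by simp
  show "dense_good V' A' w m X E r \<beta>"
  proof unfold_locales
    show "finite V'"
      using im(1) V(1) by (rule finite_subset)
    show "0 \<le> w v" for v
      by (simp add: w_def)
    show "e \<subseteq> X \<and> 2 \<le> card e" if "v \<in> V'" "e \<in> E v" for v e
      using E[of v e] that im(1) by auto
    fix f
    assume "f \<in> V'"
    then obtain x where x: "x \<in> V" "f = \<phi> x"
      using im(2) by auto
    have "sum w (V' - A' `` {f}) = real (card {y \<in> V. \<phi> y \<in> V' - A' `` {f}})"
      by (rule wS) auto
    also have "\<dots> \<le> real (card (V - A `` {x}))"
    proof (intro of_nat_mono card_mono)
      show "finite (V - A `` {x})"
        using V(1) by simp
      show "{y \<in> V. \<phi> y \<in> V' - A' `` {f}} \<subseteq> V - A `` {x}"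
        using im(5)[of x] x(2) by auto
    qed
    also have "\<dots> \<le> m"
      using miss x(1) by simp
    finally show "sum w (V' - A' `` {f}) \<le> m" .
  qed (use im XV' r dense light \<beta> total wX in auto)
qed

lemma bounded_good_image:
  fixes \<epsilon> :: real
  assumes r: "3 \<le> r" and \<epsilon>: "0 < \<epsilon>" "\<epsilon> \<le> 1"
  shows "\<exists>B n0::nat. \<forall>(V :: 'a set) A X E m.
    finite V \<and> sym A \<and> irrefl A \<and> A \<subseteq> V \<times> V \<and> X \<subseteq> V \<and> card X \<le> b \<and>
    (\<forall>v\<in>V. \<forall>e\<in>E v. e \<subseteq> X \<and> 2 \<le> card e) \<and> good r V A E \<and>
    (\<forall>v\<in>V. real (card (V - A `` {v})) \<le> m) \<and>
    (2 * real r - 3) * m + \<epsilon> * real (card V) \<le> 2 * real (card V) \<and> n0 \<le> card V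
    \<longrightarrow> (\<exists>V' A' \<phi>. card V' \<le> B \<and> good_image r V A X E V' A' \<phi>)"
proof -
  \<comment> \<open>One more than the bound on shattered sets, in which
    \<open>4 * sum w V / \<beta>\<close> becomes \<open>4 / \<epsilon>\<close>.\<close>
  define d where "d = r + nat \<lceil>(4 / \<epsilon>) ^ (r - 2)\<rceil> + 1"
  have \<rho>: "0 < \<epsilon> / 8" "\<epsilon> / 8 \<le> 1"
    using \<epsilon> by auto
  obtain B0 where h: "\<forall>(V :: 'a set) (w :: 'a \<Rightarrow> real) (L :: 'a set) N.
    finite V \<and> (\<forall>z. 0 \<le> w z) \<and> finite L \<and> 0 < sum w V \<and>
    (\<forall>a\<in>L. \<forall>b\<in>L. a \<noteq> b \<longrightarrow> \<epsilon> / 8 * sum w V \<le> sum w {z \<in> V. (z \<in> N a) \<noteq> (z \<in> N b)}) \<and>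
    (\<forall>S\<subseteq>V. card S = d \<longrightarrow> \<not> (\<forall>R\<subseteq>S. \<exists>a\<in>L. N a \<inter> S = R)) \<longrightarrow> card L \<le> B0"
    by (rule exE[OF far_sets_bounded[OF \<rho>, of d]])
  have B0: "card L \<le> B0"
    if "finite V" "\<And>z. 0 \<le> w z" "finite L" "0 < sum w V"
      "\<And>a b. a \<in> L \<Longrightarrow> b \<in> L \<Longrightarrow> a \<noteq> b \<Longrightarrow> \<epsilon> / 8 * sum w V \<le> sum w {z \<in> V. (z \<in> N a) \<noteq> (z \<in> N b)}"
      "\<And>S. S \<subseteq> V \<Longrightarrow> card S = d \<Longrightarrow> \<not> (\<forall>R\<subseteq>S. \<exists>a\<in>L. N a \<inter> S = R)"
    for V L :: "'a set" and w :: "'a \<Rightarrow> real" and N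
    by (rule h[rule_format, of V w L N]) (use that in simp)
  define n0 where "n0 = nat \<lceil>4 * real b / \<epsilon>\<rceil> + b + 1"
  \<comment> \<open>Vertices outside \<open>X\<close> are classified by \<open>E v\<close> (at most
    \<open>2 ^ 2 ^ b\<close> values) and by their trace on \<open>X\<close> (at most
    \<open>2 ^ b\<close> values). Only vertices of the same class can be merged, so the packing
    bound \<open>B0\<close> applies class by class.\<close>
  define B where "B = b + 2 ^ 2 ^ b * 2 ^ b * B0"
  show ?thesis
  proof (rule exI[of _ B], rule exI[of _ n0], intro allI impI)
    fix V :: "'a set" and A :: "('a \<times> 'a) set" and X :: "'a set" and E :: "'a \<Rightarrow> 'a set set" and m :: real
    assume "finite V \<and> sym A \<and> irrefl A \<and> A \<subseteq> V \<times> V \<and> X \<subseteq> V \<and> card X \<le> b \<and>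
      (\<forall>v\<in>V. \<forall>e\<in>E v. e \<subseteq> X \<and> 2 \<le> card e) \<and> good r V A E \<and>
      (\<forall>v\<in>V. real (card (V - A `` {v})) \<le> m) \<and>
      (2 * real r - 3) * m + \<epsilon> * real (card V) \<le> 2 * real (card V) \<and> n0 \<le> card V"
    then have V: "finite V" and A: "sym A" "irrefl A" "A \<subseteq> V \<times> V" and X: "X \<subseteq> V" "card X \<le> b"
      and E: "\<forall>v\<in>V. \<forall>e\<in>E v. e \<subseteq> X \<and> 2 \<le> card e" and good: "good r V A E"
      and miss: "\<forall>v\<in>V. real (card (V - A `` {v})) \<le> m"
      and dense: "(2 * real r - 3) * m + \<epsilon> * real (card V) \<le> 2 * real (card V)"
      and n0: "n0 \<le> card V"
      by simp_all
    define n where "n = real (card V)"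
    define img where "img = good_image r V A X E"
    have npos: "real b < n" "0 < n"
      using n0 by (auto simp: n_def n0_def)
    have "4 * real b / \<epsilon> \<le> n"
      using n0 unfolding n_def n0_def by linarith
    then have "4 * real b \<le> \<epsilon> * n"
      using \<epsilon> by (simp add: field_simps)
    then have light: "4 * real (card X) \<le> \<epsilon> * n"
      using X(2) by linarith
    have \<beta>: "0 < \<epsilon> * n"
      using \<epsilon> npos by simp
    have "img V A id"
      using X A good by (auto simp: img_def good_image_def)
    then have ex: "\<exists>k V' A' \<phi>. img V' A' \<phi> \<and> card V' = k"
      by blast
    \<comment> \<open>The number of vertices is minimised before the number of edges is maximised: a
      merge may lose edges, but it always contradicts the first choice.\<close>
    define k where "k = (LEAST k. \<exists>V' A' \<phi>. img V' A' \<phi> \<and> card V' = k)"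
    have kmin: "k \<le> card V'" if "img V' A' \<phi>" for V' A' \<phi>
      unfolding k_def by (rule Least_le) (use that in blast)
    have "\<exists>V' A' \<phi>. img V' A' \<phi> \<and> card V' = k"
      unfolding k_def by (rule LeastI_ex[OF ex])
    then have ex2: "\<exists>l V' A' \<phi>. img V' A' \<phi> \<and> card V' = k \<and> card A' = l"
      by blast
    define l where "l = (GREATEST l. \<exists>V' A' \<phi>. img V' A' \<phi> \<and> card V' = k \<and> card A' = l)"
    have bound: "l \<le> card (V \<times> V)" if ex_l: "\<exists>V' A' \<phi>. img V' A' \<phi> \<and> card V' = k \<and> card A' = l" for l
    proof -
      obtain V' A' \<phi> where "img V' A' \<phi>" "card A' = l"
        using ex_l by blast
      moreover from this have "A' \<subseteq> V \<times> V"
        by (auto simp: img_def good_image_def)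
      ultimately show ?thesis
        using V by (metis card_mono finite_SigmaI)
    qed
    have "\<exists>V' A' \<phi>. img V' A' \<phi> \<and> card V' = k \<and> card A' = l"
      unfolding l_def by (rule GreatestI_ex_nat[OF ex2 bound])
    then obtain V' A' \<phi> where im: "img V' A' \<phi>" and k: "card V' = k" and l: "card A' = l"
      by blast
    have lmax: "card A'' \<le> card A'" if "img V' A'' \<phi>" for A''
      unfolding l unfolding l_def by (rule Greatest_le_nat[OF _ bound]) (use that k in blast)
    define w where "w = (\<lambda>f. real (card {x \<in> V. \<phi> x = f}))"
    have E': "\<And>v e. v \<in> V \<Longrightarrow> e \<in> E v \<Longrightarrow> e \<subseteq> X \<and> 2 \<le> card e"
      using E by simp
    have miss': "\<And>v. v \<in> V \<Longrightarrow> real (card (V - A `` {v})) \<le> m"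
      using miss by simp
    note dgi = dense_good_image[OF im[unfolded img_def] V A(3) X(1) E' miss' r dense light[unfolded n_def] \<beta>[unfolded n_def]]
    have total: "sum w V' = n"
      using dgi(1) by (simp add: w_def n_def)
    interpret dense_good V' A' w m X E r "\<epsilon> * n"
      using dgi(2) by (simp add: w_def n_def)
    have im': "V' \<subseteq> V" "\<phi> ` V = V'" "\<forall>x\<in>X. \<phi> x = x" "\<forall>v\<in>V - X. \<phi> v \<notin> X"
      "\<forall>(x, y)\<in>A. (\<phi> x, \<phi> y) \<in> A'"
      using im by (auto simp: img_def good_image_def)
    have max: "\<not> good r V' (insert (s, u) (insert (u, s) A')) E"
      if su: "s \<in> V' - X" "u \<in> V' - X" "s \<noteq> u" "(s, u) \<notin> A'" for s u
    proof
      assume g: "good r V' (insert (s, u) (insert (u, s) A')) E"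
      have "img V' (insert (s, u) (insert (u, s) A')) \<phi>"
        unfolding img_def good_image_def
        using im' g su symA irreflA AV by (auto simp: sym_def irrefl_def)
      then have "card (insert (s, u) (insert (u, s) A')) \<le> card A'"
        by (rule lmax)
      moreover have fin: "finite A'"
        using AV finV by (meson finite_SigmaI finite_subset)
      moreover have "card A' < card (insert (s, u) (insert (u, s) A'))"
        using fin su(4) by (intro psubset_card_mono) auto
      ultimately show False
        by simp
    qed
    have close: "sum w (A' `` {v} \<inter> A' `` {v'}) < sum w V' - m - \<epsilon> * n / 8"
      if v: "v \<in> V' - X" "v' \<in> V' - X" "v \<noteq> v'" and Ev: "E v = E v'"
        and NX: "A' `` {v} \<inter> X = A' `` {v'} \<inter> X" for v v'
    proof (cases "(v, v') \<in> A'")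
      case True
      then show ?thesis
        using adjacent_not_close v by blast
    next
      case False
      show ?thesis
      proof (rule ccontr)
        assume "\<not> ?thesis"
        then have cl: "sum w V' - m - \<epsilon> * n / 8 \<le> sum w (A' `` {v} \<inter> A' `` {v'})"
          by simp
        define f where "f = (\<lambda>x. if x = v' then v else x)"
        note mg = merge_good[OF v(1,2,3) False Ev NX cl, folded f_def]
        have "img (V' - {v'}) (map_prod f f ` A') (f \<circ> \<phi>)"
          unfolding img_def good_image_def
        proof (intro conjI)
          show "V' - {v'} \<subseteq> V"
            using im'(1) by auto
          have "f ` V' = V' - {v'}"
            using v by (auto simp: f_def image_iff)
          then show "(f \<circ> \<phi>) ` V = V' - {v'}"
            using im'(2) by (metis image_comp)
          show "\<forall>x\<in>X. (f \<circ> \<phi>) x = x"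
            using im'(3) v by (auto simp: f_def)
          show "\<forall>u\<in>V - X. (f \<circ> \<phi>) u \<notin> X"
            using im'(4) v by (auto simp: f_def)
          show "\<forall>(x, y)\<in>A. ((f \<circ> \<phi>) x, (f \<circ> \<phi>) y) \<in> map_prod f f ` A'"
            using im'(5) by force
          show "sym (map_prod f f ` A')"
            using symA by (fastforce simp: sym_def)
          show "irrefl (map_prod f f ` A')" "good r (V' - {v'}) (map_prod f f ` A') E"
            using mg by simp_all
          show "map_prod f f ` A' \<subseteq> (V' - {v'}) \<times> (V' - {v'})"
            using AV v by (auto simp: f_def split: if_splits)
        qed
        then have "card V' \<le> card (V' - {v'})"
          using kmin k by metis
        moreover have "card (V' - {v'}) < card V'"
          using v(2) finV by (intro psubset_card_mono) auto
        ultimately show False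
          by simp
      qed
    qed
    define lbl where "lbl v = (E v, A' `` {v} \<inter> X)" for v
    define Cl where "Cl y = {v \<in> V' - X. lbl v = y}" for y
    have ClB: "card (Cl y) \<le> B0" for y
    proof (rule B0[of "V' - X" w "Cl y" "\<lambda>v. A' `` {v}"])
      show "finite (V' - X)" "finite (Cl y)"
        using finV by (auto simp: Cl_def)
      show "0 \<le> w z" for z
        by (rule w_nonneg)
      have "n - \<epsilon> * n / 4 \<le> sum w (V' - X)"
        using weight_diff_light[of V'] total by simp
      moreover have "\<epsilon> * n \<le> n"
        using \<epsilon> npos by (simp add: mult_left_le_one_le)
      ultimately show "0 < sum w (V' - X)"
        using npos by linarith
      show "\<epsilon> / 8 * sum w (V' - X) \<le> sum w {z \<in> V' - X. (z \<in> A' `` {a}) \<noteq> (z \<in> A' `` {b})}"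
        if ab: "a \<in> Cl y" "b \<in> Cl y" "a \<noteq> b" for a b
      proof -
        have "lbl a = lbl b" and aV: "a \<in> V' - X" and bV: "b \<in> V' - X"
          using ab by (auto simp: Cl_def)
        then have same: "E a = E b" "A' `` {a} \<inter> X = A' `` {b} \<inter> X"
          by (auto simp: lbl_def)
        have aV': "a \<in> V'"
          using aV by simp
        have "\<epsilon> / 8 * sum w (V' - X) \<le> \<epsilon> / 8 * n"
          using \<epsilon> sum_w_mono[of "V' - X" V'] total by (intro mult_left_mono) auto
        also have "\<dots> \<le> sum w {z \<in> V' - X. (z \<in> A' `` {a}) \<noteq> (z \<in> A' `` {b})}"
          using far_in_class[OF aV' same(2) close[OF aV bV ab(3) same]] by simp
        finally show ?thesis .
      qed
      show "\<not> (\<forall>R\<subseteq>S. \<exists>a\<in>Cl y. A' `` {a} \<inter> S = R)" if S: "S \<subseteq> V' - X" "card S = d" for S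
      proof
        assume sh: "\<forall>R\<subseteq>S. \<exists>a\<in>Cl y. A' `` {a} \<inter> S = R"
        have "real (card S) \<le> real r + (4 * sum w V' / (\<epsilon> * n)) ^ (r - 2)"
        proof (rule shattered_bound[OF max S(1)])
          show "Cl y \<subseteq> V' - X"
            by (auto simp: Cl_def)
        qed (use sh in auto)
        moreover have "4 * sum w V' / (\<epsilon> * n) = 4 / \<epsilon>"
          using npos by (simp add: total)
        ultimately have "real d \<le> real r + (4 / \<epsilon>) ^ (r - 2)"
          using S(2) by simp
        then show False
          unfolding d_def by linarith
      qed
    qed
    have fX: "finite X"
      using XV finV by (rule finite_subset)
    define Y where "Y = Pow (Pow X) \<times> Pow X"
    have "V' - X \<subseteq> (\<Union>y\<in>Y. Cl y)"
    proof
      fix v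
      assume v: "v \<in> V' - X"
      then have "lbl v \<in> Y"
        using E'[of v] im'(1) by (auto simp: lbl_def Y_def)
      then show "v \<in> (\<Union>y\<in>Y. Cl y)"
        using v by (auto simp: Cl_def)
    qed
    then have "card (V' - X) \<le> card (\<Union>y\<in>Y. Cl y)"
      using finV fX by (intro card_mono) (auto simp: Y_def Cl_def)
    also have "\<dots> \<le> (\<Sum>y\<in>Y. card (Cl y))"
      using fX by (intro card_UN_le) (simp add: Y_def)
    also have "\<dots> \<le> (\<Sum>y\<in>Y. B0)"
      by (intro sum_mono ClB)
    also have "\<dots> = 2 ^ 2 ^ card X * 2 ^ card X * B0"
      using fX by (simp add: Y_def card_cartesian_product card_Pow)
    also have "\<dots> \<le> 2 ^ 2 ^ b * 2 ^ b * B0"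
      using X(2) by (intro mult_mono power_increasing) auto
    finally have "card (V' - X) \<le> 2 ^ 2 ^ b * 2 ^ b * B0" .
    moreover have "card V' = card X + card (V' - X)"
      using XV finV fX card_mono[OF finV XV] by (simp add: card_Diff_subset)
    ultimately have "card V' \<le> B"
      using X(2) by (simp add: B_def)
    then show "\<exists>V' A' \<phi>. card V' \<le> B \<and> good_image r V A X E V' A' \<phi>"
      using im unfolding img_def by blast
  qed
qed

section \<open>Heavy cliques\<close>

text \<open>The forbidden set may meet \<open>Z\<close>; only the new vertices of \<open>L\<close>
  have to avoid it. Thus an \<open>r\<close>-clique is heavy for every \<open>a\<close>, which
  starts the descent.\<close>

definition heavy :: "nat \<Rightarrow> 'a set \<Rightarrow> ('a \<times> 'a) set \<Rightarrow> nat \<Rightarrow> 'a set \<Rightarrow> bool" where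
  "heavy r V A a Z \<longleftrightarrow>
     (\<forall>B. finite B \<and> card B \<le> a \<longrightarrow>
        (\<exists>L. Z \<subseteq> L \<and> L \<subseteq> V \<and> is_clique A L \<and> card L = r \<and> L \<inter> B \<subseteq> Z))"

text \<open>A sunflower of \<open>r\<close>-cliques with kernel \<open>S\<close>, that is, a copy of
  T. For \<open>k = 1\<close> it is a single \<open>r\<close>-clique with a marked subset.\<close>

definition clique_flower :: "nat \<Rightarrow> nat \<Rightarrow> nat \<Rightarrow> 'a set \<Rightarrow> ('a \<times> 'a) set \<Rightarrow> bool" where
  "clique_flower r k s V A \<longleftrightarrow>
     (\<exists>S L. card S = s \<and>
        (\<forall>j\<in>{1..k}. S \<subseteq> L j \<and> L j \<subseteq> V \<and> is_clique A (L j) \<and> card (L j) = r) \<and>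
        (\<forall>i\<in>{1..k}. \<forall>j\<in>{1..k}. i \<noteq> j \<longrightarrow> L i \<inter> L j = S))"

lemma heavyD:
  assumes "heavy r V A a Z" "finite B" "card B \<le> a"
  obtains L where "Z \<subseteq> L" "L \<subseteq> V" "is_clique A L" "card L = r" "L \<inter> B \<subseteq> Z"
  using assms unfolding heavy_def by blast

lemma heavy_mono: "heavy r V A a Z \<Longrightarrow> a' \<le> a \<Longrightarrow> heavy r V A a' Z"
  by (simp add: heavy_def)

lemma heavy_clique: "K \<subseteq> V \<Longrightarrow> is_clique A K \<Longrightarrow> card K = r \<Longrightarrow> heavy r V A a K"
  unfolding heavy_def by blast

lemma heavy_subset:
  assumes "heavy r V A a Z" "finite V"
  shows "Z \<subseteq> V" "finite Z" "card Z \<le> r"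
proof -
  obtain L where L: "Z \<subseteq> L" "L \<subseteq> V" "card L = r"
    by (rule heavyD[OF assms(1), of "{}"]) simp_all
  have "finite L"
    using L(2) assms(2) by (rule finite_subset)
  then show "Z \<subseteq> V" "finite Z" "card Z \<le> r"
    using L card_mono[of L Z] by (auto intro: finite_subset)
qed

text \<open>The cliques are chosen one after the other. Each choice forbids all the
  \<open>Z j\<close> and all earlier cliques, at most \<open>r * k\<close> vertices each, which
  explains \<open>2 * r * k\<close>. Forbidding the later \<open>Z j\<close> as well keeps an early
  clique from running into them.\<close>

lemma heavy_extend:
  assumes fin: "finite V" and Z: "\<And>j. j \<in> {1..k} \<Longrightarrow> heavy r V A a (Z j)" and a: "2 * r * k \<le> a"
  obtains L where "\<And>j. j \<in> {1..k} \<Longrightarrow> Z j \<subseteq> L j \<and> L j \<subseteq> V \<and> is_clique A (L j) \<and> card (L j) = r"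
    and "\<And>i j. i \<in> {1..k} \<Longrightarrow> j \<in> {1..k} \<Longrightarrow> i \<noteq> j \<Longrightarrow> L i \<inter> L j = Z i \<inter> Z j"
proof -
  define ZZ where "ZZ = (\<Union>j\<in>{1..k}. Z j)"
  note Zs = heavy_subset[OF Z fin]
  have fZZ: "finite ZZ"
    using Zs(2) by (auto simp: ZZ_def)
  have "card ZZ \<le> (\<Sum>j\<in>{1..k}. card (Z j))"
    unfolding ZZ_def by (rule card_UN_le) simp
  also have "\<dots> \<le> (\<Sum>j\<in>{1..k}. r)"
    by (intro sum_mono Zs(3)) auto
  finally have cZZ: "card ZZ \<le> r * k"
    by (simp add: mult.commute)
  have "t \<le> k \<Longrightarrow> \<exists>L. (\<forall>j\<in>{1..t}. Z j \<subseteq> L j \<and> L j \<subseteq> V \<and> is_clique A (L j) \<and> card (L j) = r \<and> L j \<inter> ZZ \<subseteq> Z j)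
      \<and> (\<forall>i\<in>{1..t}. \<forall>j\<in>{1..t}. i \<noteq> j \<longrightarrow> L i \<inter> L j \<subseteq> Z i \<inter> Z j)" for t
  proof (induction t)
    case (Suc t)
    from Suc.IH[OF Suc_leD[OF Suc.prems]] obtain L where
      L0: "\<forall>j\<in>{1..t}. Z j \<subseteq> L j \<and> L j \<subseteq> V \<and> is_clique A (L j) \<and> card (L j) = r \<and> L j \<inter> ZZ \<subseteq> Z j"
        "\<forall>i\<in>{1..t}. \<forall>j\<in>{1..t}. i \<noteq> j \<longrightarrow> L i \<inter> L j \<subseteq> Z i \<inter> Z j"
      by (elim exE conjE)
    note L = L0[rule_format]
    define B where "B = ZZ \<union> (\<Union>j\<in>{1..t}. L j)"
    have "finite (L j)" if "j \<in> {1..t}" for j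
      using L(1)[OF that] fin by (auto intro: finite_subset)
    then have fB: "finite B"
      using fZZ by (auto simp: B_def)
    have "card (\<Union>j\<in>{1..t}. L j) \<le> (\<Sum>j\<in>{1..t}. card (L j))"
      by (rule card_UN_le) simp
    also have "\<dots> = r * t"
      using L(1) by simp
    also have "\<dots> \<le> r * k"
      using Suc.prems by simp
    finally have "card B \<le> a"
      using cZZ a card_Un_le[of ZZ "\<Union>j\<in>{1..t}. L j"] by (simp add: B_def)
    moreover have hs: "heavy r V A a (Z (Suc t))"
      using Suc.prems by (intro Z) auto
    ultimately obtain M where M: "Z (Suc t) \<subseteq> M" "M \<subseteq> V" "is_clique A M" "card M = r" "M \<inter> B \<subseteq> Z (Suc t)"
      using heavyD[OF hs fB] by metis
    have ZS: "Z (Suc t) \<subseteq> ZZ"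
      unfolding ZZ_def using Suc.prems by (intro UN_upper) auto
    have MZ: "M \<inter> ZZ \<subseteq> Z (Suc t)" and MLi: "\<And>i. i \<in> {1..t} \<Longrightarrow> M \<inter> L i \<subseteq> Z (Suc t)"
      using M(5) by (auto simp: B_def)
    have Mi: "M \<inter> L i \<subseteq> Z i \<inter> Z (Suc t)" if i: "i \<in> {1..t}" for i
    proof -
      have "M \<inter> L i \<subseteq> L i \<inter> ZZ"
        using MLi[OF i] ZS by auto
      then show ?thesis
        using L(1)[OF i] MLi[OF i] by blast
    qed
    define L' where "L' = L(Suc t := M)"
    have *: "j \<in> {1..Suc t} \<longleftrightarrow> j = Suc t \<or> j \<in> {1..t}" for j
      by auto
    show ?case
    proof (intro exI[of _ L'] conjI ballI impI)
      fix j
      assume "j \<in> {1..Suc t}"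
      then consider "j = Suc t" | "j \<in> {1..t}" "j \<noteq> Suc t"
        by fastforce
      then show "Z j \<subseteq> L' j" "L' j \<subseteq> V" "is_clique A (L' j)" "card (L' j) = r" "L' j \<inter> ZZ \<subseteq> Z j"
        using M MZ L(1) by (cases; simp add: L'_def)+
      fix i
      assume "i \<in> {1..Suc t}" "i \<noteq> j"
      then show "L' i \<inter> L' j \<subseteq> Z i \<inter> Z j"
      proof -
        have ij: "i \<in> {1..t} \<or> i = Suc t" "j \<in> {1..t} \<or> j = Suc t"
          using \<open>i \<in> {1..Suc t}\<close> \<open>j \<in> {1..Suc t}\<close> * by auto
        have ne: "l \<noteq> Suc t" if "l \<in> {1..t}" for l
          using that by simp
        consider "i \<in> {1..t}" "j \<in> {1..t}" | "i = Suc t" "j \<in> {1..t}" | "i \<in> {1..t}" "j = Suc t"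
          using ij \<open>i \<noteq> j\<close> by blast
        then show ?thesis
        proof cases
          case 1
          then show ?thesis
            using L(2)[OF 1 \<open>i \<noteq> j\<close>] ne by (simp add: L'_def)
        next
          case 2
          then show ?thesis
            using Mi[OF 2(2)] ne[OF 2(2)] by (simp add: L'_def Int_commute)
        next
          case 3
          then show ?thesis
            using Mi[OF 3(1)] ne[OF 3(1)] by (simp add: L'_def Int_commute)
        qed
      qed
    qed
  qed auto
  from this[OF order_refl] obtain L where
    L0: "\<forall>j\<in>{1..k}. Z j \<subseteq> L j \<and> L j \<subseteq> V \<and> is_clique A (L j) \<and> card (L j) = r \<and> L j \<inter> ZZ \<subseteq> Z j"
      "\<forall>i\<in>{1..k}. \<forall>j\<in>{1..k}. i \<noteq> j \<longrightarrow> L i \<inter> L j \<subseteq> Z i \<inter> Z j"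
    by (elim exE conjE)
  note L = L0[rule_format]
  show ?thesis
  proof (rule that[of L])
    fix i j
    assume ij: "i \<in> {1..k}" "j \<in> {1..k}" "i \<noteq> j"
    then show "L i \<inter> L j = Z i \<inter> Z j"
      using L(2)[OF ij] L(1)[OF ij(1)] L(1)[OF ij(2)] by blast
  qed (use L(1) in simp)
qed

lemma heavy_flower:
  assumes "finite V" "heavy r V A a S" "card S = s" "2 * r * k \<le> a"
  shows "clique_flower r k s V A"
proof -
  obtain L where L: "\<And>j. j \<in> {1..k} \<Longrightarrow> S \<subseteq> L j \<and> L j \<subseteq> V \<and> is_clique A (L j) \<and> card (L j) = r"
    "\<And>i j. i \<in> {1..k} \<Longrightarrow> j \<in> {1..k} \<Longrightarrow> i \<noteq> j \<Longrightarrow> L i \<inter> L j = S \<inter> S"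
    using heavy_extend[OF assms(1), of k r A a "\<lambda>_. S"] assms(2,4) by metis
  show ?thesis
    unfolding clique_flower_def using L assms(3) by (intro exI[of _ S] exI[of _ L]) auto
qed

lemma heavy_star_flower:
  assumes V: "finite V" and Z: "\<And>j. j \<in> {1..k} \<Longrightarrow> heavy r V A a (insert v (e j))"
    and disj: "\<And>i j. i \<in> {1..k} \<Longrightarrow> j \<in> {1..k} \<Longrightarrow> i \<noteq> j \<Longrightarrow> e i \<inter> e j \<subseteq> {v}" and a: "2 * r * k \<le> a"
  shows "clique_flower r k 1 V A"
proof -
  obtain L where L: "\<And>j. j \<in> {1..k} \<Longrightarrow> insert v (e j) \<subseteq> L j \<and> L j \<subseteq> V \<and> is_clique A (L j) \<and> card (L j) = r"
    "\<And>i j. i \<in> {1..k} \<Longrightarrow> j \<in> {1..k} \<Longrightarrow> i \<noteq> j \<Longrightarrow> L i \<inter> L j = insert v (e i) \<inter> insert v (e j)"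
    using heavy_extend[OF V, of k r A a "\<lambda>j. insert v (e j)"] Z a by metis
  have "L i \<inter> L j = {v}" if "i \<in> {1..k}" "j \<in> {1..k}" "i \<noteq> j" for i j
    using L(2)[OF that] disj[OF that] by blast
  then show ?thesis
    unfolding clique_flower_def using L(1) by (intro exI[of _ "{v}"] exI[of _ L]) auto
qed

section \<open>Heavy cliques under the degree condition\<close>

locale dense_graph = weighted_graph V A "\<lambda>_. 1" m
  for V :: "'a set" and A :: "('a \<times> 'a) set" and m :: real +
  fixes r :: nat and \<beta> :: real
  assumes r3: "3 \<le> r" and dense: "(2 * real r - 3) * m + \<beta> \<le> 2 * real (card V)" and \<beta>_pos: "0 < \<beta>"
begin

text \<open>If no \<open>Z - {u}\<close> were heavy, there would be an \<open>r\<close>-clique \<open>L\<close> containing \<open>Z\<close> such that almost every common neighbour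
  of \<open>A0\<close> misses two of the three vertices of \<open>Z - A0\<close> or a vertex of \<open>L - Z\<close>. Giving the latter weight 2, this
  contradicts the degree condition.\<close>

lemma heavy_down:
  assumes Z: "heavy r V A (3 * a) Z" and A0: "A0 \<subseteq> Z" "card Z = card A0 + 3" and a: "6 * real a < \<beta>"
  shows "\<exists>u\<in>Z - A0. heavy r V A a (Z - {u})"
proof (rule ccontr)
  assume no: "\<not> ?thesis"
  have "\<exists>B. finite B \<and> card B \<le> a \<and>
      \<not> (\<exists>L. Z - {u} \<subseteq> L \<and> L \<subseteq> V \<and> is_clique A L \<and> card L = r \<and> L \<inter> B \<subseteq> Z - {u})" if "u \<in> Z - A0" for u
    using no that unfolding heavy_def by blast
  then obtain B where B: "\<And>u. u \<in> Z - A0 \<Longrightarrow> finite (B u) \<and> card (B u) \<le> a"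
    "\<And>u L. u \<in> Z - A0 \<Longrightarrow> Z - {u} \<subseteq> L \<Longrightarrow> L \<subseteq> V \<Longrightarrow> is_clique A L \<Longrightarrow> card L = r \<Longrightarrow> \<not> L \<inter> B u \<subseteq> Z - {u}"
    by metis
  note Zs = heavy_subset[OF Z finV]
  have fA0: "finite A0"
    using A0(1) Zs(2) by (rule finite_subset)
  have c3: "card (Z - A0) = 3"
    using A0 fA0 by (simp add: card_Diff_subset)
  \<comment> \<open>Each of the three candidates \<open>u\<close> has a blocking set
    \<open>B u\<close> of at most \<open>a\<close> vertices. All three have to be avoided at once,
    hence the loss from \<open>3 * a\<close> to \<open>a\<close>. Removing them also from
    \<open>S\<close> costs \<open>6 * a\<close> in the doubled count, which \<open>\<beta>\<close>
    covers.\<close>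
  define BB where "BB = (\<Union>u\<in>Z - A0. B u)"
  have fBB: "finite BB"
    using B(1) Zs(2) by (auto simp: BB_def)
  have "card BB \<le> (\<Sum>u\<in>Z - A0. card (B u))"
    unfolding BB_def using Zs(2) by (intro card_UN_le) simp
  also have "\<dots> \<le> (\<Sum>u\<in>Z - A0. a)"
    using B(1) by (intro sum_mono) auto
  finally have cBB: "card BB \<le> 3 * a"
    using c3 by simp
  obtain L where L: "Z \<subseteq> L" "L \<subseteq> V" "is_clique A L" "card L = r" "L \<inter> BB \<subseteq> Z"
    by (rule heavyD[OF Z fBB cBB])
  have fL: "finite L"
    using L(2) finV by (rule finite_subset)
  define c :: "'a \<Rightarrow> real" where "c d = (if d \<in> Z then 1 else 2)" for d
  define W where "W = L - A0"
  define S where "S = common_nbhd V A A0 - BB"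
  have fW: "finite W"
    using fL by (simp add: W_def)
  have SV: "S \<subseteq> V"
    by (auto simp: S_def common_nbhd_def)
  have two: "2 \<le> sum c (W - A `` {z})" if z: "z \<in> S" for z
  proof (rule ccontr)
    assume lt: "\<not> ?thesis"
    have fin: "finite (W - A `` {z})"
      using fW by simp
    have "(\<Sum>d\<in>W - A `` {z}. 1) \<le> sum c (W - A `` {z})"
      by (intro sum_mono) (auto simp: c_def)
    then have "\<not> 2 \<le> card (W - A `` {z})"
      using lt by simp
    then have one: "W - A `` {z} = {} \<or> (\<exists>d. W - A `` {z} = {d})"
      by (rule card_lt_2[OF fin])
    have "\<exists>u\<in>Z - A0. W - {u} \<subseteq> A `` {z}"
    proof (cases "W - A `` {z} = {}")
      case True
      have "Z - A0 \<noteq> {}"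
        using c3 by (metis card.empty zero_neq_numeral)
      then show ?thesis
        using True by blast
    next
      case False
      then obtain d where d: "W - A `` {z} = {d}"
        using one by blast
      then have "d \<in> Z"
        using lt by (auto simp: c_def split: if_splits)
      moreover have "d \<notin> A0"
        using d by (auto simp: W_def)
      ultimately show ?thesis
        using d by blast
    qed
    then obtain u where u: "u \<in> Z - A0" "W - {u} \<subseteq> A `` {z}"
      by blast
    have adj: "L - {u} \<subseteq> A `` {z}"
      using u(2) z adj_sym by (auto simp: W_def S_def common_nbhd_def)
    have zL: "z \<notin> L - {u}"
      using adj not_adj_self by auto
    have uL: "u \<in> L"
      using u L(1) by auto
    define L' where "L' = insert z (L - {u})"
    have "is_clique A L'"
      unfolding L'_def by (rule is_clique_insert[OF symA is_clique_subset[OF L(3)] adj]) auto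
    moreover have "card L' = r"
      unfolding L'_def using zL uL fL L(4) by (metis card_Suc_Diff1 card_insert_disjoint finite_Diff)
    moreover have "L' \<subseteq> V"
      using L(2) z SV by (auto simp: L'_def)
    moreover have "Z - {u} \<subseteq> L'"
      using L(1) by (auto simp: L'_def)
    moreover have "L' \<inter> B u \<subseteq> Z - {u}"
    proof
      fix y
      assume y: "y \<in> L' \<inter> B u"
      then have "y \<in> BB"
        using u(1) by (auto simp: BB_def)
      then have "y \<in> L - {u}"
        using y z by (auto simp: L'_def S_def)
      then show "y \<in> Z - {u}"
        using L(5) \<open>y \<in> BB\<close> by auto
    qed
    ultimately show False
      using B(2)[OF u(1)] by blast
  qed
  have sumc: "sum c W = 2 * real r - 2 * real (card A0) - 3"
  proof -
    have "sum c W = sum c (Z - A0) + sum c (L - Z)"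
      using fL L(1) A0(1) by (subst sum.union_disjoint[symmetric]) (auto simp: W_def intro: arg_cong2[where f = sum] finite_subset)
    also have "\<dots> = real (card (Z - A0)) + 2 * real (card (L - Z))"
      by (simp add: c_def)
    also have "card (L - Z) = r - card Z"
      using L Zs(2) by (simp add: card_Diff_subset)
    finally show ?thesis
      using c3 A0(2) Zs(3) by simp
  qed
  have "(\<Sum>z\<in>S. 1 * 2) \<le> sum c W * m"
    using two L(2) SV by (intro miss_count) (auto simp: W_def c_def)
  then have 1: "2 * real (card S) \<le> (2 * real r - 2 * real (card A0) - 3) * m"
    by (simp add: sumc)
  have "real (card V) - real (card A0) * m \<le> real (card (V \<inter> common_nbhd V A A0))"
    using common_nbhd_weight[of V A0] A0(1) Zs(1) by simp
  also have "V \<inter> common_nbhd V A A0 = common_nbhd V A A0"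
    by (auto simp: common_nbhd_def)
  also have "real (card (common_nbhd V A A0)) \<le> real (card S) + real (card BB)"
  proof -
    have "card (common_nbhd V A A0) \<le> card (S \<union> BB)"
      using fBB finite_subset[OF SV finV] by (intro card_mono) (auto simp: S_def)
    also have "\<dots> \<le> card S + card BB"
      by (rule card_Un_le)
    finally show ?thesis by simp
  qed
  finally show False
    using 1 dense a cBB by (simp add: algebra_simps)
qed

text \<open>Each removed vertex costs a factor 3. It is chosen among three vertices outside
  \<open>C\<close>, with \<open>A0\<close> consisting of all others, so \<open>Z\<close> needs three
  vertices outside \<open>C\<close> before each removal. As \<open>Z\<close> then has at least
  \<open>j + 1\<close> elements, this is the condition \<open>card C + 2 \<le> j\<close>.\<close>

lemma heavy_descend:
  assumes "heavy r V A (3 ^ i * a) Z" "card Z = j + i" "C \<subseteq> Z" "card C + 2 \<le> j" "6 * 3 ^ i * real a < \<beta>"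
  shows "\<exists>Z'\<subseteq>Z. C \<subseteq> Z' \<and> card Z' = j \<and> heavy r V A a Z'"
  using assms
proof (induction i arbitrary: Z)
  case (Suc i)
  note Zs = heavy_subset[OF Suc.prems(1) finV]
  have fC: "finite C"
    using Suc.prems(3) Zs(2) by (rule finite_subset)
  have "card (Z - C) = j + Suc i - card C"
    using Suc.prems(2,3) fC by (simp add: card_Diff_subset)
  then have "j + Suc i - 3 - card C \<le> card (Z - C)"
    by simp
  then obtain D where D: "D \<subseteq> Z - C" "card D = j + Suc i - 3 - card C"
    by (meson obtain_subset_with_card_n)
  have fD: "finite D"
    using D(1) Zs(2) by (meson finite_Diff finite_subset)
  define A0 where "A0 = C \<union> D"
  have "card A0 = card C + card D"
    unfolding A0_def using D(1) fC fD by (intro card_Un_disjoint) auto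
  then have A0: "A0 \<subseteq> Z" "card Z = card A0 + 3"
    using D Suc.prems by (auto simp: A0_def)
  have h: "heavy r V A (3 * (3 ^ i * a)) Z"
    using Suc.prems(1) by (simp add: mult.assoc)
  have "6 * real (3 ^ i * a) \<le> 6 * 3 ^ Suc i * real a"
    by simp
  then have lt: "6 * real (3 ^ i * a) < \<beta>"
    using Suc.prems(5) by linarith
  obtain u where u: "u \<in> Z - A0" "heavy r V A (3 ^ i * a) (Z - {u})"
    using heavy_down[OF h A0 lt] by blast
  have "\<exists>Z'\<subseteq>Z - {u}. C \<subseteq> Z' \<and> card Z' = j \<and> heavy r V A a Z'"
  proof (rule Suc.IH[OF u(2)])
    show "card (Z - {u}) = j + i"
      using u(1) Zs(2) Suc.prems(2) by simp
    show "C \<subseteq> Z - {u}"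
      using Suc.prems(3) u(1) by (auto simp: A0_def)
    show "6 * 3 ^ i * real a < \<beta>"
      using lt by simp
  qed (rule Suc.prems(4))
  then show ?case
    by blast
qed auto

text \<open>The descent from an \<open>r\<close>-clique with \<open>C = {}\<close> reaches every
  size down to 2, and a heavy set of size \<open>s\<close> is the kernel of a flower. It does not
  reach single vertices, hence the separate treatment of \<open>s = 1\<close>.\<close>

lemma no_clique_if_no_flower:
  assumes s: "2 \<le> s" "s \<le> r" and no: "\<not> clique_flower r k s V A" and big: "12 * 3 ^ r * real (r * k) < \<beta>"
  shows "\<not> (\<exists>K\<subseteq>V. is_clique A K \<and> card K = r)"
proof
  assume "\<exists>K\<subseteq>V. is_clique A K \<and> card K = r"
  then obtain K where K: "K \<subseteq> V" "is_clique A K" "card K = r"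
    by blast
  have "(3::real) ^ (r - s) \<le> 3 ^ r"
    by (intro power_increasing) auto
  then have "6 * 3 ^ (r - s) * real (2 * r * k) \<le> 6 * 3 ^ r * real (2 * r * k)"
    by (intro mult_right_mono mult_left_mono) auto
  then have lt: "6 * 3 ^ (r - s) * real (2 * r * k) < \<beta>"
    using big by simp
  have "\<exists>Z\<subseteq>K. {} \<subseteq> Z \<and> card Z = s \<and> heavy r V A (2 * r * k) Z"
  proof (rule heavy_descend)
    show "heavy r V A (3 ^ (r - s) * (2 * r * k)) K"
      by (rule heavy_clique[OF K])
  qed (use s K(3) lt in simp_all)
  then obtain Z where "card Z = s" "heavy r V A (2 * r * k) Z"
    by blast
  then have "clique_flower r k s V A"
    by (intro heavy_flower[OF finV]) auto
  then show False
    using no by simp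
qed

definition heavy_pairs :: "nat \<Rightarrow> 'a \<Rightarrow> 'a set set" where
  "heavy_pairs a v = {e. card e = 2 \<and> heavy r V A a e \<and> heavy r V A a (insert v e)}"

lemma good_heavy_pairs:
  assumes "18 * 3 ^ r * real a < \<beta>"
  shows "good r V A (heavy_pairs a)"
  unfolding good_def
proof (intro allI impI ballI)
  fix K v
  assume KV: "K \<subseteq> V" and K: "is_clique A K \<and> card K = r" and v: "v \<in> K"
  have "(3::real) ^ (r - 3) \<le> 3 ^ r"
    by (rule power_increasing) simp_all
  then have "6 * 3 ^ (r - 3) * real (3 * a) \<le> 6 * 3 ^ r * real (3 * a)"
    by (intro mult_right_mono mult_left_mono) auto
  then have lt: "6 * 3 ^ (r - 3) * real (3 * a) < \<beta>"
    using assms by simp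
  have "\<exists>Z\<subseteq>K. {v} \<subseteq> Z \<and> card Z = 3 \<and> heavy r V A (3 * a) Z"
  proof (rule heavy_descend)
    show "heavy r V A (3 ^ (r - 3) * (3 * a)) K"
      using KV K by (intro heavy_clique) auto
  qed (use K v r3 lt in simp_all)
  then obtain Z where Z: "Z \<subseteq> K" "v \<in> Z" "card Z = 3" "heavy r V A (3 * a) Z"
    by blast
  have "(1::real) * real a \<le> 3 ^ r * real a"
    by (intro mult_right_mono one_le_power) auto
  moreover have "0 \<le> real a"
    by simp
  ultimately have "6 * real a < \<beta>"
    using assms by linarith
  then obtain u where u: "u \<in> Z" "heavy r V A a (Z - {u})"
    using heavy_down[OF Z(4), of "{}"] Z(3) by auto
  have fZ: "finite Z"
    using Z(3) by (metis card.infinite zero_neq_numeral)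
  have "card (Z - {u}) = 2"
    using u(1) Z(3) fZ by simp
  moreover have "heavy r V A a (insert v (Z - {u}))"
  proof (cases "u = v")
    case True
    then show ?thesis
      using Z heavy_mono[OF Z(4), of a] by (simp add: insert_absorb)
  next
    case False
    then show ?thesis
      using Z(2) u(2) by (simp add: insert_absorb)
  qed
  ultimately have "Z - {u} \<in> heavy_pairs a v"
    using u(2) by (simp add: heavy_pairs_def)
  then show "\<exists>e\<in>heavy_pairs a v. e \<subseteq> K"
    using Z(1) by blast
qed

text \<open>Some vertex \<open>z\<close> misses at most one vertex in each of \<open>k\<close> of
  the cliques, so \<open>z\<close> with \<open>r - 1\<close> of its neighbours in each of them is a
  flower with kernel \<open>{z}\<close>. Otherwise almost every pair of a vertex and a clique has at
  least two misses, although a clique collects at most \<open>r * m\<close> misses in total and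
  \<open>r \<le> 2 * r - 3\<close>.\<close>

lemma disjoint_cliques_flower:
  assumes L: "\<And>j. j \<in> {1..t} \<Longrightarrow> L j \<subseteq> V \<and> is_clique A (L j) \<and> card (L j) = r"
    and disj: "\<And>i j. i \<in> {1..t} \<Longrightarrow> j \<in> {1..t} \<Longrightarrow> i \<noteq> j \<Longrightarrow> L i \<inter> L j = {}"
    and t: "2 * real k * real (card V) < real t * \<beta>"
  shows "clique_flower r k 1 V A"
proof -
  define T where "T z = {j \<in> {1..t}. 2 \<le> card (L j - A `` {z})}" for z
  have fT: "finite (T z)" "card (T z) \<le> t" for z
  proof -
    have "T z \<subseteq> {1..t}"
      by (auto simp: T_def)
    then show "finite (T z)" "card (T z) \<le> t"
      using card_mono[of "{1..t}" "T z"] by (auto intro: finite_subset)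
  qed
  have "t \<noteq> 0"
    using t by (intro notI) (simp add: mult_less_0_iff)
  then have "1 \<in> {1..t}"
    by simp
  then have "L 1 \<noteq> {}" "L 1 \<subseteq> V"
    using L r3 by force+
  then obtain v0 where "v0 \<in> V"
    by blast
  then have m0: "0 \<le> m"
    using miss[of v0] by (simp add: order_trans[OF of_nat_0_le_iff])
  have "\<exists>z\<in>V. k \<le> card ({1..t} - T z)"
  proof (rule ccontr)
    assume no: "\<not> ?thesis"
    have "real (card V) * (2 * (real t - real k)) = (\<Sum>z\<in>V. 2 * (real t - real k))"
      by simp
    also have "\<dots> \<le> (\<Sum>z\<in>V. \<Sum>j\<in>{1..t}. 1 * (if j \<in> T z then 2 else 0))"
    proof (rule sum_mono)
      fix z
      assume "z \<in> V"
      then have "card ({1..t} - T z) < k"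
        using no by auto
      moreover have "T z \<subseteq> {1..t}"
        by (auto simp: T_def)
      ultimately have "t - card (T z) < k"
        using fT by (simp add: card_Diff_subset)
      then have "real t \<le> real (k + card (T z))"
        by (intro of_nat_mono) simp
      then have "2 * (real t - real k) \<le> 2 * real (card (T z))"
        by simp
      also have "\<dots> = (\<Sum>j\<in>{1..t} \<inter> T z. 2)"
        using \<open>T z \<subseteq> {1..t}\<close> by (simp add: Int_absorb1)
      also have "\<dots> = (\<Sum>j\<in>{1..t}. if j \<in> T z then 2 else 0)"
        by (rule sum.inter_restrict) simp
      finally show "2 * (real t - real k) \<le> (\<Sum>j\<in>{1..t}. 1 * (if j \<in> T z then 2 else 0))"
        by simp
    qed
    also have "\<dots> = (\<Sum>j\<in>{1..t}. \<Sum>z\<in>V. 1 * (if j \<in> T z then 2 else 0))"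
      by (rule sum.swap)
    also have "\<dots> \<le> (\<Sum>j\<in>{1..t}. real r * m)"
    proof (rule sum_mono)
      fix j
      assume j: "j \<in> {1..t}"
      have "(\<Sum>z\<in>V. 1 * (if j \<in> T z then 2 else 0)) \<le> sum (\<lambda>_. 1) (L j) * m"
        using L[OF j] by (intro miss_count) (auto simp: T_def)
      then show "(\<Sum>z\<in>V. 1 * (if j \<in> T z then 2 else 0)) \<le> real r * m"
        using L[OF j] by simp
    qed
    also have "\<dots> = real t * (real r * m)"
      by simp
    also have "\<dots> \<le> real t * (2 * real (card V) - \<beta>)"
    proof (rule mult_left_mono)
      have "real r * m \<le> (2 * real r - 3) * m"
        using m0 r3 by (intro mult_right_mono) auto
      then show "real r * m \<le> 2 * real (card V) - \<beta>"
        using dense by linarith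
    qed simp
    finally show False
      using t by (simp add: algebra_simps)
  qed
  then obtain z J where z: "z \<in> V" and J: "J \<subseteq> {1..t} - T z" "card J = k"
    by (meson obtain_subset_with_card_n)
  have fJ: "finite J"
    using J(1) by (meson finite_Diff finite_atLeastAtMost finite_subset)
  obtain h where h: "bij_betw h {1..k} J"
    using fJ J(2) by (metis card_atLeastAtMost diff_Suc_1 finite_atLeastAtMost finite_same_card_bij)
  have hJ: "h j \<in> {1..t}" "\<not> 2 \<le> card (L (h j) - A `` {z})" if "j \<in> {1..k}" for j
  proof -
    have "h j \<in> J"
      using bij_betwE[OF h] that by simp
    then have "h j \<in> {1..t} - T z"
      using J(1) by blast
    then show "h j \<in> {1..t}" "\<not> 2 \<le> card (L (h j) - A `` {z})"
      unfolding T_def by blast+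
  qed
  have "\<exists>P\<subseteq>L (h j) \<inter> A `` {z}. card P = r - 1" if j: "j \<in> {1..k}" for j
  proof -
    have fL: "finite (L (h j))"
      using L[OF hJ(1)[OF j]] finV by (auto intro: finite_subset)
    have "card (L (h j)) = card (L (h j) \<inter> A `` {z}) + card (L (h j) - A `` {z})"
      using fL by (metis card_Int_Diff)
    then have "r - 1 \<le> card (L (h j) \<inter> A `` {z})"
      using hJ(2)[OF j] L[OF hJ(1)[OF j]] by linarith
    then show ?thesis
      by (meson obtain_subset_with_card_n)
  qed
  then obtain P where P: "\<And>j. j \<in> {1..k} \<Longrightarrow> P j \<subseteq> L (h j) \<inter> A `` {z}" "\<And>j. j \<in> {1..k} \<Longrightarrow> card (P j) = r - 1"
    by metis
  have zP: "z \<notin> P j" if "j \<in> {1..k}" for j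
    using P(1)[OF that] not_adj_self by auto
  show ?thesis
    unfolding clique_flower_def
  proof (intro exI[of _ "{z}"] exI[of _ "\<lambda>j. insert z (P j)"] conjI ballI impI)
    fix j
    assume j: "j \<in> {1..k}"
    have PL: "P j \<subseteq> L (h j)" "P j \<subseteq> A `` {z}"
      using P(1)[OF j] by auto
    have Lj: "L (h j) \<subseteq> V" "is_clique A (L (h j))"
      using L[OF hJ(1)[OF j]] by auto
    show "insert z (P j) \<subseteq> V"
      using PL(1) Lj(1) z by auto
    show "is_clique A (insert z (P j))"
      by (rule is_clique_insert[OF symA is_clique_subset[OF Lj(2) PL(1)] PL(2)])
    have "finite (P j)"
      using PL(1) Lj(1) finV by (meson finite_subset)
    then show "card (insert z (P j)) = r"
      using P(2)[OF j] zP[OF j] r3 by simp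
  next
    fix i j
    assume ij: "i \<in> {1..k}" "j \<in> {1..k}" "i \<noteq> j"
    then have "h i \<noteq> h j"
      using h unfolding bij_betw_def by (meson inj_onD)
    then have "L (h i) \<inter> L (h j) = {}"
      using ij by (intro disj hJ)
    then show "insert z (P i) \<inter> insert z (P j) = {z}"
      using P(1)[OF ij(1)] P(1)[OF ij(2)] by blast
  qed auto
qed

text \<open>Regard heavy pairs as edges of a graph. Degrees are below \<open>k\<close>, since
  \<open>k\<close> heavy pairs at one vertex extend to a flower centred there. A matching has at
  most \<open>t\<close> edges, since \<open>t\<close> disjoint heavy pairs extend to
  \<open>t\<close> disjoint cliques. Every heavy pair meets a maximal matching, so at most
  \<open>2 * t\<close> vertices and their neighbours are covered.\<close>

lemma heavy_pairs_bounded: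
  assumes no: "\<not> clique_flower r k 1 V A" and t: "2 * real k * real (card V) < real t * \<beta>"
    and a: "2 * r * (k + t) \<le> a"
  shows "card (\<Union>{e. card e = 2 \<and> heavy r V A a e}) \<le> 2 * t * k"
proof -
  define HP where "HP = {e. card e = 2 \<and> heavy r V A a e}"
  have HPV: "HP \<subseteq> Pow V"
  proof
    fix e
    assume "e \<in> HP"
    then have "heavy r V A a e"
      by (simp add: HP_def)
    then show "e \<in> Pow V"
      using heavy_subset(1)[OF _ finV] by simp
  qed
  have fHP: "finite HP"
    using HPV finV by (meson finite_Pow_iff finite_subset)
  define MM where "MM = {M. M \<subseteq> HP \<and> (\<forall>a\<in>M. \<forall>b\<in>M. a \<noteq> b \<longrightarrow> a \<inter> b = {})}"
  have small: "card M \<le> t" if M: "M \<in> MM" for M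
  proof (rule ccontr)
    assume "\<not> card M \<le> t"
    then obtain M' where M': "M' \<subseteq> M" "card M' = t"
      by (meson nat_le_linear obtain_subset_with_card_n)
    have "finite M'"
      using M' M fHP by (auto simp: MM_def intro: finite_subset)
    then obtain e where e: "bij_betw e {1..t} M'"
      using M'(2) by (metis card_atLeastAtMost diff_Suc_1 finite_atLeastAtMost finite_same_card_bij)
    have eM: "e j \<in> M" if "j \<in> {1..t}" for j
      using bij_betwE[OF e] M'(1) that by blast
    have hv: "heavy r V A a (e j)" if "j \<in> {1..t}" for j
      using eM[OF that] M by (auto simp: MM_def HP_def)
    have dis: "e i \<inter> e j = {}" if "i \<in> {1..t}" "j \<in> {1..t}" "i \<noteq> j" for i j
    proof -
      have "e i \<noteq> e j"
        using e that unfolding bij_betw_def by (meson inj_onD)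
      then show ?thesis
        using eM that(1,2) M by (simp add: MM_def)
    qed
    have "2 * r * t \<le> 2 * r * (k + t)"
      by simp
    then have at: "2 * r * t \<le> a"
      using a by linarith
    show False
    proof (rule heavy_extend[OF finV hv at])
      fix L
      assume L: "\<And>j. j \<in> {1..t} \<Longrightarrow> e j \<subseteq> L j \<and> L j \<subseteq> V \<and> is_clique A (L j) \<and> card (L j) = r"
        "\<And>i j. i \<in> {1..t} \<Longrightarrow> j \<in> {1..t} \<Longrightarrow> i \<noteq> j \<Longrightarrow> L i \<inter> L j = e i \<inter> e j"
      have "clique_flower r k 1 V A"
        by (rule disjoint_cliques_flower[of t L k, OF _ _ t]) (use L dis in simp_all)
      then show False
        using no by simp
    qed
  qed
  have "{} \<in> MM"
    by (simp add: MM_def)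
  moreover have "finite MM"
    using fHP by (simp add: MM_def)
  ultimately obtain M where M: "M \<in> MM" and Mmax: "\<And>M'. M' \<in> MM \<Longrightarrow> M \<subseteq> M' \<Longrightarrow> M = M'"
    using finite_has_maximal2[of MM "{}"] by metis
  define nb where "nb x = {y. y \<noteq> x \<and> {x, y} \<in> HP}" for x
  have nbV: "finite (nb x)" for x
    using HPV finV by (intro finite_subset[of "nb x" V]) (auto simp: nb_def)
  have nb: "card (nb x) < k" for x
  proof (rule ccontr)
    assume "\<not> card (nb x) < k"
    then obtain Y where Y: "Y \<subseteq> nb x" "card Y = k"
      by (meson not_le obtain_subset_with_card_n)
    then obtain y where y: "bij_betw y {1..k} Y"
      using nbV by (metis card_atLeastAtMost diff_Suc_1 finite_atLeastAtMost finite_same_card_bij finite_subset)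
    have "2 * r * k \<le> 2 * r * (k + t)"
      by simp
    then have ak: "2 * r * k \<le> a"
      using a by linarith
    have "clique_flower r k 1 V A"
    proof (rule heavy_star_flower[OF finV _ _ ak])
      fix j
      assume j: "j \<in> {1..k}"
      then have "y j \<in> nb x"
        using bij_betwE[OF y] Y(1) by blast
      then show "heavy r V A a (insert x {y j})"
        by (simp add: nb_def HP_def)
      fix i
      assume "i \<in> {1..k}" "i \<noteq> j"
      then have "y i \<noteq> y j"
        using y j unfolding bij_betw_def by (meson inj_onD)
      then show "{y i} \<inter> {y j} \<subseteq> {x}"
        by simp
    qed
    then show False
      using no by simp
  qed
  have c2: "card e = 2" if "e \<in> HP" for e
    using that by (simp add: HP_def)
  have "card (\<Union>M) \<le> (\<Sum>e\<in>M. card e)"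
    by (rule card_Union_le_sum_card)
  also have "\<dots> = 2 * card M"
    using M c2 by (simp add: MM_def subset_iff)
  also have "\<dots> \<le> 2 * t"
    using small[OF M] by simp
  finally have cM: "card (\<Union>M) \<le> 2 * t" .
  have fUM: "finite (\<Union>M)"
    using M HPV finV by (auto simp: MM_def intro!: finite_subset[of "\<Union>M" V])
  have "\<Union>HP \<subseteq> (\<Union>x\<in>\<Union>M. insert x (nb x))"
  proof
    fix y
    assume "y \<in> \<Union>HP"
    then obtain e where e: "e \<in> HP" "y \<in> e"
      by blast
    have "\<exists>x\<in>\<Union>M. x \<in> e"
    proof (rule ccontr)
      assume no_x: "\<not> ?thesis"
      then have "\<forall>e'\<in>M. e \<inter> e' = {}"
        by blast
      then have "insert e M \<in> MM"
        using M e(1) by (simp add: MM_def Int_commute)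
      then have "e \<in> M"
        using Mmax by blast
      then show False
        using no_x e(2) by blast
    qed
    then obtain x where x: "x \<in> \<Union>M" "x \<in> e"
      by blast
    have "y \<in> insert x (nb x)"
    proof (cases "y = x")
      case False
      have "finite e"
        using c2[OF e(1)] by (metis card.infinite zero_neq_numeral)
      then have "{x, y} = e"
        using e(2) x(2) False c2[OF e(1)] by (intro card_subset_eq) auto
      then show ?thesis
        using e(1) False by (simp add: nb_def)
    qed simp
    then show "y \<in> (\<Union>x\<in>\<Union>M. insert x (nb x))"
      using x(1) by blast
  qed
  then have "card (\<Union>HP) \<le> card (\<Union>x\<in>\<Union>M. insert x (nb x))"
    using fUM nbV by (intro card_mono finite_UN_I) auto
  also have "\<dots> \<le> (\<Sum>x\<in>\<Union>M. card (insert x (nb x)))"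
    by (rule card_UN_le[OF fUM])
  also have "\<dots> \<le> (\<Sum>x\<in>\<Union>M. k)"
  proof (rule sum_mono)
    fix x
    have "card (insert x (nb x)) \<le> Suc (card (nb x))"
      by (rule card_insert_le_m1) simp_all
    then show "card (insert x (nb x)) \<le> k"
      using nb[of x] by linarith
  qed
  also have "\<dots> \<le> 2 * t * k"
    using cM by simp
  finally show ?thesis
    by (simp add: HP_def)
qed

end

section \<open>Bounded images that preserve flower-freeness\<close>

lemma bounded_flower_free_image:
  fixes \<epsilon> :: real
  assumes r: "3 \<le> r" and k: "1 \<le> k" and s: "1 \<le> s" "s \<le> r" and \<epsilon>: "0 < \<epsilon>" "\<epsilon> \<le> 1"
  shows "\<exists>N::nat. \<forall>(V :: 'a set) A m.
    finite V \<and> sym A \<and> irrefl A \<and> A \<subseteq> V \<times> V \<and> \<not> clique_flower r k s V A \<and>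
    (\<forall>v\<in>V. real (card (V - A `` {v})) \<le> m) \<and>
    (2 * real r - 3) * m + \<epsilon> * real (card V) \<le> 2 * real (card V)
    \<longrightarrow> (\<exists>V' A' \<phi>. V' \<subseteq> V \<and> card V' \<le> N \<and> \<phi> ` V \<subseteq> V' \<and> (\<forall>(x, y)\<in>A. (\<phi> x, \<phi> y) \<in> A') \<and>
          sym A' \<and> irrefl A' \<and> A' \<subseteq> V' \<times> V' \<and> \<not> clique_flower r k s V' A')"
proof -
  \<comment> \<open>\<open>t * \<epsilon>\<close> exceeds \<open>2 * k\<close>, as required to turn
    \<open>t\<close> disjoint cliques into a flower. With \<open>a\<close> one can extend
    \<open>t\<close> disjoint heavy pairs as well as \<open>k\<close> heavy pairs at one vertex, and
    \<open>b\<close> bounds the set covered by heavy pairs.\<close>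
  define t where "t = nat \<lceil>2 * real k / \<epsilon>\<rceil> + 1"
  define a where "a = 2 * r * (k + t)"
  define b where "b = 2 * t * k"
  obtain B n0 where h: "\<forall>(V :: 'a set) A X E m.
    finite V \<and> sym A \<and> irrefl A \<and> A \<subseteq> V \<times> V \<and> X \<subseteq> V \<and> card X \<le> b \<and>
    (\<forall>v\<in>V. \<forall>e\<in>E v. e \<subseteq> X \<and> 2 \<le> card e) \<and> good r V A E \<and>
    (\<forall>v\<in>V. real (card (V - A `` {v})) \<le> m) \<and>
    (2 * real r - 3) * m + \<epsilon> * real (card V) \<le> 2 * real (card V) \<and> n0 \<le> card V
    \<longrightarrow> (\<exists>V' A' \<phi>. card V' \<le> B \<and> good_image r V A X E V' A' \<phi>)"
    using bounded_good_image[OF r \<epsilon>, of b] by (elim exE)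
  define n1 where "n1 = nat \<lceil>18 * 3 ^ r * real a / \<epsilon>\<rceil> + nat \<lceil>12 * 3 ^ r * real (r * k) / \<epsilon>\<rceil> + n0 + 1"
  define N where "N = B + n1"
  show ?thesis
  proof (rule exI[of _ N], intro allI impI)
    fix V :: "'a set" and A :: "('a \<times> 'a) set" and m :: real
    assume "finite V \<and> sym A \<and> irrefl A \<and> A \<subseteq> V \<times> V \<and> \<not> clique_flower r k s V A \<and>
      (\<forall>v\<in>V. real (card (V - A `` {v})) \<le> m) \<and>
      (2 * real r - 3) * m + \<epsilon> * real (card V) \<le> 2 * real (card V)"
    then have V: "finite V" and A: "sym A" "irrefl A" "A \<subseteq> V \<times> V" and no: "\<not> clique_flower r k s V A"
      and miss: "\<forall>v\<in>V. real (card (V - A `` {v})) \<le> m"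
      and dense: "(2 * real r - 3) * m + \<epsilon> * real (card V) \<le> 2 * real (card V)"
      by simp_all
    show "\<exists>V' A' \<phi>. V' \<subseteq> V \<and> card V' \<le> N \<and> \<phi> ` V \<subseteq> V' \<and> (\<forall>(x, y)\<in>A. (\<phi> x, \<phi> y) \<in> A') \<and>
        sym A' \<and> irrefl A' \<and> A' \<subseteq> V' \<times> V' \<and> \<not> clique_flower r k s V' A'"
    proof (cases "n1 \<le> card V")
      case False
      then show ?thesis
        using A no by (intro exI[of _ V] exI[of _ A] exI[of _ id]) (auto simp: N_def)
    next
      case n1: True
      have big: "18 * 3 ^ r * real a < \<epsilon> * real (card V)" "12 * 3 ^ r * real (r * k) < \<epsilon> * real (card V)"
        "0 < card V" "n0 \<le> card V"
      proof -
        have "18 * 3 ^ r * real a / \<epsilon> < real (card V)" "12 * 3 ^ r * real (r * k) / \<epsilon> < real (card V)"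
          using n1 unfolding n1_def by linarith+
        then show "18 * 3 ^ r * real a < \<epsilon> * real (card V)" "12 * 3 ^ r * real (r * k) < \<epsilon> * real (card V)"
          using \<epsilon>(1) by (simp_all add: divide_less_eq mult.commute)
      qed (use n1 in \<open>simp_all add: n1_def\<close>)
      interpret dense_graph V A m r "\<epsilon> * real (card V)"
        by unfold_locales (use V A miss dense r \<epsilon>(1) big in auto)
      have image: "\<exists>V' A' \<phi>. card V' \<le> B \<and> good_image r V A X E V' A' \<phi>"
        if "X \<subseteq> V" "card X \<le> b" "\<forall>v\<in>V. \<forall>e\<in>E v. e \<subseteq> X \<and> 2 \<le> card e" "good r V A E" for X E
        by (rule h[rule_format, of V A X E m]) (use that V A miss dense big(4) in simp)
      have finish: ?thesis
        if X: "X \<subseteq> V" "card X \<le> b" "\<forall>v\<in>V. \<forall>e\<in>E v. e \<subseteq> X \<and> 2 \<le> card e" "good r V A E"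
          and free: "\<And>V' A'. V' \<subseteq> V \<Longrightarrow> good r V' A' E \<Longrightarrow> \<not> clique_flower r k s V' A'" for X E
      proof -
        obtain V' A' \<phi> where im: "card V' \<le> B" "good_image r V A X E V' A' \<phi>"
          using image[OF X] by (elim exE conjE)
        then have "V' \<subseteq> V" "\<phi> ` V = V'" "\<forall>(x, y)\<in>A. (\<phi> x, \<phi> y) \<in> A'" "sym A'" "irrefl A'"
          "A' \<subseteq> V' \<times> V'" "good r V' A' E"
          by (simp_all add: good_image_def)
        then show ?thesis
          using im(1) free[of V' A'] by (intro exI[of _ V'] exI[of _ A'] exI[of _ \<phi>]) (simp add: N_def)
      qed
      show ?thesis
      proof (cases "2 \<le> s")
        case True
        have noK: "\<not> (\<exists>K\<subseteq>V. is_clique A K \<and> card K = r)"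
          by (rule no_clique_if_no_flower[OF True s(2) no big(2)])
        show ?thesis
        proof (rule finish[of "{}" "\<lambda>_. {}"])
          show "good r V A (\<lambda>_. {})"
            using noK unfolding good_def by blast
          fix V' :: "'a set" and A' :: "('a \<times> 'a) set"
          assume g: "good r V' A' (\<lambda>_. {})"
          show "\<not> clique_flower r k s V' A'"
          proof
            assume "clique_flower r k s V' A'"
            then obtain L :: "nat \<Rightarrow> 'a set" where "\<forall>j\<in>{1..k}. L j \<subseteq> V' \<and> is_clique A' (L j) \<and> card (L j) = r"
              unfolding clique_flower_def by blast
            then have L: "L 1 \<subseteq> V'" "is_clique A' (L 1)" "card (L 1) = r"
              using k by auto
            moreover have "L 1 \<noteq> {}"
              using L(3) r by auto
            ultimately show False
              using g unfolding good_def by blast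
          qed
        qed auto
      next
        case False
        then have s1: "s = 1"
          using s by simp
        define E where "E = heavy_pairs a"
        define X where "X = \<Union>{e. card e = 2 \<and> heavy r V A a e}"
        have t: "2 * real k * real (card V) < real t * (\<epsilon> * real (card V))"
        proof -
          have "2 * real k / \<epsilon> < real t"
            unfolding t_def by linarith
          then have "2 * real k < real t * \<epsilon>"
            using \<epsilon>(1) by (simp add: divide_less_eq)
          then show ?thesis
            using big(3) by (simp add: mult.assoc[symmetric])
        qed
        show ?thesis
        proof (rule finish[of X E])
          show "X \<subseteq> V"
            unfolding X_def using heavy_subset(1)[OF _ V] by blast
          show "card X \<le> b"
            unfolding X_def b_def
            by (rule heavy_pairs_bounded[OF _ t]) (use no s1 in \<open>simp_all add: a_def\<close>)
          show "\<forall>v\<in>V. \<forall>e\<in>E v. e \<subseteq> X \<and> 2 \<le> card e"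
            by (auto simp: E_def heavy_pairs_def X_def)
          show "good r V A E"
            unfolding E_def by (rule good_heavy_pairs[OF big(1)])
          fix V' :: "'a set" and A' :: "('a \<times> 'a) set"
          assume V': "V' \<subseteq> V" and g: "good r V' A' E"
          show "\<not> clique_flower r k s V' A'"
          proof
            assume "clique_flower r k s V' A'"
            then obtain S L where S: "card S = 1"
              and L: "\<forall>j\<in>{1..k}. S \<subseteq> L j \<and> L j \<subseteq> V' \<and> is_clique A' (L j) \<and> card (L j) = r"
              and disj: "\<forall>i\<in>{1..k}. \<forall>j\<in>{1..k}. i \<noteq> j \<longrightarrow> L i \<inter> L j = S"
              unfolding clique_flower_def s1 by blast
            obtain p where p: "S = {p}"
              using S by (auto simp: card_1_singleton_iff)
            have "\<exists>e\<in>E p. e \<subseteq> L j" if "j \<in> {1..k}" for j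
            proof -
              have "L j \<subseteq> V'" "is_clique A' (L j) \<and> card (L j) = r" "p \<in> L j"
                using L that p by auto
              then show ?thesis
                using g unfolding good_def by simp
            qed
            then have "\<forall>j\<in>{1..k}. \<exists>e. e \<in> E p \<and> e \<subseteq> L j"
              by blast
            then obtain e where e: "\<forall>j\<in>{1..k}. e j \<in> E p \<and> e j \<subseteq> L j"
              by (rule bchoice[THEN exE])
            \<comment> \<open>The flower is carried back from the image to G. The sets
              \<open>insert p (e j)\<close> are heavy in G, whatever edges the image has gained, and
              the \<open>e j\<close> meet at most in \<open>p\<close> because the petals of the
              image do.\<close>
            have "clique_flower r k 1 V A"
            proof (rule heavy_star_flower[OF V])
              show "heavy r V A a (insert p (e j))" if "j \<in> {1..k}" for j
                using e that by (auto simp: E_def heavy_pairs_def)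
              show "e i \<inter> e j \<subseteq> {p}" if ij: "i \<in> {1..k}" "j \<in> {1..k}" "i \<noteq> j" for i j
              proof -
                have "e i \<inter> e j \<subseteq> L i \<inter> L j"
                  using e ij(1,2) by blast
                moreover have "L i \<inter> L j = {p}"
                  using disj[rule_format, OF ij] p by simp
                ultimately show ?thesis
                  by simp
              qed
              show "2 * r * k \<le> a"
                by (simp add: a_def)
            qed
            then show False
              using no s1 by simp
          qed
        qed
      qed
    qed
  qed
qed

section \<open>Copies of the graph T\<close>

lemma pair_graph_iff:
  "pair_graph G \<longleftrightarrow> finite (pverts G) \<and> parcs G \<subseteq> pverts G \<times> pverts G \<and> sym (parcs G) \<and> irrefl (parcs G)"
proof
  assume "pair_graph G"
  then interpret pair_graph G .
  have "irrefl (parcs G)"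
    by (rule irreflI) (use no_loops' in blast)
  then show "finite (pverts G) \<and> parcs G \<subseteq> pverts G \<times> pverts G \<and> sym (parcs G) \<and> irrefl (parcs G)"
    using pair_finite_verts in_arcsD1 in_arcsD2 pair_sym_arcs
    by (auto simp: symmetric_def)
next
  assume G: "finite (pverts G) \<and> parcs G \<subseteq> pverts G \<times> pverts G \<and> sym (parcs G) \<and> irrefl (parcs G)"
  then have "finite (parcs G)"
    by (meson finite_SigmaI finite_subset)
  then show "pair_graph G"
    using G by unfold_locales (auto simp: irrefl_def symmetric_def)
qed

lemma contains_copy_iff:
  assumes H: "pair_graph H" and G: "pair_graph G"
  shows "contains_copy H G \<longleftrightarrow>
    (\<exists>f. inj_on f (pverts H) \<and> f ` pverts H \<subseteq> pverts G \<and> (\<forall>(u, v)\<in>parcs H. (f u, f v) \<in> parcs G))"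
proof
  assume "contains_copy H G"
  then obtain H' :: "'b pair_pre_digraph" and iso where
    sub: "subgraph (with_proj H') (with_proj G)" and
    iso: "pre_digraph.digraph_isomorphism (with_proj H) iso" and eq: "with_proj H' = app_iso iso (with_proj H)"
    unfolding contains_copy_def digraph_iso_def by blast
  have H': "pverts H' = iso_verts iso ` pverts H" "parcs H' = iso_arcs iso ` parcs H"
    "fst = iso_tail iso" "snd = iso_head iso"
    using eq by (auto simp: with_proj_def app_iso_def)
  have sub': "pverts H' \<subseteq> pverts G" "parcs H' \<subseteq> parcs G"
    using sub by (simp_all add: subgraph_def)
  have inj: "inj_on (iso_verts iso) (pverts H)"
    and ends: "\<And>a. a \<in> parcs H \<Longrightarrow> iso_verts iso (fst a) = iso_tail iso (iso_arcs iso a) \<and>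
      iso_verts iso (snd a) = iso_head iso (iso_arcs iso a)"
    using iso by (simp_all add: pre_digraph.digraph_isomorphism_def)
  have arcs: "(iso_verts iso u, iso_verts iso v) \<in> parcs G" if uv: "(u, v) \<in> parcs H" for u v
  proof -
    have "(iso_verts iso u, iso_verts iso v) = iso_arcs iso (u, v)"
      using ends[OF uv] by (simp flip: H'(3,4))
    also have "\<dots> \<in> parcs H'"
      unfolding H'(2) using uv by (rule imageI)
    finally show ?thesis
      using sub'(2) by (rule subsetD[rotated])
  qed
  show "\<exists>f. inj_on f (pverts H) \<and> f ` pverts H \<subseteq> pverts G \<and> (\<forall>(u, v)\<in>parcs H. (f u, f v) \<in> parcs G)"
  proof (intro exI[of _ "iso_verts iso"] conjI)
    show "iso_verts iso ` pverts H \<subseteq> pverts G"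
      using sub'(1) unfolding H'(1) .
    show "\<forall>(u, v)\<in>parcs H. (iso_verts iso u, iso_verts iso v) \<in> parcs G"
      using arcs by auto
  qed (rule inj)
next
  assume "\<exists>f. inj_on f (pverts H) \<and> f ` pverts H \<subseteq> pverts G \<and> (\<forall>(u, v)\<in>parcs H. (f u, f v) \<in> parcs G)"
  then obtain f where f: "inj_on f (pverts H)" "f ` pverts H \<subseteq> pverts G"
    and hom: "\<forall>(u, v)\<in>parcs H. (f u, f v) \<in> parcs G"
    by (elim exE conjE)
  have f3: "(f u, f v) \<in> parcs G" if "(u, v) \<in> parcs H" for u v
    using hom that by auto
  define H' where "H' = \<lparr>pverts = f ` pverts H, parcs = map_prod f f ` parcs H\<rparr>"
  define iso where "iso = \<lparr>iso_verts = f, iso_arcs = map_prod f f, iso_head = snd, iso_tail = fst\<rparr>"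
  have HH: "finite (pverts H)" "parcs H \<subseteq> pverts H \<times> pverts H" "sym (parcs H)" "irrefl (parcs H)"
    using H by (auto simp: pair_graph_iff)
  have sub: "parcs H' \<subseteq> parcs G"
    using f3 by (auto simp: H'_def)
  have pg: "pair_graph H'"
    unfolding pair_graph_iff
  proof (intro conjI)
    show "finite (pverts H')" "parcs H' \<subseteq> pverts H' \<times> pverts H'"
      using HH(1,2) by (auto simp: H'_def)
    show "sym (parcs H')"
      using HH(3) by (fastforce simp: H'_def sym_def)
    show "irrefl (parcs H')"
      using sub G by (auto simp: pair_graph_iff irrefl_def)
  qed
  have wf: "wf_digraph (with_proj K)" if "pair_graph K" for K :: "'c pair_pre_digraph"
  proof -
    from that interpret pair_graph K .
    show ?thesis
      by unfold_locales
  qed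
  have "subgraph (with_proj H') (with_proj G)"
    unfolding subgraph_def using sub f(2) wf[OF pg] wf[OF G] by (auto simp: H'_def compatible_def)
  moreover have "pre_digraph.digraph_isomorphism (with_proj H) iso"
    unfolding pre_digraph.digraph_isomorphism_def
  proof (intro conjI)
    show "inj_on (iso_arcs iso) (arcs (with_proj H))"
      using inj_on_subset[OF map_prod_inj_on[OF f(1) f(1)] HH(2)] by (simp add: iso_def)
  qed (use wf[OF H] f(1) in \<open>auto simp: iso_def\<close>)
  moreover have "with_proj H' = app_iso iso (with_proj H)"
    by (simp add: with_proj_def app_iso_def iso_def H'_def)
  ultimately show "contains_copy H G"
    unfolding contains_copy_def digraph_iso_def using pg by blast
qed

lemma contains_T_graph_iff:
  assumes G: "pair_graph G" and k: "1 \<le> k" and s: "s \<le> r"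
  shows "contains_copy (T_graph r k s) G \<longleftrightarrow> clique_flower r k s (pverts G) (parcs G)"
  unfolding contains_copy_iff[OF pair_graph_T_graph G]
proof
  assume "\<exists>f. inj_on f (pverts (T_graph r k s)) \<and> f ` pverts (T_graph r k s) \<subseteq> pverts G \<and>
    (\<forall>(u, v)\<in>parcs (T_graph r k s). (f u, f v) \<in> parcs G)"
  then obtain f where f: "inj_on f (pverts (T_graph r k s))" "f ` pverts (T_graph r k s) \<subseteq> pverts G"
    and hom: "\<forall>(u, v)\<in>parcs (T_graph r k s). (f u, f v) \<in> parcs G"
    by (elim exE conjE)
  have f3: "(f u, f v) \<in> parcs G" if "(u, v) \<in> parcs (T_graph r k s)" for u v
    using hom that by auto
  have cv: "copy_vertex s j i \<in> pverts (T_graph r k s)" if "j \<in> {1..k}" "i < r" for j i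
    using that by (auto simp: T_graph_def)
  have arc: "(copy_vertex s j a, copy_vertex s j b) \<in> parcs (T_graph r k s)"
    if "j \<in> {1..k}" "a < r" "b < r" "a \<noteq> b" for j a b
    unfolding T_graph_def pair_pre_digraph.simps
    by (rule CollectI, rule exI[of _ j], rule exI[of _ a], rule exI[of _ b]) (use that in simp)
  have snd_cv: "snd (copy_vertex s j i) = i" for j i
    by (simp add: copy_vertex_def)
  define L where "L j = (\<lambda>i. f (copy_vertex s j i)) ` {..<r}" for j
  define S where "S = (\<lambda>i. f (copy_vertex s 1 i)) ` {..<s}"
  have inj: "f (copy_vertex s j a) = f (copy_vertex s l b) \<longleftrightarrow> copy_vertex s j a = copy_vertex s l b"
    if "j \<in> {1..k}" "l \<in> {1..k}" "a < r" "b < r" for j l a b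
    by (rule inj_on_eq_iff[OF f(1) cv[OF that(1,3)] cv[OF that(2,4)]])
  have inj1: "inj_on (\<lambda>i. f (copy_vertex s j i)) {..<r}" if "j \<in> {1..k}" for j
  proof (rule inj_onI)
    fix a b
    assume "a \<in> {..<r}" "b \<in> {..<r}" "f (copy_vertex s j a) = f (copy_vertex s j b)"
    then have "copy_vertex s j a = copy_vertex s j b"
      using inj that by simp
    then show "a = b"
      by (metis snd_cv)
  qed
  have SL: "S \<subseteq> L j" for j
  proof
    fix x
    assume "x \<in> S"
    then obtain i where i: "i < s" "x = f (copy_vertex s 1 i)"
      by (auto simp: S_def)
    then have "x = f (copy_vertex s j i)"
      by (simp add: copy_vertex_def)
    then show "x \<in> L j"
      using i(1) s by (auto simp: L_def)
  qed
  have k1: "1 \<in> {1..k}"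
    using k by simp
  show "clique_flower r k s (pverts G) (parcs G)"
    unfolding clique_flower_def
  proof (intro exI[of _ S] exI[of _ L] conjI ballI impI)
    have "inj_on (\<lambda>i. f (copy_vertex s 1 i)) {..<s}"
      using s by (intro inj_on_subset[OF inj1[OF k1]]) auto
    then show "card S = s"
      by (simp add: S_def card_image)
    fix j
    assume j: "j \<in> {1..k}"
    show "S \<subseteq> L j"
      by (rule SL)
    show "L j \<subseteq> pverts G"
      using f(2) cv[OF j] by (auto simp: L_def)
    show "is_clique (parcs G) (L j)"
      unfolding is_clique_def
    proof (intro ballI impI)
      fix x y
      assume "x \<in> L j" "y \<in> L j" "x \<noteq> y"
      then obtain a b where "a < r" "b < r" "a \<noteq> b" "x = f (copy_vertex s j a)" "y = f (copy_vertex s j b)"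
        by (auto simp: L_def)
      then show "(x, y) \<in> parcs G"
        using f3[OF arc[OF j]] by simp
    qed
    show "card (L j) = r"
      using inj1[OF j] by (simp add: L_def card_image)
    fix i
    assume i: "i \<in> {1..k}" and "i \<noteq> j"
    show "L i \<inter> L j = S"
    proof
      show "L i \<inter> L j \<subseteq> S"
      proof
        fix x
        assume "x \<in> L i \<inter> L j"
        then obtain a b where ab: "a < r" "b < r" "x = f (copy_vertex s i a)" "x = f (copy_vertex s j b)"
          by (auto simp: L_def)
        then have "copy_vertex s i a = copy_vertex s j b"
          using inj[OF i j ab(1,2)] by simp
        then have "a < s"
          using \<open>i \<noteq> j\<close> by (auto simp: copy_vertex_def split: if_splits)
        then show "x \<in> S"
          using ab(3) by (auto simp: S_def copy_vertex_def)
      qed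
      show "S \<subseteq> L i \<inter> L j"
        using SL by simp
    qed
  qed
next
  assume "clique_flower r k s (pverts G) (parcs G)"
  then obtain S L where S: "card S = s"
    and L0: "\<forall>j\<in>{1..k}. S \<subseteq> L j \<and> L j \<subseteq> pverts G \<and> is_clique (parcs G) (L j) \<and> card (L j) = r"
      "\<forall>i\<in>{1..k}. \<forall>j\<in>{1..k}. i \<noteq> j \<longrightarrow> L i \<inter> L j = S"
    unfolding clique_flower_def by (elim exE conjE)
  note L = L0(1)[rule_format] and disj = L0(2)[rule_format]
  have finG: "finite (pverts G)"
    using G by (simp add: pair_graph_iff)
  have fL: "finite (L j)" if "j \<in> {1..k}" for j
    using L[OF that] finG by (auto intro: finite_subset)
  have k1: "1 \<in> {1..k}"
    using k by simp
  have fS: "finite S"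
    using fL[OF k1] L[OF k1] by (auto intro: finite_subset)
  obtain g where g: "bij_betw g {..<s} S"
    using fS S by (metis card_lessThan finite_lessThan finite_same_card_bij)
  have "\<exists>h. bij_betw h {s..<r} (L j - S)" if j: "j \<in> {1..k}" for j
  proof -
    have "card (L j - S) = r - s"
      using L[OF j] fS S by (simp add: card_Diff_subset)
    then show ?thesis
      using fL[OF j] by (intro finite_same_card_bij) auto
  qed
  then obtain h where h: "\<And>j. j \<in> {1..k} \<Longrightarrow> bij_betw (h j) {s..<r} (L j - S)"
    by metis
  define f where "f = (\<lambda>(j, i). if i < s then g i else h j i)"
  have f_cv: "f (copy_vertex s j i) = (if i < s then g i else h j i)" for j i
    by (simp add: f_def copy_vertex_def)
  have gS: "g i \<in> S" if "i < s" for i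
    using bij_betwE[OF g] that by simp
  have hL: "h j i \<in> L j - S" if "j \<in> {1..k}" "\<not> i < s" "i < r" for j i
    using bij_betwE[OF h[OF that(1)]] that by simp
  have fL': "f (copy_vertex s j i) \<in> L j" if "j \<in> {1..k}" "i < r" for j i
    using gS hL[OF that(1) _ that(2)] L[OF that(1)] by (auto simp: f_cv)
  have eq: "copy_vertex s j a = copy_vertex s l b"
    if "j \<in> {1..k}" "l \<in> {1..k}" "a < r" "b < r" "f (copy_vertex s j a) = f (copy_vertex s l b)" for j l a b
  proof -
    consider "a < s" "b < s" | "a < s" "\<not> b < s" | "\<not> a < s" "b < s" | "\<not> a < s" "\<not> b < s"
      by blast
    then show ?thesis
    proof cases
      case 1
      then have "a = b"
        using that(5) g by (auto simp: f_cv bij_betw_def dest: inj_onD)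
      then show ?thesis
        using 1 by (simp add: copy_vertex_def)
    next
      case 2
      then show ?thesis
        using that(5) gS[of a] hL[OF that(2) _ that(4)] by (auto simp: f_cv)
    next
      case 3
      then show ?thesis
        using that(5) gS[of b] hL[OF that(1) _ that(3)] by (auto simp: f_cv)
    next
      case 4
      then have e: "h j a = h l b" and ha: "h j a \<in> L j - S" and hb: "h l b \<in> L l - S"
        using that(5) hL[OF that(1) _ that(3)] hL[OF that(2) _ that(4)] by (auto simp: f_cv)
      have "j = l"
      proof (rule ccontr)
        assume "j \<noteq> l"
        then have "L j \<inter> L l = S"
          using disj that by simp
        then show False
          using e ha hb by auto
      qed
      moreover have "a = b"
        using e 4 h[OF that(1)] that(3,4) \<open>j = l\<close> by (auto simp: bij_betw_def dest: inj_onD)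
      ultimately show ?thesis
        by simp
    qed
  qed
  show "\<exists>f. inj_on f (pverts (T_graph r k s)) \<and> f ` pverts (T_graph r k s) \<subseteq> pverts G \<and>
    (\<forall>(u, v)\<in>parcs (T_graph r k s). (f u, f v) \<in> parcs G)"
  proof (intro exI[of _ f] conjI)
    show "inj_on f (pverts (T_graph r k s))"
    proof (rule inj_onI)
      fix x y
      assume xy: "x \<in> pverts (T_graph r k s)" "y \<in> pverts (T_graph r k s)" "f x = f y"
      obtain j a where x: "x = copy_vertex s j a" "j \<in> {1..k}" "a < r"
        using xy(1) unfolding T_graph_def by auto
      obtain l b where y: "y = copy_vertex s l b" "l \<in> {1..k}" "b < r"
        using xy(2) unfolding T_graph_def by auto
      show "x = y"
        using eq[OF x(2) y(2) x(3) y(3)] xy(3) x(1) y(1) by simp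
    qed
    show "f ` pverts (T_graph r k s) \<subseteq> pverts G"
    proof
      fix x
      assume "x \<in> f ` pverts (T_graph r k s)"
      then obtain j i where "j \<in> {1..k}" "i < r" "x = f (copy_vertex s j i)"
        by (auto simp: T_graph_def)
      then show "x \<in> pverts G"
        using fL' L by blast
    qed
    show "\<forall>(u, v)\<in>parcs (T_graph r k s). (f u, f v) \<in> parcs G"
    proof (rule ballI)
      fix z
      assume "z \<in> parcs (T_graph r k s)"
      then obtain j a b where jab: "j \<in> {1..k}" "a < r" "b < r" "a \<noteq> b"
        "z = (copy_vertex s j a, copy_vertex s j b)"
        unfolding T_graph_def by auto
      have "copy_vertex s j a \<noteq> copy_vertex s j b"
        using jab(4) by (simp add: copy_vertex_def)
      then have "f (copy_vertex s j a) \<noteq> f (copy_vertex s j b)"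
        using eq[OF jab(1,1,2,3)] by blast
      then have "(f (copy_vertex s j a), f (copy_vertex s j b)) \<in> parcs G"
        using L[OF jab(1)] fL'[OF jab(1) jab(2)] fL'[OF jab(1) jab(3)] by (simp add: is_clique_def)
      then show "case z of (u, v) \<Rightarrow> (f u, f v) \<in> parcs G"
        using jab(5) by simp
    qed
  qed
qed

lemma clique_flower_inj_hom:
  assumes flower: "clique_flower r k s V A" and k: "1 \<le> k" and g: "inj_on g V" "g ` V \<subseteq> V'"
    and hom: "\<And>x y. (x, y) \<in> A \<Longrightarrow> x \<in> V \<Longrightarrow> y \<in> V \<Longrightarrow> (g x, g y) \<in> A'"
  shows "clique_flower r k s V' A'"
proof -
  obtain S L where S: "card S = s"
    and L0: "\<forall>j\<in>{1..k}. S \<subseteq> L j \<and> L j \<subseteq> V \<and> is_clique A (L j) \<and> card (L j) = r"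
      "\<forall>i\<in>{1..k}. \<forall>j\<in>{1..k}. i \<noteq> j \<longrightarrow> L i \<inter> L j = S"
    using flower unfolding clique_flower_def by (elim exE conjE)
  note L = L0(1)[rule_format] and disj = L0(2)[rule_format]
  have LV: "L j \<subseteq> V" if "j \<in> {1..k}" for j
    using L[OF that] by simp
  have "S \<subseteq> L 1"
    using L[of 1] k by simp
  then have "inj_on g S"
    using LV[of 1] k by (intro inj_on_subset[OF g(1)]) auto
  show ?thesis
    unfolding clique_flower_def
  proof (intro exI[of _ "g ` S"] exI[of _ "\<lambda>j. g ` L j"] conjI ballI impI)
    show "card (g ` S) = s"
      using S \<open>inj_on g S\<close> by (simp add: card_image)
    fix j
    assume j: "j \<in> {1..k}"
    show "g ` S \<subseteq> g ` L j"
      using L[OF j] by auto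
    show "g ` L j \<subseteq> V'"
      using image_mono[OF LV[OF j], of g] g(2) by (rule order_trans)
    show "is_clique A' (g ` L j)"
      unfolding is_clique_def
    proof (intro ballI impI)
      fix x y
      assume "x \<in> g ` L j" "y \<in> g ` L j" "x \<noteq> y"
      then obtain a b where ab: "a \<in> L j" "b \<in> L j" "a \<noteq> b" "x = g a" "y = g b"
        by auto
      then have "(a, b) \<in> A"
        using L[OF j] by (simp add: is_clique_def)
      then show "(x, y) \<in> A'"
        using ab LV[OF j] by (auto intro: hom)
    qed
    show "card (g ` L j) = r"
      using L[OF j] inj_on_subset[OF g(1) LV[OF j]] by (simp add: card_image)
    fix i
    assume i: "i \<in> {1..k}" and ij: "i \<noteq> j"
    show "g ` L i \<inter> g ` L j = g ` S"
      using inj_on_image_Int[OF g(1) LV[OF i] LV[OF j]] disj[OF i j ij] by simp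
  qed
qed

section \<open>A common target for all small flower-free graphs\<close>

lemma finite_graphs_below: "finite {H :: nat pair_pre_digraph. pverts H \<subseteq> {..<N} \<and> parcs H \<subseteq> pverts H \<times> pverts H}"
proof (rule finite_subset)
  show "{H :: nat pair_pre_digraph. pverts H \<subseteq> {..<N} \<and> parcs H \<subseteq> pverts H \<times> pverts H}
    \<subseteq> (\<lambda>(V, A). \<lparr>pverts = V, parcs = A\<rparr>) ` (Pow {..<N} \<times> Pow ({..<N} \<times> {..<N}))"
  proof
    fix H :: "nat pair_pre_digraph"
    assume "H \<in> {H. pverts H \<subseteq> {..<N} \<and> parcs H \<subseteq> pverts H \<times> pverts H}"
    then show "H \<in> (\<lambda>(V, A). \<lparr>pverts = V, parcs = A\<rparr>) ` (Pow {..<N} \<times> Pow ({..<N} \<times> {..<N}))"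
      by (intro image_eqI[of _ _ "(pverts H, parcs H)"]) auto
  qed
qed auto

text \<open>The target is the disjoint union of the finitely many flower-free graphs on subsets of
  \<open>{..<N}\<close>. Because \<open>s\<close> is positive, all petals share a vertex, so a
  flower lies in one component.\<close>

lemma flower_free_universal:
  assumes k: "1 \<le> k" and s: "1 \<le> s"
  shows "\<exists>F :: nat pair_pre_digraph. pair_graph F \<and> \<not> clique_flower r k s (pverts F) (parcs F) \<and>
    (\<forall>H :: nat pair_pre_digraph. pair_graph H \<and> \<not> clique_flower r k s (pverts H) (parcs H) \<and> pverts H \<subseteq> {..<N}
       \<longrightarrow> homomorphic_to H F)"
proof -
  define HH where "HH = {H :: nat pair_pre_digraph. pair_graph H \<and>
    \<not> clique_flower r k s (pverts H) (parcs H) \<and> pverts H \<subseteq> {..<N}}"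
  have fin: "finite HH"
    by (rule finite_subset[OF _ finite_graphs_below[of N]]) (auto simp: HH_def pair_graph_iff)
  obtain idx :: "nat pair_pre_digraph \<Rightarrow> nat" where idx: "inj_on idx HH"
    using finite_imp_inj_to_nat_seg[OF fin] by (elim exE conjE)
  define c where "c H v = prod_encode (idx H, v)" for H v
  have c_eq: "c H u = c H' v \<longleftrightarrow> H = H' \<and> u = v" if "H \<in> HH" "H' \<in> HH" for H H' u v
    using idx that by (auto simp: c_def dest: inj_onD)
  define VF where "VF = (\<Union>H\<in>HH. c H ` pverts H)"
  define AF where "AF = (\<Union>H\<in>HH. map_prod (c H) (c H) ` parcs H)"
  define F where "F = \<lparr>pverts = VF, parcs = AF\<rparr>"
  have H: "finite (pverts H)" "parcs H \<subseteq> pverts H \<times> pverts H" "sym (parcs H)" "irrefl (parcs H)"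
    "\<not> clique_flower r k s (pverts H) (parcs H)" if "H \<in> HH" for H
    using that by (auto simp: HH_def pair_graph_iff)
  have AF_iff: "(c H u, y) \<in> AF \<longleftrightarrow> (\<exists>v. y = c H v \<and> (u, v) \<in> parcs H)" if "H \<in> HH" for H u y
  proof
    assume "(c H u, y) \<in> AF"
    then obtain H' a b where ab: "H' \<in> HH" "(a, b) \<in> parcs H'" "c H u = c H' a" "y = c H' b"
      by (auto simp: AF_def)
    then have "H = H'" "u = a"
      using c_eq[OF that ab(1)] by auto
    then show "\<exists>v. y = c H v \<and> (u, v) \<in> parcs H"
      using ab(2,4) by auto
  next
    assume "\<exists>v. y = c H v \<and> (u, v) \<in> parcs H"
    then obtain v where v: "y = c H v" "(u, v) \<in> parcs H"
      by blast
    show "(c H u, y) \<in> AF"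
      unfolding AF_def by (rule UN_I[OF that], rule image_eqI[OF _ v(2)]) (simp add: v(1))
  qed
  have "pair_graph F"
    unfolding pair_graph_iff
  proof (intro conjI)
    show "finite (pverts F)"
      using fin H(1) by (auto simp: F_def VF_def)
    show "parcs F \<subseteq> pverts F \<times> pverts F"
      using H(2) by (fastforce simp: F_def VF_def AF_def)
    show "sym (parcs F)"
    proof (rule symI)
      fix x y
      assume "(x, y) \<in> parcs F"
      then obtain H u v where huv: "H \<in> HH" "(u, v) \<in> parcs H" "x = c H u" "y = c H v"
        by (auto simp: F_def AF_def)
      then have "(v, u) \<in> parcs H"
        using H(3) by (auto dest: symD)
      then show "(y, x) \<in> parcs F"
        using huv AF_iff by (auto simp: F_def)
    qed
    show "irrefl (parcs F)"
    proof (rule irreflI, rule notI)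
      fix x
      assume "(x, x) \<in> parcs F"
      then obtain H u v where "H \<in> HH" "(u, v) \<in> parcs H" "x = c H u" "x = c H v"
        by (auto simp: F_def AF_def)
      then show False
        using H(4) c_eq by (auto simp: irrefl_def)
    qed
  qed
  moreover have "\<not> clique_flower r k s (pverts F) (parcs F)"
  proof
    assume "clique_flower r k s (pverts F) (parcs F)"
    then have "clique_flower r k s VF AF"
      by (simp add: F_def)
    then obtain S L where S: "card S = s"
      and L0: "\<forall>j\<in>{1..k}. S \<subseteq> L j \<and> L j \<subseteq> VF \<and> is_clique AF (L j) \<and> card (L j) = r"
        "\<forall>i\<in>{1..k}. \<forall>j\<in>{1..k}. i \<noteq> j \<longrightarrow> L i \<inter> L j = S"
      unfolding clique_flower_def by (elim exE conjE)
    note L = L0(1)[rule_format] and disj = L0(2)[rule_format]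
    have k1: "1 \<in> {1..k}"
      using k by simp
    have "S \<noteq> {}"
      using S s by auto
    then obtain p where p: "p \<in> S"
      by blast
    then have "p \<in> VF"
      using L[OF k1] by blast
    then obtain H0 v0 where H0: "H0 \<in> HH" "v0 \<in> pverts H0" "p = c H0 v0"
      by (auto simp: VF_def)
    have Lc: "L j \<subseteq> c H0 ` pverts H0" if j: "j \<in> {1..k}" for j
    proof
      fix x
      assume x: "x \<in> L j"
      show "x \<in> c H0 ` pverts H0"
      proof (cases "x = p")
        case False
        then have "(c H0 v0, x) \<in> AF"
          using L[OF j] p x H0(3) by (auto simp: is_clique_def)
        then show ?thesis
          using AF_iff[OF H0(1)] H(2)[OF H0(1)] by auto
      qed (use H0 in auto)
    qed
    define g where "g = the_inv_into UNIV (c H0)"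
    have inj: "inj (c H0)"
      using c_eq[OF H0(1) H0(1)] by (auto simp: inj_on_def)
    have gc: "g (c H0 v) = v" for v
      unfolding g_def using the_inv_into_f_f[OF inj] by simp
    have inj_g: "inj_on g (c H0 ` pverts H0)"
      by (auto simp: inj_on_def gc)
    have "clique_flower r k s (c H0 ` pverts H0) AF"
      unfolding clique_flower_def using S L0 Lc by (intro exI[of _ S] exI[of _ L]) simp
    then have "clique_flower r k s (pverts H0) (parcs H0)"
    proof (rule clique_flower_inj_hom[OF _ k inj_g])
      show "g ` c H0 ` pverts H0 \<subseteq> pverts H0"
        by (auto simp: gc)
      fix x y
      assume "(x, y) \<in> AF" "x \<in> c H0 ` pverts H0"
      then obtain u where u: "x = c H0 u" "(c H0 u, y) \<in> AF"
        by auto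
      then obtain v where "y = c H0 v" "(u, v) \<in> parcs H0"
        using AF_iff[OF H0(1)] by auto
      then show "(g x, g y) \<in> parcs H0"
        using u(1) by (simp add: gc)
    qed
    then show False
      using H(5)[OF H0(1)] by simp
  qed
  moreover have "homomorphic_to H0 F" if "H0 \<in> HH" for H0
    unfolding homomorphic_to_def graph_hom_def
    using that AF_iff[OF that] by (intro exI[of _ "c H0"]) (auto simp: F_def VF_def)
  ultimately show ?thesis
    by (intro exI[of _ F]) (simp add: HH_def)
qed

section \<open>A dense graph of large chromatic number\<close>

lemma card_odd_below: "card {i::nat. i < 2 * l + 1 \<and> odd i} = l"
proof (induction l)
  case 0
  have "{i::nat. i < 2 * 0 + 1 \<and> odd i} = {}"
    by (auto intro!: gr0I)
  then show ?case
    by simp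
next
  case (Suc l)
  have "{i::nat. i < 2 * Suc l + 1 \<and> odd i} = insert (2 * l + 1) {i. i < 2 * l + 1 \<and> odd i}"
    by (auto simp: less_Suc_eq)
  then show ?case
    using Suc by simp
qed

lemma card_odd_rank:
  fixes S :: "nat set"
  assumes "finite S" "card S = 2 * l + 1"
  shows "card {x \<in> S. odd (card {y \<in> S. x < y})} = l"
proof -
  define rk where "rk x = card {y \<in> S. x < y}" for x
  have less: "rk y < rk x" if "x \<in> S" "y \<in> S" "x < y" for x y
    unfolding rk_def using assms(1) that by (intro psubset_card_mono) auto
  have inj: "inj_on rk S"
  proof (rule inj_onI)
    fix x y
    assume "x \<in> S" "y \<in> S" "rk x = rk y"
    then show "x = y"
      using less[of x y] less[of y x] by (cases x y rule: linorder_cases) auto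
  qed
  have "rk ` S \<subseteq> {..<2 * l + 1}"
  proof
    fix i
    assume "i \<in> rk ` S"
    then obtain x where x: "x \<in> S" "i = rk x"
      by blast
    have "rk x < card S"
      unfolding rk_def using assms(1) x(1) by (intro psubset_card_mono) auto
    then show "i \<in> {..<2 * l + 1}"
      using x(2) assms(2) by simp
  qed
  then have im: "rk ` S = {..<2 * l + 1}"
    using card_image[OF inj] assms(2) by (intro card_subset_eq) auto
  have "rk ` {x \<in> S. odd (rk x)} = {i. i < 2 * l + 1 \<and> odd i}"
    using im by auto
  moreover have "card (rk ` {x \<in> S. odd (rk x)}) = card {x \<in> S. odd (rk x)}"
    by (rule card_image[OF inj_on_subset[OF inj]]) auto
  ultimately show ?thesis
    using card_odd_below[of l] by (simp add: rk_def)
qed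

text \<open>Takes the place of the sets defining a Kneser graph: subsets of a common ground set,
  here the permutations, with density \<open>l / (2 * l + 1)\<close>, just below one half, when
  \<open>card S = 2 * l + 1\<close>. Adjacency will be disjointness.\<close>

definition odd_argmax :: "nat \<Rightarrow> nat set \<Rightarrow> (nat \<Rightarrow> nat) set" where
  "odd_argmax N S =
     {\<pi>. \<pi> permutes {..<N} \<and> (\<exists>x\<in>S. (\<forall>y\<in>S. \<pi> y \<le> \<pi> x) \<and> odd (card {y \<in> S. x < y}))}"

text \<open>Composing with a transposition shows that \<open>\<pi>\<close> is maximal equally often
  at each element of \<open>S\<close>. Exactly \<open>l\<close> of the \<open>2 * l + 1\<close>
  elements have an odd number of elements of \<open>S\<close> above them.\<close>

lemma card_odd_argmax:
  assumes S: "S \<subseteq> {..<N}" "card S = 2 * l + 1"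
  shows "(2 * l + 1) * card (odd_argmax N S) = l * fact N"
proof -
  define Om where "Om = {\<pi>. \<pi> permutes {..<N}}"
  define P where "P x = {\<pi> \<in> Om. \<forall>y\<in>S. \<pi> y \<le> \<pi> x}" for x
  have fS: "finite S"
    using S(1) by (rule finite_subset) simp
  have fOm: "finite Om"
    unfolding Om_def by (rule finite_permutations) simp
  have fP: "finite (P x)" for x
    using fOm by (simp add: P_def)
  have le: "card (P x) \<le> card (P z)" if x: "x \<in> S" and z: "z \<in> S" for x z
  proof (rule card_inj_on_le[OF _ _ fP])
    show "inj_on (\<lambda>\<pi>. \<pi> \<circ> transpose x z) (P x)"
    proof (rule inj_onI)
      fix \<pi> \<rho>
      assume "\<pi> \<circ> transpose x z = \<rho> \<circ> transpose x z"
      then have "\<pi> \<circ> transpose x z \<circ> transpose x z = \<rho> \<circ> transpose x z \<circ> transpose x z"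
        by simp
      then show "\<pi> = \<rho>"
        by (simp add: comp_assoc)
    qed
    show "(\<lambda>\<pi>. \<pi> \<circ> transpose x z) ` P x \<subseteq> P z"
    proof
      fix \<rho>
      assume "\<rho> \<in> (\<lambda>\<pi>. \<pi> \<circ> transpose x z) ` P x"
      then obtain \<pi> where \<pi>: "\<pi> permutes {..<N}" "\<forall>y\<in>S. \<pi> y \<le> \<pi> x" "\<rho> = \<pi> \<circ> transpose x z"
        by (auto simp: P_def Om_def)
      have "transpose x z permutes {..<N}"
        using x z S(1) by (intro permutes_swap_id) auto
      then have "\<rho> permutes {..<N}"
        unfolding \<pi>(3) using \<pi>(1) by (rule permutes_compose)
      moreover have "\<rho> y \<le> \<rho> z" if "y \<in> S" for y
      proof -
        have "transpose x z y \<in> S"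
          using that x z by (auto simp: transpose_def)
        then show ?thesis
          using \<pi>(2,3) by simp
      qed
      ultimately show "\<rho> \<in> P z"
        by (simp add: P_def Om_def)
    qed
  qed
  have eq: "x = z" if "x \<in> S" "z \<in> S" "\<pi> \<in> P x" "\<pi> \<in> P z" for x z \<pi>
  proof -
    have "\<pi> x = \<pi> z" and "\<pi> permutes {..<N}"
      using that by (auto simp: P_def Om_def intro: antisym)
    then show ?thesis
      by (meson injD permutes_inj)
  qed
  have "S \<noteq> {}"
    using S(2) by auto
  then obtain x0 where x0: "x0 \<in> S"
    by blast
  define p where "p = card (P x0)"
  have p: "card (P x) = p" if "x \<in> S" for x
    using le[OF that x0] le[OF x0 that] by (simp add: p_def)
  have cardU: "card (\<Union>x\<in>S'. P x) = card S' * p" if "S' \<subseteq> S" for S'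
  proof -
    have "card (\<Union>x\<in>S'. P x) = (\<Sum>x\<in>S'. card (P x))"
    proof (rule card_UN_disjoint)
      show "finite S'"
        using that fS by (rule finite_subset)
      show "\<forall>i\<in>S'. finite (P i)"
        using fP by simp
      show "\<forall>i\<in>S'. \<forall>j\<in>S'. i \<noteq> j \<longrightarrow> P i \<inter> P j = {}"
      proof (intro ballI impI)
        fix i j
        assume "i \<in> S'" "j \<in> S'" "i \<noteq> j"
        then have "\<pi> \<notin> P i \<inter> P j" for \<pi>
          using eq[of i j \<pi>] that by auto
        then show "P i \<inter> P j = {}"
          by blast
      qed
    qed
    also have "\<dots> = (\<Sum>x\<in>S'. p)"
      using that p by (intro sum.cong) auto
    finally show ?thesis by simp
  qed
  have "Om \<subseteq> (\<Union>x\<in>S. P x)"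
  proof
    fix \<pi>
    assume \<pi>: "\<pi> \<in> Om"
    have "Max (\<pi> ` S) \<in> \<pi> ` S"
      using fS x0 by (intro Max_in) auto
    then obtain x where "x \<in> S" "\<pi> x = Max (\<pi> ` S)"
      by auto
    then have "\<pi> \<in> P x"
      using \<pi> fS by (auto simp: P_def)
    then show "\<pi> \<in> (\<Union>x\<in>S. P x)"
      using \<open>x \<in> S\<close> by blast
  qed
  then have "Om = (\<Union>x\<in>S. P x)"
    by (auto simp: P_def)
  moreover have "card Om = fact N"
    unfolding Om_def by (rule card_permutations) auto
  ultimately have "fact N = (2 * l + 1) * p"
    using cardU[of S] S(2) by simp
  moreover have "odd_argmax N S = (\<Union>x\<in>{x \<in> S. odd (card {y \<in> S. x < y})}. P x)"
    by (auto simp: odd_argmax_def P_def Om_def)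
  then have "card (odd_argmax N S) = l * p"
    using cardU[of "{x \<in> S. odd (card {y \<in> S. x < y})}"] card_odd_rank[OF fS S(2)] by simp
  ultimately show ?thesis
    by (simp add: algebra_simps)
qed

text \<open>Both sets look at the position, counted from the top, of the vertex where \<open>\<pi>\<close> is maximal. Passing from
  \<open>H - {Max H}\<close> to \<open>H - {Min H}\<close> increases this position by one and hence changes its parity.\<close>

lemma odd_argmax_shift_disjoint:
  fixes H :: "nat set"
  assumes H: "finite H" "card H = 2 * l + 2"
  shows "odd_argmax N (H - {Max H}) \<inter> odd_argmax N (H - {Min H}) = {}"
proof (rule ccontr)
  assume "\<not> ?thesis"
  then obtain \<pi> where \<pi>: "\<pi> \<in> odd_argmax N (H - {Max H})" "\<pi> \<in> odd_argmax N (H - {Min H})"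
    by blast
  define a where "a = Max H"
  define b where "b = Min H"
  have ne: "H \<noteq> {}"
    using H by auto
  have ab: "a \<in> H" "b \<in> H" "\<And>y. y \<in> H \<Longrightarrow> y \<le> a" "\<And>y. y \<in> H \<Longrightarrow> b \<le> y"
    using H(1) ne by (auto simp: a_def b_def)
  have "a \<noteq> b"
  proof
    assume "a = b"
    then have "H \<subseteq> {a}"
      using ab(3,4) by (auto intro: antisym)
    then have "card H \<le> card {a}"
      by (intro card_mono) auto
    then show False
      using H(2) by simp
  qed
  obtain x where x: "x \<in> H" "x \<noteq> a" "\<And>y. y \<in> H - {a} \<Longrightarrow> \<pi> y \<le> \<pi> x" "odd (card {y \<in> H - {a}. x < y})"
    using \<pi>(1) by (auto simp: odd_argmax_def a_def)
  obtain z where z: "z \<in> H" "z \<noteq> b" "\<And>y. y \<in> H - {b} \<Longrightarrow> \<pi> y \<le> \<pi> z" "odd (card {y \<in> H - {b}. z < y})"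
    using \<pi>(2) by (auto simp: odd_argmax_def b_def)
  have "z \<noteq> a"
  proof
    assume "z = a"
    then have "{y \<in> H - {b}. z < y} = {}"
      using ab(3) by fastforce
    then have "even (card {y \<in> H - {b}. z < y})"
      by (simp only: card.empty even_zero)
    with z(4) show False
      by (rule notE)
  qed
  moreover have xb: "x \<noteq> b"
  proof
    assume "x = b"
    then have "{y \<in> H - {a}. x < y} = H - {a, b}"
      using ab(4) by (auto simp: order.strict_iff_order)
    moreover have "card (H - {a, b}) = 2 * l"
      using H ab(1,2) \<open>a \<noteq> b\<close> by (simp add: card_Diff_subset)
    ultimately have "even (card {y \<in> H - {a}. x < y})"
      by simp
    with x(4) show False
      by (rule notE)
  qed
  ultimately have "\<pi> x = \<pi> z"
    using x z by (intro antisym) auto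
  moreover have "inj \<pi>"
    using \<pi>(1) by (auto simp: odd_argmax_def intro: permutes_inj)
  ultimately have xz: "x = z"
    by (simp add: inj_eq)
  have "b < x" "x < a"
    using ab(3,4)[OF x(1)] x(2) xb by simp_all
  then have "{y \<in> H - {b}. x < y} = insert a {y \<in> H - {a}. x < y}"
    using ab(1) by auto
  moreover have "finite {y \<in> H - {a}. x < y}"
    using H(1) by simp
  ultimately have "card {y \<in> H - {b}. x < y} = Suc (card {y \<in> H - {a}. x < y})"
    by simp
  moreover have "odd (card {y \<in> H - {b}. x < y})"
    unfolding xz by (rule z(4))
  ultimately show False
    using x(4) by (metis even_Suc)
qed

section \<open>Hajnal's graph over sets of permutations\<close>

datatype vertex = Sub "nat set" | Perm "nat \<Rightarrow> nat" nat | Aux nat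

text \<open>The vertices \<open>Sub S\<close> carry the chromatic number but are few. Copies of the
  permutations give them their degree, the second argument of \<open>Perm\<close> being just a copy
  index, and the vertices \<open>Aux j\<close> give the permutations theirs.\<close>

fun hajnal_adj :: "nat \<Rightarrow> vertex \<Rightarrow> vertex \<Rightarrow> bool" where
  "hajnal_adj N (Sub S) (Sub S') \<longleftrightarrow> odd_argmax N S \<inter> odd_argmax N S' = {}"
| "hajnal_adj N (Sub S) (Perm \<pi> i) \<longleftrightarrow> \<pi> \<in> odd_argmax N S"
| "hajnal_adj N (Perm \<pi> i) (Sub S) \<longleftrightarrow> \<pi> \<in> odd_argmax N S"
| "hajnal_adj N (Perm \<pi> i) (Aux j) \<longleftrightarrow> True"
| "hajnal_adj N (Aux j) (Perm \<pi> i) \<longleftrightarrow> True"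
| "hajnal_adj N _ _ \<longleftrightarrow> False"

lemma hajnal_adj_sym: "hajnal_adj N u v \<longleftrightarrow> hajnal_adj N v u"
  by (cases u; cases v) (auto simp: Int_commute)

text \<open>Three pairwise disjoint sets of density \<open>l / (2 * l + 1)\<close> do not fit, since
  \<open>3 * l > 2 * l + 1\<close> for \<open>l \<ge> 2\<close>. A permutation adjacent to two
  vertices \<open>Sub S\<close> lies in both sets, so these are not disjoint. The remaining types
  contain two vertices of an independent part or a pair of \<open>Sub\<close> and
  \<open>Aux\<close>.\<close>

lemma hajnal_adj_no_triangle:
  assumes l: "2 \<le> l" and S: "\<And>S. Sub S \<in> {u, v, w} \<Longrightarrow> S \<subseteq> {..<N} \<and> card S = 2 * l + 1"
  shows "\<not> (hajnal_adj N u v \<and> hajnal_adj N v w \<and> hajnal_adj N u w)"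
proof
  assume adj: "hajnal_adj N u v \<and> hajnal_adj N v w \<and> hajnal_adj N u w"
  show False
  proof (cases "\<exists>S1 S2 S3. u = Sub S1 \<and> v = Sub S2 \<and> w = Sub S3")
    case True
    then obtain S1 S2 S3 where eq: "u = Sub S1" "v = Sub S2" "w = Sub S3"
      by blast
    have c: "(2 * l + 1) * card (odd_argmax N T) = l * fact N" if "T \<in> {S1, S2, S3}" for T
      using that S[of T] eq by (intro card_odd_argmax) auto
    have sub: "odd_argmax N T \<subseteq> {\<pi>. \<pi> permutes {..<N}}" for T
      by (auto simp: odd_argmax_def)
    have fin: "finite {\<pi>. \<pi> permutes {..<N}}"
      by (rule finite_permutations) simp
    have fT: "finite (odd_argmax N T)" for T
      using sub fin by (rule finite_subset)
    have "card (odd_argmax N S1 \<union> odd_argmax N S2 \<union> odd_argmax N S3) \<le> card {\<pi>. \<pi> permutes {..<N}}"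
      using sub by (intro card_mono fin) auto
    also have "\<dots> = fact N"
      by (rule card_permutations) auto
    also have "card (odd_argmax N S1 \<union> odd_argmax N S2 \<union> odd_argmax N S3)
        = card (odd_argmax N S1) + card (odd_argmax N S2) + card (odd_argmax N S3)"
      using adj eq fT by (subst card_Un_disjoint | auto)+
    finally have "(2 * l + 1) * (card (odd_argmax N S1) + card (odd_argmax N S2) + card (odd_argmax N S3))
        \<le> (2 * l + 1) * fact N"
      by (rule mult_le_mono2)
    moreover have "(2 * l + 1) * (card (odd_argmax N S1) + card (odd_argmax N S2) + card (odd_argmax N S3))
        = 3 * (l * fact N)"
      using c[of S1] c[of S2] c[of S3] by (simp only: distrib_left) simp
    ultimately have "3 * l * fact N \<le> (2 * l + 1) * fact N"
      by simp
    then have "3 * l \<le> 2 * l + 1"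
      by (simp only: mult_le_cancel2) simp
    then show False
      using l by simp
  next
    case False
    then show False
      using adj by (cases u; cases v; cases w) auto
  qed
qed

definition colourable :: "nat \<Rightarrow> 'a set \<Rightarrow> ('a \<times> 'a) set \<Rightarrow> bool" where
  "colourable f V A \<longleftrightarrow> (\<exists>\<phi> :: 'a \<Rightarrow> nat. (\<forall>v\<in>V. \<phi> v < f) \<and> (\<forall>(u, v)\<in>A. \<phi> u \<noteq> \<phi> v))"

text \<open>The inequality says that the minimum degree is almost
  \<open>(2 * r - 5) / (2 * r - 3)\<close> times the number of vertices. The bound \<open>m\<close>
  is a parameter because the step to larger \<open>r\<close> joins an independent set of precisely
  this size.\<close>

definition dense_uncolourable ::
  "nat \<Rightarrow> nat \<Rightarrow> real \<Rightarrow> 'a set \<Rightarrow> ('a \<times> 'a) set \<Rightarrow> nat \<Rightarrow> bool" where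
  "dense_uncolourable r f \<epsilon> V A m \<longleftrightarrow>
     finite V \<and> V \<noteq> {} \<and> sym A \<and> irrefl A \<and> A \<subseteq> V \<times> V \<and>
     \<not> (\<exists>K\<subseteq>V. is_clique A K \<and> card K = r) \<and> (\<forall>v\<in>V. card (V - A `` {v}) \<le> m) \<and>
     (2 * real r - 3) * real m \<le> (2 + \<epsilon>) * real (card V) \<and> \<not> colourable f V A"

lemma dense_uncolourable_base:
  assumes \<epsilon>: "0 < \<epsilon>"
  shows "\<exists>(V :: vertex set) A m. dense_uncolourable 3 f \<epsilon> V A m"
proof -
  \<comment> \<open>The density of \<open>odd_argmax\<close> falls short of one half by a term of
    order \<open>1 / l\<close>, which \<open>\<epsilon>\<close> has to absorb; the summand 2 secures
    \<open>l \<ge> 2\<close> for triangle-freeness.\<close>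
  define l where "l = nat \<lceil>1 / \<epsilon>\<rceil> + 2"
  have l2: "2 \<le> l"
    by (simp add: l_def)
  have "1 / \<epsilon> \<le> real l"
    unfolding l_def by linarith
  then have l\<epsilon>: "1 \<le> \<epsilon> * real l"
    using \<epsilon> by (simp add: divide_le_eq mult.commute)
  \<comment> \<open>Ramsey's theorem for \<open>(2 * l + 1)\<close>-sets yields a set
    \<open>H\<close> of just one more element whose large subsets share a colour.
    \<open>Suc f\<close> colours instead of \<open>f\<close> also admit a constant colouring when
    \<open>f = 0\<close>, from which \<open>C\<close> is seen to be non-empty.\<close>
  obtain N :: nat where N: "partn_lst {..<N} (replicate (Suc f) (2 * l + 2)) (2 * l + 1)"
    using ramsey_full[of "replicate (Suc f) (2 * l + 2)" "2 * l + 1"] by (elim exE)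
  define C where "C = nsets {..<N} (2 * l + 1)"
  define Om where "Om = {\<pi>. \<pi> permutes {..<N}}"
  define c where "c = card C"
  define M :: nat where "M = fact N"
  \<comment> \<open>The factor \<open>2 * l + 1\<close> clears the denominator of the density, and
    the size of \<open>t\<close> makes the \<open>c\<close> set vertices negligible. With
    \<open>2 * t * M\<close> permutation vertices and \<open>t * M\<close> auxiliary ones, vertices
    of every type have about a third of all vertices as neighbours, or more.\<close>
  define t where "t = (2 * l + 1) * c"
  define W where "W Q = (\<lambda>(\<pi>, i). Perm \<pi> i) ` (Q \<times> {..<2 * t})" for Q
  define U where "U = Aux ` {..<t * M}"
  define V where "V = Sub ` C \<union> W Om \<union> U"
  define A where "A = {(u, v). u \<in> V \<and> v \<in> V \<and> hajnal_adj N u v}"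
  \<comment> \<open>This is the bound attained for \<open>Sub S\<close>: \<open>c\<close> set
    vertices, \<open>t * M\<close> auxiliary ones, and \<open>(t + c) * M\<close> permutation
    vertices outside \<open>odd_argmax N S\<close>. The term \<open>c * M\<close> is the price for
    density below one half.\<close>
  define m where "m = c + 2 * t * M + c * M"
  have M1: "1 \<le> M"
    by (simp add: M_def)
  have fC: "finite C"
    unfolding C_def by (rule finite_imp_finite_nsets) simp
  have fOm: "finite Om"
    unfolding Om_def by (rule finite_permutations) simp
  have cOm: "card Om = M"
    unfolding Om_def M_def by (rule card_permutations) auto
  have fW: "finite (W Q)" if "Q \<subseteq> Om" for Q
    using finite_subset[OF that fOm] by (simp add: W_def)
  have cW: "card (W Q) = card Q * (2 * t)" for Q
    unfolding W_def by (subst card_image) (auto simp: inj_on_def card_cartesian_product)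
  have cS: "card (Sub ` C) = c"
    by (simp add: c_def card_image inj_on_def)
  have cU: "card U = t * M"
    by (simp add: U_def card_image inj_on_def)
  have fV: "finite V"
    using fC fW[OF order_refl] by (simp add: V_def U_def)
  have SC: "S \<subseteq> {..<N}" "card S = 2 * l + 1" if "Sub S \<in> V" for S
    using that by (auto simp: V_def C_def W_def U_def nsets_def)
  have cardV: "card V = c + 3 * t * M"
  proof -
    have "card V = card (Sub ` C \<union> W Om) + card U"
      unfolding V_def using fC fW[OF order_refl] by (intro card_Un_disjoint) (auto simp: U_def W_def)
    also have "card (Sub ` C \<union> W Om) = card (Sub ` C) + card (W Om)"
      using fC fW[OF order_refl] by (intro card_Un_disjoint) (auto simp: W_def)
    finally show ?thesis
      by (simp add: cS cW cU cOm)
  qed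
  have argmax: "(2 * l + 1) * card (odd_argmax N S) = l * M" if "Sub S \<in> V" for S
    unfolding M_def using SC[OF that] by (rule card_odd_argmax)
  have oOm: "odd_argmax N S \<subseteq> Om" for S
    by (auto simp: odd_argmax_def Om_def)
  have mono_pair: "\<exists>S S'. S \<in> C \<and> S' \<in> C \<and> col S = (col S' :: nat) \<and> odd_argmax N S \<inter> odd_argmax N S' = {}"
    if col: "\<And>S. S \<in> C \<Longrightarrow> col S < Suc f" for col
  proof -
    have "col \<in> nsets {..<N} (2 * l + 1) \<rightarrow> {..<Suc f}"
      using col by (auto simp: C_def)
    then obtain i H where i: "i < length (replicate (Suc f) (2 * l + 2))"
      and H: "H \<in> nsets {..<N} (replicate (Suc f) (2 * l + 2) ! i)" "col ` nsets H (2 * l + 1) \<subseteq> {i}"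
      by (rule partn_lstE[OF N]) simp
    have "replicate (Suc f) (2 * l + 2) ! i = 2 * l + 2"
      using i by (simp del: replicate_Suc)
    then have H2: "H \<subseteq> {..<N}" "finite H" "card H = 2 * l + 2"
      using H(1) by (auto simp: nsets_def)
    have mem: "H - {x} \<in> nsets H (2 * l + 1)" "H - {x} \<in> C" if "x \<in> H" for x
      using that H2 by (auto simp: nsets_def C_def)
    have "H \<noteq> {}"
      using H2(3) by auto
    then have "Max H \<in> H" "Min H \<in> H"
      using H2(2) by simp_all
    then have "col (H - {Max H}) = i" "col (H - {Min H}) = i" "H - {Max H} \<in> C" "H - {Min H} \<in> C"
      using mem H(2) by blast+
    then show ?thesis
      using odd_argmax_shift_disjoint[OF H2(2,3)] by metis
  qed
  have "C \<noteq> {}"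
    using mono_pair[of "\<lambda>_. 0"] by auto
  have "sym A"
    by (auto simp: sym_def A_def hajnal_adj_sym)
  moreover have "irrefl A"
  proof (rule irreflI)
    fix v
    have "\<not> hajnal_adj N v v" if v: "v \<in> V"
    proof (cases v)
      case (Sub S)
      have "card (odd_argmax N S) \<noteq> 0"
        using argmax[of S] v Sub l2 M1 by (intro notI) auto
      then have "odd_argmax N S \<noteq> {}"
        by auto
      then show ?thesis
        using Sub by simp
    qed auto
    then show "(v, v) \<notin> A"
      by (auto simp: A_def)
  qed
  moreover have "\<not> (\<exists>K\<subseteq>V. is_clique A K \<and> card K = 3)"
  proof
    assume "\<exists>K\<subseteq>V. is_clique A K \<and> card K = 3"
    then obtain K where K: "K \<subseteq> V" "is_clique A K" "card K = 3"
      by blast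
    obtain u v w where uvw: "K = {u, v, w}" "u \<noteq> v" "v \<noteq> w" "u \<noteq> w"
      using K(3) unfolding card_3_iff by blast
    have "hajnal_adj N u v" "hajnal_adj N v w" "hajnal_adj N u w"
      using K(2) uvw by (auto simp: is_clique_def A_def)
    moreover have "S \<subseteq> {..<N} \<and> card S = 2 * l + 1" if "Sub S \<in> {u, v, w}" for S
      using that K(1) uvw(1) SC[of S] by blast
    ultimately show False
      using hajnal_adj_no_triangle[OF l2, of u v w N] by simp
  qed
  moreover have "card (V - A `` {v}) \<le> m" if v: "v \<in> V" for v
  proof (cases v)
    case (Sub S)
    have "V - A `` {v} \<subseteq> Sub ` C \<union> W (Om - odd_argmax N S) \<union> U"
      using v unfolding V_def A_def Sub W_def by auto
    then have "card (V - A `` {v}) \<le> card (Sub ` C \<union> W (Om - odd_argmax N S) \<union> U)"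
      using fC fW[of "Om - odd_argmax N S"] by (intro card_mono) (auto simp: U_def)
    also have "\<dots> \<le> card (Sub ` C) + card (W (Om - odd_argmax N S)) + card U"
      by (meson add_right_mono card_Un_le order_trans)
    also have "\<dots> = c + (M - card (odd_argmax N S)) * (2 * t) + t * M"
      using card_Diff_subset[OF finite_subset[OF oOm fOm] oOm, of S] by (simp add: cS cW cU cOm)
    also have "\<dots> = c + 2 * c * ((2 * l + 1) * M - (2 * l + 1) * card (odd_argmax N S)) + t * M"
      by (simp only: t_def diff_mult_distrib[symmetric] mult_ac)
    also have "\<dots> = c + 2 * c * ((l + 1) * M) + t * M"
      using argmax[of S] v Sub by simp
    also have "\<dots> = m"
      by (simp add: m_def t_def algebra_simps)
    finally show ?thesis .
  next
    case (Perm \<pi> i)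
    have "V - A `` {v} \<subseteq> Sub ` C \<union> W Om"
      using v unfolding V_def A_def Perm U_def by auto
    then have "card (V - A `` {v}) \<le> card (Sub ` C \<union> W Om)"
      using fC fW[OF order_refl] by (intro card_mono) auto
    also have "\<dots> \<le> card (Sub ` C) + card (W Om)"
      by (rule card_Un_le)
    finally show ?thesis
      by (simp add: cS cW cOm m_def algebra_simps)
  next
    case (Aux j)
    have "V - A `` {v} \<subseteq> Sub ` C \<union> U"
      using v unfolding V_def A_def Aux W_def by auto
    then have "card (V - A `` {v}) \<le> card (Sub ` C \<union> U)"
      using fC by (intro card_mono) (auto simp: U_def)
    also have "\<dots> \<le> card (Sub ` C) + card U"
      by (rule card_Un_le)
    finally show ?thesis
      by (simp add: cS cU m_def algebra_simps)
  qed
  moreover have "(2 * real 3 - 3) * real m \<le> (2 + \<epsilon>) * real (card V)"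
  proof -
    have "real c * real M \<le> \<epsilon> * real l * (real c * real M)"
      using mult_right_mono[OF l\<epsilon>, of "real c * real M"] by simp
    moreover have "real c \<le> real c * real M"
      using mult_left_mono[of 1 "real M" "real c"] M1 by simp
    moreover have "0 \<le> \<epsilon> * real c" "0 \<le> \<epsilon> * (real c * real M)"
      using \<epsilon> by simp_all
    moreover have "real m = real c + (4 * real l + 3) * (real c * real M)"
      "real (card V) = real c + (6 * real l + 3) * (real c * real M)"
      by (simp_all add: m_def cardV t_def algebra_simps)
    ultimately show ?thesis
      by (simp add: algebra_simps)
  qed
  moreover have "\<not> colourable f V A"
  proof
    assume "colourable f V A"
    then obtain \<phi> :: "vertex \<Rightarrow> nat" where \<phi>: "\<forall>v\<in>V. \<phi> v < f" "\<forall>(u, v)\<in>A. \<phi> u \<noteq> \<phi> v"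
      unfolding colourable_def by blast
    have SV: "Sub S \<in> V" if "S \<in> C" for S
      using that by (simp add: V_def)
    obtain S S' where S: "S \<in> C" "S' \<in> C" "\<phi> (Sub S) = \<phi> (Sub S')" "odd_argmax N S \<inter> odd_argmax N S' = {}"
      using mono_pair[of "\<lambda>S. \<phi> (Sub S)"] \<phi>(1) SV by (metis less_SucI)
    then have "(Sub S, Sub S') \<in> A"
      using SV by (simp add: A_def)
    then show False
      using \<phi>(2) S(3) by auto
  qed
  moreover have "V \<noteq> {}"
    using \<open>C \<noteq> {}\<close> by (auto simp: V_def)
  moreover have "A \<subseteq> V \<times> V"
    by (auto simp: A_def)
  ultimately show ?thesis
    using fV unfolding dense_uncolourable_def by (intro exI[of _ V] exI[of _ A] exI[of _ m]) simp
qed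

section \<open>From triangle-free graphs to larger forbidden cliques\<close>

lemma dense_uncolourable_image:
  assumes G: "dense_uncolourable r f \<epsilon> V A m" and \<beta>: "inj_on \<beta> V"
  shows "dense_uncolourable r f \<epsilon> (\<beta> ` V) (map_prod \<beta> \<beta> ` A) m"
proof -
  have V: "finite V" "V \<noteq> {}" "sym A" "irrefl A" and AV: "A \<subseteq> V \<times> V"
    and noK: "\<not> (\<exists>K\<subseteq>V. is_clique A K \<and> card K = r)" and miss: "\<forall>v\<in>V. card (V - A `` {v}) \<le> m"
    and d: "(2 * real r - 3) * real m \<le> (2 + \<epsilon>) * real (card V)" and nc: "\<not> colourable f V A"
    using G unfolding dense_uncolourable_def by simp_all
  define B where "B = map_prod \<beta> \<beta> ` A"
  have B_iff: "(\<beta> u, \<beta> v) \<in> B \<longleftrightarrow> (u, v) \<in> A" if "u \<in> V" "v \<in> V" for u v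
  proof
    assume "(\<beta> u, \<beta> v) \<in> B"
    then obtain a b where ab: "(a, b) \<in> A" "\<beta> u = \<beta> a" "\<beta> v = \<beta> b"
      by (auto simp: B_def)
    then have "u = a" "v = b"
      using inj_onD[OF \<beta>] AV that by blast+
    then show "(u, v) \<in> A"
      using ab(1) by simp
  next
    assume "(u, v) \<in> A"
    then show "(\<beta> u, \<beta> v) \<in> B"
      unfolding B_def by (rule image_eqI[rotated]) simp
  qed
  have BV: "B \<subseteq> \<beta> ` V \<times> \<beta> ` V"
    using AV by (auto simp: B_def)
  have "sym B"
    using V(3) by (fastforce simp: B_def sym_def)
  moreover have "irrefl B"
  proof (rule irreflI, rule notI)
    fix x
    assume x: "(x, x) \<in> B"
    then obtain v where "v \<in> V" "x = \<beta> v"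
      using BV by auto
    then show False
      using x B_iff V(4) by (auto simp: irrefl_def)
  qed
  moreover have "\<not> (\<exists>K\<subseteq>\<beta> ` V. is_clique B K \<and> card K = r)"
  proof
    assume "\<exists>K\<subseteq>\<beta> ` V. is_clique B K \<and> card K = r"
    then obtain K where K: "K \<subseteq> \<beta> ` V" "is_clique B K" "card K = r"
      by blast
    then obtain K' where K': "K' \<subseteq> V" "K = \<beta> ` K'"
      by (meson subset_image_iff)
    have inj: "inj_on \<beta> K'"
      using \<beta> K'(1) by (rule inj_on_subset)
    have "is_clique A K'"
      unfolding is_clique_def
    proof (intro ballI impI)
      fix x y
      assume xy: "x \<in> K'" "y \<in> K'" "x \<noteq> y"
      then have "\<beta> x \<noteq> \<beta> y"
        using inj by (auto dest: inj_onD)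
      then show "(x, y) \<in> A"
        using K(2) K' xy B_iff[of x y] by (auto simp: is_clique_def)
    qed
    moreover have "card K' = r"
      using K(3) K'(2) inj by (simp add: card_image)
    ultimately show False
      using noK K'(1) by blast
  qed
  moreover have "\<forall>x\<in>\<beta> ` V. card (\<beta> ` V - B `` {x}) \<le> m"
  proof
    fix x
    assume "x \<in> \<beta> ` V"
    then obtain v where v: "v \<in> V" "x = \<beta> v"
      by blast
    have "\<beta> ` V - B `` {x} \<subseteq> \<beta> ` (V - A `` {v})"
      using v B_iff by auto
    then have "card (\<beta> ` V - B `` {x}) \<le> card (\<beta> ` (V - A `` {v}))"
      using V(1) by (intro card_mono) auto
    also have "\<dots> \<le> card (V - A `` {v})"
      using V(1) by (intro card_image_le) auto
    finally show "card (\<beta> ` V - B `` {x}) \<le> m"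
      using miss v(1) by force
  qed
  moreover have "\<not> colourable f (\<beta> ` V) B"
  proof
    assume "colourable f (\<beta> ` V) B"
    then obtain \<phi> :: "'b \<Rightarrow> nat" where \<phi>: "\<forall>v\<in>\<beta> ` V. \<phi> v < f" "\<forall>(u, v)\<in>B. \<phi> u \<noteq> \<phi> v"
      unfolding colourable_def by (elim exE conjE)
    have "(\<forall>v\<in>V. (\<phi> \<circ> \<beta>) v < f) \<and> (\<forall>(u, v)\<in>A. (\<phi> \<circ> \<beta>) u \<noteq> (\<phi> \<circ> \<beta>) v)"
      using \<phi> by (auto simp: B_def)
    then have "colourable f V A"
      unfolding colourable_def by (rule exI[of _ "\<phi> \<circ> \<beta>"])
    then show False
      using nc by simp
  qed
  moreover have "card (\<beta> ` V) = card V"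
    using \<beta> by (rule card_image)
  ultimately show ?thesis
    using V(1,2) BV d unfolding dense_uncolourable_def B_def by simp
qed

text \<open>The new independent set \<open>J\<close> has \<open>m\<close> vertices, so its members
  miss exactly what is allowed and old vertices miss nothing new. Increasing \<open>r\<close> adds
  \<open>2 * m\<close> on the left of the density inequality, and the vertices of \<open>J\<close>
  add at least as much on the right.\<close>

lemma dense_uncolourable_join:
  fixes V :: "nat set"
  assumes G: "dense_uncolourable r f \<epsilon> V A m" and \<epsilon>: "0 \<le> \<epsilon>"
  shows "\<exists>(V' :: nat set) A'. dense_uncolourable (Suc r) f \<epsilon> V' A' m"
proof -
  have V: "finite V" "V \<noteq> {}" "sym A" "irrefl A" and AV: "A \<subseteq> V \<times> V"
    and noK: "\<not> (\<exists>K\<subseteq>V. is_clique A K \<and> card K = r)" and miss: "\<forall>v\<in>V. card (V - A `` {v}) \<le> m"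
    and d: "(2 * real r - 3) * real m \<le> (2 + \<epsilon>) * real (card V)" and nc: "\<not> colourable f V A"
    using G unfolding dense_uncolourable_def by simp_all
  define J where "J = {Suc (Max V)..<Suc (Max V) + m}"
  have J: "finite J" "card J = m" "V \<inter> J = {}"
    using V(1) by (auto simp: J_def Suc_le_eq dest: Max_ge)
  define V' where "V' = V \<union> J"
  define A' where "A' = A \<union> V \<times> J \<union> J \<times> V"
  have cV': "card V' = card V + m"
    unfolding V'_def using card_Un_disjoint[OF V(1) J(1,3)] J(2) by simp
  have "sym A'"
    using V(3) by (auto simp: A'_def sym_def)
  moreover have "irrefl A'"
    using V(4) J(3) by (auto simp: A'_def irrefl_def)
  moreover have "\<not> (\<exists>K\<subseteq>V'. is_clique A' K \<and> card K = Suc r)"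
  proof
    assume "\<exists>K\<subseteq>V'. is_clique A' K \<and> card K = Suc r"
    then obtain K where K: "K \<subseteq> V'" "is_clique A' K" "card K = Suc r"
      by blast
    have fK: "finite K"
      using K(1) V(1) J(1) by (auto simp: V'_def intro: finite_subset)
    have KV: "is_clique A (K \<inter> V)"
      using K(2) J(3) unfolding is_clique_def A'_def by blast
    have "card (K \<inter> J) \<le> 1"
    proof (rule ccontr)
      assume "\<not> ?thesis"
      then obtain x y where "x \<in> K \<inter> J" "y \<in> K \<inter> J" "x \<noteq> y"
        using fK card_le_Suc0_iff_eq[of "K \<inter> J"] by auto
      then show False
        using K(2) J(3) AV unfolding is_clique_def A'_def by blast
    qed
    moreover have "K = (K \<inter> V) \<union> (K \<inter> J)"
      using K(1) by (auto simp: V'_def)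
    then have "card K \<le> card (K \<inter> V) + card (K \<inter> J)"
      by (metis card_Un_le)
    ultimately have "r \<le> card (K \<inter> V)"
      using K(3) by simp
    then obtain K' where "K' \<subseteq> K \<inter> V" "card K' = r"
      by (meson obtain_subset_with_card_n)
    then show False
      using noK is_clique_subset[OF KV] by blast
  qed
  moreover have "\<forall>v\<in>V'. card (V' - A' `` {v}) \<le> m"
  proof
    fix v
    assume v: "v \<in> V'"
    show "card (V' - A' `` {v}) \<le> m"
    proof (cases "v \<in> V")
      case True
      have "V' - A' `` {v} \<subseteq> V - A `` {v}"
        using True by (auto simp: V'_def A'_def)
      then have "card (V' - A' `` {v}) \<le> card (V - A `` {v})"
        using V(1) by (intro card_mono) auto
      then show ?thesis
        using miss True by force
    next
      case False
      have "V' - A' `` {v} \<subseteq> J"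
        using v False by (auto simp: V'_def A'_def)
      then show ?thesis
        using card_mono[OF J(1)] J(2) by simp
    qed
  qed
  moreover have "(2 * real (Suc r) - 3) * real m \<le> (2 + \<epsilon>) * real (card V')"
  proof -
    have "0 \<le> \<epsilon> * real m"
      using \<epsilon> by simp
    then show ?thesis
      using d by (simp add: cV' algebra_simps)
  qed
  moreover have "\<not> colourable f V' A'"
  proof
    assume "colourable f V' A'"
    then obtain \<phi> :: "nat \<Rightarrow> nat" where \<phi>: "\<forall>v\<in>V'. \<phi> v < f" "\<forall>(u, v)\<in>A'. \<phi> u \<noteq> \<phi> v"
      unfolding colourable_def by (elim exE conjE)
    have "(\<forall>v\<in>V. \<phi> v < f) \<and> (\<forall>(u, v)\<in>A. \<phi> u \<noteq> \<phi> v)"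
      using \<phi> by (auto simp: V'_def A'_def)
    then have "colourable f V A"
      unfolding colourable_def by (rule exI[of _ \<phi>])
    then show False
      using nc by simp
  qed
  moreover have "finite V'" "V' \<noteq> {}" "A' \<subseteq> V' \<times> V'"
    using V(1,2) J(1) AV by (auto simp: V'_def A'_def)
  ultimately show ?thesis
    unfolding dense_uncolourable_def by (intro exI[of _ V'] exI[of _ A']) simp
qed

lemma dense_uncolourable_exists:
  assumes "3 \<le> r" "0 < \<epsilon>"
  shows "\<exists>(V :: nat set) A m. dense_uncolourable r f \<epsilon> V A m"
  using assms(1)
proof (induction r rule: dec_induct)
  case base
  obtain V :: "vertex set" and A m where G: "dense_uncolourable 3 f \<epsilon> V A m"
    using dense_uncolourable_base[OF assms(2), of f] by (elim exE)
  then have fV: "finite V"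
    by (simp add: dense_uncolourable_def)
  obtain \<beta> :: "vertex \<Rightarrow> nat" where \<beta>: "inj_on \<beta> V"
    using finite_imp_inj_to_nat_seg[OF fV] by (elim exE conjE)
  show ?case
    using dense_uncolourable_image[OF G \<beta>] by (intro exI)
next
  case (step r)
  then show ?case
    using dense_uncolourable_join assms(2) by (metis less_imp_le)
qed

section \<open>The threshold\<close>

lemma out_degree_eq: "out_degree (with_proj G) v = card (parcs G `` {v})"
proof -
  have "snd ` {e \<in> parcs G. fst e = v} = parcs G `` {v}"
    by force
  moreover have "card (snd ` {e \<in> parcs G. fst e = v}) = card {e \<in> parcs G. fst e = v}"
    by (rule card_image) (auto simp: inj_on_def)
  ultimately show ?thesis
    by (simp add: out_degree_def out_arcs_def)
qed

lemma threshold_upper: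
  assumes r: "3 \<le> r" and k: "1 \<le> k" and s: "1 \<le> s" "s \<le> r" and \<epsilon>: "0 < \<epsilon>"
  shows "\<exists>F :: nat pair_pre_digraph. pair_graph F \<and> free_of (T_graph r k s) F \<and>
    (\<forall>G :: nat pair_pre_digraph. pair_graph G \<and> free_of (T_graph r k s) G \<and>
       real (min_degree G) \<ge> ((2 * real r - 5) / (2 * real r - 3) + \<epsilon>) * real (card (pverts G))
       \<longrightarrow> homomorphic_to G F)"
proof -
  define \<theta> where "\<theta> = (2 * real r - 5) / (2 * real r - 3)"
  \<comment> \<open>The bounded-image result needs a slack of at most 1, and a smaller slack only
    weakens the density hypothesis.\<close>
  define \<epsilon>' where "\<epsilon>' = min \<epsilon> 1"
  have \<epsilon>': "0 < \<epsilon>'" "\<epsilon>' \<le> 1" "\<epsilon>' \<le> \<epsilon>"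
    using \<epsilon> by (auto simp: \<epsilon>'_def)
  have free: "free_of (T_graph r k s) G \<longleftrightarrow> \<not> clique_flower r k s (pverts G) (parcs G)" if "pair_graph G"
    for G :: "nat pair_pre_digraph"
    using contains_T_graph_iff[OF that k s(2)] by (simp add: free_of_def)
  obtain N where N: "\<forall>(V :: nat set) A m.
    finite V \<and> sym A \<and> irrefl A \<and> A \<subseteq> V \<times> V \<and> \<not> clique_flower r k s V A \<and>
    (\<forall>v\<in>V. real (card (V - A `` {v})) \<le> m) \<and>
    (2 * real r - 3) * m + \<epsilon>' * real (card V) \<le> 2 * real (card V)
    \<longrightarrow> (\<exists>V' A' \<phi>. V' \<subseteq> V \<and> card V' \<le> N \<and> \<phi> ` V \<subseteq> V' \<and> (\<forall>(x, y)\<in>A. (\<phi> x, \<phi> y) \<in> A') \<and>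
          sym A' \<and> irrefl A' \<and> A' \<subseteq> V' \<times> V' \<and> \<not> clique_flower r k s V' A')"
    using bounded_flower_free_image[OF r k s \<epsilon>'(1,2)] by (elim exE)
  obtain F :: "nat pair_pre_digraph" where F: "pair_graph F" "\<not> clique_flower r k s (pverts F) (parcs F)"
    and univ: "\<forall>H :: nat pair_pre_digraph. pair_graph H \<and> \<not> clique_flower r k s (pverts H) (parcs H) \<and> pverts H \<subseteq> {..<N}
       \<longrightarrow> homomorphic_to H F"
    using flower_free_universal[OF k s(1), of r N] by (elim exE conjE)
  have "homomorphic_to G F" if G: "pair_graph G" "free_of (T_graph r k s) G"
    "real (min_degree G) \<ge> (\<theta> + \<epsilon>) * real (card (pverts G))" for G :: "nat pair_pre_digraph"
  proof -
    define V where "V = pverts G"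
    define A where "A = parcs G"
    define n where "n = real (card V)"
    define m where "m = n - (\<theta> + \<epsilon>) * n"
    have GV: "finite V" "A \<subseteq> V \<times> V" "sym A" "irrefl A" "\<not> clique_flower r k s V A"
      using G(1,2) free[OF G(1)] by (auto simp: pair_graph_iff V_def A_def)
    have miss: "\<forall>v\<in>V. real (card (V - A `` {v})) \<le> m"
    proof
      fix v
      assume v: "v \<in> V"
      have "min_degree G \<le> out_degree (with_proj G) v"
        unfolding min_degree_def using v GV(1) by (intro Min_le) (auto simp: V_def)
      then have "(\<theta> + \<epsilon>) * n \<le> real (card (A `` {v}))"
        using G(3) by (simp add: out_degree_eq A_def V_def n_def)
      moreover have "card (V - A `` {v}) = card V - card (A `` {v})"
        using GV(1,2) by (intro card_Diff_subset) (auto intro: finite_subset)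
      moreover have "card (A `` {v}) \<le> card V"
        using GV(1,2) by (intro card_mono) auto
      ultimately show "real (card (V - A `` {v})) \<le> m"
        by (simp add: m_def n_def)
    qed
    have "(2 * real r - 3) * m + \<epsilon>' * n \<le> 2 * n"
    proof -
      \<comment> \<open>In other words \<open>(2 * r - 3) * (1 - \<theta>) = 2\<close>, which links
        the threshold to the density condition on missed vertices.\<close>
      have "(2 * real r - 3) * \<theta> = 2 * real r - 5"
        using r by (simp add: \<theta>_def)
      then have "(2 * real r - 3) * (1 - (\<theta> + \<epsilon>)) = 2 - (2 * real r - 3) * \<epsilon>"
        by (simp add: algebra_simps)
      moreover have "1 * \<epsilon>' \<le> (2 * real r - 3) * \<epsilon>"
        using r \<epsilon>' by (intro mult_mono) auto
      ultimately have "(2 * real r - 3) * (1 - (\<theta> + \<epsilon>)) + \<epsilon>' \<le> 2"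
        by linarith
      then have "((2 * real r - 3) * (1 - (\<theta> + \<epsilon>)) + \<epsilon>') * n \<le> 2 * n"
        by (rule mult_right_mono) (simp add: n_def)
      then show ?thesis
        by (simp add: m_def algebra_simps)
    qed
    then have "\<exists>V' A' \<phi>. V' \<subseteq> V \<and> card V' \<le> N \<and> \<phi> ` V \<subseteq> V' \<and> (\<forall>(x, y)\<in>A. (\<phi> x, \<phi> y) \<in> A') \<and>
          sym A' \<and> irrefl A' \<and> A' \<subseteq> V' \<times> V' \<and> \<not> clique_flower r k s V' A'"
      using GV miss by (intro N[rule_format]) (simp add: n_def)
    then obtain V' A' \<phi> where V': "V' \<subseteq> V" "card V' \<le> N" "\<phi> ` V \<subseteq> V'" "\<forall>(x, y)\<in>A. (\<phi> x, \<phi> y) \<in> A'"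
      "sym A'" "irrefl A'" "A' \<subseteq> V' \<times> V'" "\<not> clique_flower r k s V' A'"
      by (elim exE conjE)
    have fV': "finite V'"
      using V'(1) GV(1) by (rule finite_subset)
    obtain \<beta> where \<beta>: "bij_betw \<beta> V' {..<card V'}"
      using ex_bij_betw_finite_nat[OF fV'] by (auto simp: atLeast0LessThan)
    define H where "H = \<lparr>pverts = \<beta> ` V', parcs = map_prod \<beta> \<beta> ` A'\<rparr>"
    have inj: "inj_on \<beta> V'"
      using \<beta> by (rule bij_betw_imp_inj_on)
    have H_iff: "(\<beta> x, \<beta> y) \<in> map_prod \<beta> \<beta> ` A' \<longleftrightarrow> (x, y) \<in> A'" if "x \<in> V'" "y \<in> V'" for x y
    proof
      assume "(\<beta> x, \<beta> y) \<in> map_prod \<beta> \<beta> ` A'"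
      then obtain a b where ab: "(a, b) \<in> A'" "\<beta> x = \<beta> a" "\<beta> y = \<beta> b"
        by auto
      then have "x = a" "y = b"
        using inj_onD[OF inj] V'(7) that by blast+
      then show "(x, y) \<in> A'"
        using ab(1) by simp
    qed auto
    have pH: "pair_graph H"
      unfolding pair_graph_iff
    proof (intro conjI)
      show "finite (pverts H)" "parcs H \<subseteq> pverts H \<times> pverts H"
        using fV' V'(7) by (auto simp: H_def)
      show "sym (parcs H)"
        using V'(5) by (fastforce simp: H_def sym_def)
      show "irrefl (parcs H)"
      proof (rule irreflI, rule notI)
        fix x
        assume x: "(x, x) \<in> parcs H"
        then obtain v where "v \<in> V'" "x = \<beta> v"
          using V'(7) by (auto simp: H_def)
        then show False
          using x H_iff V'(6) by (auto simp: irrefl_def H_def)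
      qed
    qed
    have "\<not> clique_flower r k s (pverts H) (parcs H)"
    proof
      assume flower: "clique_flower r k s (pverts H) (parcs H)"
      define g where "g = the_inv_into V' \<beta>"
      have g: "inj_on g (\<beta> ` V')" "g ` (\<beta> ` V') = V'"
        using inj by (auto simp: g_def inj_on_the_inv_into the_inv_into_onto the_inv_into_f_f)
      have gA: "(g x, g y) \<in> A'" if xy: "(x, y) \<in> parcs H" for x y
      proof -
        obtain a b where "(a, b) \<in> A'" "x = \<beta> a" "y = \<beta> b"
          using xy by (auto simp: H_def)
        moreover from this have "g x = a" "g y = b"
          using V'(7) inj by (auto simp: g_def the_inv_into_f_f)
        ultimately show ?thesis
          by simp
      qed
      have "clique_flower r k s V' A'"
        by (rule clique_flower_inj_hom[OF flower k _ _ gA]) (use g in \<open>simp_all add: H_def\<close>)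
      then show False
        using V'(8) by simp
    qed
    moreover have "pverts H \<subseteq> {..<N}"
      using bij_betw_imp_surj_on[OF \<beta>] V'(2) by (simp add: H_def)
    ultimately have "homomorphic_to H F"
      using univ pH by simp
    then obtain h where h: "\<forall>v\<in>pverts H. h v \<in> pverts F" "\<forall>(u, v)\<in>parcs H. (h u, h v) \<in> parcs F"
      unfolding homomorphic_to_def graph_hom_def by (elim exE conjE)
    have "graph_hom (h \<circ> \<beta> \<circ> \<phi>) G F"
      unfolding graph_hom_def
    proof (intro conjI ballI)
      fix v
      assume "v \<in> pverts G"
      then have "\<phi> v \<in> V'"
        using V'(3) by (auto simp: V_def)
      then show "(h \<circ> \<beta> \<circ> \<phi>) v \<in> pverts F"
        using h(1) by (simp add: H_def)
    next
      fix e
      assume e: "e \<in> parcs G"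
      obtain u v where uv: "e = (u, v)"
        by fastforce
      then have "(\<phi> u, \<phi> v) \<in> A'"
        using e V'(4) by (auto simp: A_def)
      then have "(\<beta> (\<phi> u), \<beta> (\<phi> v)) \<in> parcs H"
        unfolding H_def by (auto intro: image_eqI[of _ _ "(\<phi> u, \<phi> v)"])
      then show "case e of (u, v) \<Rightarrow> ((h \<circ> \<beta> \<circ> \<phi>) u, (h \<circ> \<beta> \<circ> \<phi>) v) \<in> parcs F"
        using h(2) uv by auto
    qed
    then show ?thesis
      unfolding homomorphic_to_def by (rule exI[of _ "h \<circ> \<beta> \<circ> \<phi>"])
  qed
  then show ?thesis
    using F free[OF F(1)] by (intro exI[of _ F]) (simp add: \<theta>_def)
qed

text \<open>As \<open>F\<close> has no loops, a homomorphism into \<open>F\<close> properly colours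
  the graph with \<open>card (pverts F)\<close> colours. A dense graph that needs more colours and
  has no \<open>r\<close>-clique at all is therefore a counterexample.\<close>

lemma threshold_lower:
  fixes F :: "nat pair_pre_digraph"
  assumes r: "3 \<le> r" and k: "1 \<le> k" and s: "s \<le> r" and F: "pair_graph F"
    and \<alpha>: "\<alpha> < (2 * real r - 5) / (2 * real r - 3)"
  shows "\<exists>G :: nat pair_pre_digraph. pair_graph G \<and> free_of (T_graph r k s) G \<and>
    real (min_degree G) \<ge> \<alpha> * real (card (pverts G)) \<and> \<not> homomorphic_to G F"
proof -
  \<comment> \<open>Chosen so that \<open>(2 * r - 3) * (1 - \<alpha>) = 2 + \<epsilon>\<close>, the
    form in which density enters \<open>dense_uncolourable\<close>.\<close>
  define \<epsilon> where "\<epsilon> = (2 * real r - 5) - (2 * real r - 3) * \<alpha>"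
  have \<epsilon>: "0 < \<epsilon>"
    using \<alpha> r by (simp add: \<epsilon>_def less_divide_eq mult.commute)
  have finF: "finite (pverts F)" and loopF: "irrefl (parcs F)"
    using F by (simp_all add: pair_graph_iff)
  obtain V :: "nat set" and A m where G: "dense_uncolourable r (card (pverts F)) \<epsilon> V A m"
    using dense_uncolourable_exists[OF r \<epsilon>, of "card (pverts F)"] by (elim exE)
  then have V: "finite V" "V \<noteq> {}" "sym A" "irrefl A" "A \<subseteq> V \<times> V"
    and noK: "\<not> (\<exists>K\<subseteq>V. is_clique A K \<and> card K = r)" and miss: "\<forall>v\<in>V. card (V - A `` {v}) \<le> m"
    and d: "(2 * real r - 3) * real m \<le> (2 + \<epsilon>) * real (card V)"
    and nc: "\<not> colourable (card (pverts F)) V A"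
    unfolding dense_uncolourable_def by simp_all
  define H where "H = \<lparr>pverts = V, parcs = A\<rparr>"
  have pH: "pair_graph H"
    using V by (simp add: pair_graph_iff H_def)
  moreover have "free_of (T_graph r k s) H"
  proof -
    have "\<not> clique_flower r k s V A"
    proof
      assume "clique_flower r k s V A"
      then obtain L :: "nat \<Rightarrow> nat set" where "\<forall>j\<in>{1..k}. L j \<subseteq> V \<and> is_clique A (L j) \<and> card (L j) = r"
        unfolding clique_flower_def by blast
      then have "L 1 \<subseteq> V \<and> is_clique A (L 1) \<and> card (L 1) = r"
        using k by simp
      then show False
        using noK by blast
    qed
    then show ?thesis
      using contains_T_graph_iff[OF pH k s] by (simp add: free_of_def H_def)
  qed
  moreover have "real (min_degree H) \<ge> \<alpha> * real (card (pverts H))"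
  proof -
    have "min_degree H \<in> out_degree (with_proj H) ` pverts H"
      unfolding min_degree_def using V(1,2) by (intro Min_in) (auto simp: H_def)
    then obtain v where v: "v \<in> V" "min_degree H = card (A `` {v})"
      by (auto simp: H_def out_degree_eq)
    have "card (V - A `` {v}) = card V - card (A `` {v})"
      using V(1,5) by (intro card_Diff_subset) (auto intro: finite_subset)
    then have "card V \<le> m + min_degree H"
      using miss v by force
    then have "real (card V) \<le> real m + real (min_degree H)"
      by linarith
    then have "(2 * real r - 3) * real (card V) \<le> (2 * real r - 3) * (real m + real (min_degree H))"
      using r by (intro mult_left_mono) auto
    then have "(2 * real r - 3) * (\<alpha> * real (card V)) \<le> (2 * real r - 3) * real (min_degree H)"
      using d by (simp add: \<epsilon>_def algebra_simps)
    then show ?thesis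
      using r by (simp add: H_def)
  qed
  moreover have "\<not> homomorphic_to H F"
  proof
    assume "homomorphic_to H F"
    then obtain h where h: "\<forall>v\<in>V. h v \<in> pverts F" "\<forall>(u, v)\<in>A. (h u, h v) \<in> parcs F"
      unfolding homomorphic_to_def graph_hom_def H_def by auto
    obtain \<beta> where \<beta>: "bij_betw \<beta> (pverts F) {..<card (pverts F)}"
      using ex_bij_betw_finite_nat[OF finF] by (auto simp: atLeast0LessThan)
    have "(\<forall>v\<in>V. (\<beta> \<circ> h) v < card (pverts F)) \<and> (\<forall>(u, v)\<in>A. (\<beta> \<circ> h) u \<noteq> (\<beta> \<circ> h) v)"
    proof (intro conjI ballI)
      fix v
      assume "v \<in> V"
      then show "(\<beta> \<circ> h) v < card (pverts F)"
        using h(1) bij_betwE[OF \<beta>] by simp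
    next
      fix e
      assume e: "e \<in> A"
      obtain u v where uv: "e = (u, v)"
        by fastforce
      have "(h u, h v) \<in> parcs F"
        using h(2) e uv by auto
      then have "h u \<noteq> h v"
        using loopF by (auto simp: irrefl_def)
      moreover have "h u \<in> pverts F" "h v \<in> pverts F"
        using h(1) e uv V(5) by auto
      ultimately show "case e of (u, v) \<Rightarrow> (\<beta> \<circ> h) u \<noteq> (\<beta> \<circ> h) v"
        using bij_betw_imp_inj_on[OF \<beta>] uv by (auto dest: inj_onD)
    qed
    then have "colourable (card (pverts F)) V A"
      unfolding colourable_def by (rule exI[of _ "\<beta> \<circ> h"])
    then show False
      using nc by simp
  qed
  ultimately show ?thesis
    by (intro exI[of _ H]) simp
qed

theorem theorem1p1:
  fixes r k s :: nat
  assumes "r \<ge> 3" and "k \<ge> 1" and "1 \<le> s" and "s \<le> r"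
  shows "hom_threshold (T_graph r k s) = (2 * real r - 5) / (2 * real r - 3)"
proof -
  define \<theta> where "\<theta> = (2 * real r - 5) / (2 * real r - 3)"
  define S where "S = {\<alpha> :: real. \<alpha> \<ge> 0 \<and>
     (\<exists>F :: nat pair_pre_digraph. pair_graph F \<and> free_of (T_graph r k s) F \<and>
        (\<forall>G :: nat pair_pre_digraph.
           pair_graph G \<and> free_of (T_graph r k s) G \<and> real (min_degree G) \<ge> \<alpha> * real (card (pverts G))
             \<longrightarrow> homomorphic_to G F))}"
  have \<theta>0: "0 \<le> \<theta>"
    using assms(1) by (simp add: \<theta>_def)
  have upper: "\<theta> + \<epsilon> \<in> S" if "0 < \<epsilon>" for \<epsilon>
    using threshold_upper[OF assms that] \<theta>0 that by (simp add: S_def \<theta>_def)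
  have lower: "\<theta> \<le> \<alpha>" if \<alpha>: "\<alpha> \<in> S" for \<alpha>
  proof (rule ccontr)
    assume "\<not> \<theta> \<le> \<alpha>"
    then have lt: "\<alpha> < (2 * real r - 5) / (2 * real r - 3)"
      by (simp add: \<theta>_def)
    obtain F :: "nat pair_pre_digraph" where F: "pair_graph F"
      and hom: "\<forall>G :: nat pair_pre_digraph.
           pair_graph G \<and> free_of (T_graph r k s) G \<and> real (min_degree G) \<ge> \<alpha> * real (card (pverts G))
             \<longrightarrow> homomorphic_to G F"
      using \<alpha> unfolding S_def by (elim CollectE exE conjE)
    obtain G :: "nat pair_pre_digraph" where "pair_graph G" "free_of (T_graph r k s) G"
      "real (min_degree G) \<ge> \<alpha> * real (card (pverts G))" "\<not> homomorphic_to G F"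
      using threshold_lower[OF assms(1,2,4) F lt] by (elim exE conjE)
    then show False
      using hom by simp
  qed
  \<comment> \<open>Nothing is claimed about \<open>\<theta>\<close> itself lying in
    \<open>S\<close>; the infimum is only approached through
    \<open>\<theta> + \<epsilon>\<close>.\<close>
  have "Inf S = \<theta>"
  proof (rule antisym)
    show "\<theta> \<le> Inf S"
      using upper[of 1] by (intro cInf_greatest lower) auto
    have "Inf S \<le> \<theta> + \<epsilon>" if "0 < \<epsilon>" for \<epsilon>
      using upper[OF that] by (intro cInf_lower bdd_belowI[of S \<theta>] lower)
    then show "Inf S \<le> \<theta>"
      by (rule field_le_epsilon)
  qed
  then show ?thesis
    unfolding hom_threshold_def S_def \<theta>_def by simp
qed

end
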